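(* Let $1/2<a\le b<1$, let $R:[a,b]^2\to(0,\infty)$ be an asymptotic covariance and let $h:[0,\infty)\to[a,b]$. Assume that $R$ is three times continuously differentiable and that $h$ is two times continuously differentiable. Then the following equality of finite-dimensional distributions holds: $$\{\widetilde S_h(t)\}_{t\ge0}\stackrel{\mathcal D}{=}\left\{\widetilde W(t,h(t))-\int_0^t h'(\theta)\,\frac{\partial\widetilde W(\theta,H)}{\partial H}\bigg|_{H=h(\theta)}d\theta\right\}_{t\ge0},$$ where the right-hand side is always defined (for a suitable modification of $\widetilde W$).
   Context: For a centered Gaussian field $X=\{X_n(H):H\in(1/2,1),n\in\mathbb{N}\}$ consider: Assumption (i): for every $M>0$, the map $(j,k,H_1,H_2)\mapsto\mathbb{E}[X_j(H_1)X_k(H_2)]$ is bounded on $\{(j,k)\in\mathbb{N}^2:|j-k|\le M\}\times[a,b]^2$. Assumption (ii): there exists a continuous function $R:[a,b]^2\to(0,\infty)$ such that $$\lim_{j-k\to\infty}\ \sup_{(H_1,H_2)\in[a,b]^2}\left|(j-k)^{2-H_1-H_2}\,\mathbb{E}[X_j(H_1)X_k(H_2)]-R(H_1,H_2)\right|=0.$$ The function $R$ is then called the asymptotic covariance of $X$. A measurable bounded function $R:[a,b]^2\to(0,\infty)$ is called an asymptotic covariance if there exists a centered Gaussian field satisfying Assumption (ii) with $R$ as asymptotic covariance. $\mathcal{G}_R$ is the space of all centered Gaussian fields satisfying Assumptions (i) and (ii) with $R$ as asymptotic covariance. Fix $X\in\mathcal{G}_R$ and put $\mathcal{R}(t,s;H_1,H_2)=R(H_1,H_2)\mathbf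 1_{t\ge s}+R(H_2,H_1)\mathbf 1_{t<s}$. The process $\widetilde S_h=\{\widetilde S_h(t)\}_{t\ge0}$ is the limit in finite-dimensional distributions, as $N\to\infty$, of $\{\sum_{n=1}^{\lfloor Nt\rfloor}N^{-h(n/N)}X_n(h(n/N))\}_{t\ge 0}$; it is the centered Gaussian process with covariance $$\mathbb{E}[\widetilde S_h(t)\widetilde S_h(s)]=\int_0^t d\theta\int_0^s d\sigma\,\mathcal{R}(\theta,\sigma;h(\theta),h(\sigma))|\theta-\sigma|^{h(\theta)+h(\sigma)-2}.$$ The field $\widetilde W=\{\widetilde W(t,H)\}_{t\ge0,H\in[a,b]}$ is the limit in finite-dimensional distributions, as $N\to\infty$, of $\{N^{-H}\sum_{n=1}^{\lfloor Nt\rfloor}X_n(H)\}_{t,H}$; it is the centered Gaussian field with covariance $$\mathbb{E}[\widetilde W(t,H_1)\widetilde W(s,H_2)]=\frac{R(H_2,H_1)s^{H_1+H_2}+R(H_1,H_2)t^{H_1+H_2}-\mathcal{R}(t,s;H_1,H_2)|t-s|^{H_1+H_2}}{(H_1+H_2)(H_1+H_2-1)}.$$ *)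

theory Defs
  imports "HOL-Probability.Probability"
begin

text \<open>Point masses at \<open>0\<close> count as normal distributions (variance \<open>0\<close>).\<close>

definition centered_normal :: "'a measure \<Rightarrow> ('a \<Rightarrow> real) \<Rightarrow> bool" where
  "centered_normal M Y \<longleftrightarrow>
     Y \<in> borel_measurable M \<and>
     ((AE \<omega> in M. Y \<omega> = 0) \<or>
      (\<exists>\<sigma>>0. distributed M lborel Y (\<lambda>y. ennreal (normal_density 0 \<sigma> y))))"

definition centered_gaussian_field ::
  "'a measure \<Rightarrow> 'i set \<Rightarrow> ('i \<Rightarrow> 'a \<Rightarrow> real) \<Rightarrow> bool" where
  "centered_gaussian_field M I X \<longleftrightarrow>
     prob_space M \<and>
     (\<forall>J c. finite J \<and> J \<subseteq> I \<longrightarrow> centered_normal M (\<lambda>\<omega>. \<Sum>i\<in>J. c i * X i \<omega>))"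

definition fdd_equal ::
  "'i set \<Rightarrow> 'a measure \<Rightarrow> ('i \<Rightarrow> 'a \<Rightarrow> real) \<Rightarrow> 'b measure \<Rightarrow> ('i \<Rightarrow> 'b \<Rightarrow> real) \<Rightarrow> bool" where
  "fdd_equal I M X M' Y \<longleftrightarrow>
     (\<forall>i\<in>I. X i \<in> borel_measurable M) \<and> (\<forall>i\<in>I. Y i \<in> borel_measurable M') \<and>
     (\<forall>J. finite J \<and> J \<subseteq> I \<longrightarrow>
        distr M (\<Pi>\<^sub>M i\<in>J. borel) (\<lambda>\<omega>. \<lambda>i\<in>J. X i \<omega>) =
        distr M' (\<Pi>\<^sub>M i\<in>J. borel) (\<lambda>\<omega>. \<lambda>i\<in>J. Y i \<omega>))"

text \<open>
  Weak convergence of all finite-dimensional distributions. For finite \<open>J\<close>, the set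
  \<open>\<Pi>\<^sub>E i\<in>J. UNIV\<close> with the product topology is a copy of Euclidean space with
  coordinates indexed by \<open>J\<close>.
\<close>

definition fdd_converges ::
  "'i set \<Rightarrow> 'a measure \<Rightarrow> (nat \<Rightarrow> 'i \<Rightarrow> 'a \<Rightarrow> real) \<Rightarrow> 'b measure \<Rightarrow> ('i \<Rightarrow> 'b \<Rightarrow> real) \<Rightarrow> bool" where
  "fdd_converges I M X M' Y \<longleftrightarrow>
     (\<forall>N. \<forall>i\<in>I. X N i \<in> borel_measurable M) \<and> (\<forall>i\<in>I. Y i \<in> borel_measurable M') \<and>
     (\<forall>J (f :: ('i \<Rightarrow> real) \<Rightarrow> real).
        finite J \<and> J \<subseteq> I \<and>
        continuous_on (\<Pi>\<^sub>E i\<in>J. UNIV) f \<and> bounded (f ` (\<Pi>\<^sub>E i\<in>J. UNIV)) \<longrightarrow>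
        (\<lambda>N. LINT \<omega>|M. f (\<lambda>i\<in>J. X N i \<omega>)) \<longlonglongrightarrow> (LINT \<omega>|M'. f (\<lambda>i\<in>J. Y i \<omega>)))"

definition is_modification ::
  "'i set \<Rightarrow> 'a measure \<Rightarrow> ('i \<Rightarrow> 'a \<Rightarrow> real) \<Rightarrow> ('i \<Rightarrow> 'a \<Rightarrow> real) \<Rightarrow> bool" where
  "is_modification I M Y X \<longleftrightarrow>
     (\<forall>i\<in>I. Y i \<in> borel_measurable M \<and> (AE \<omega> in M. Y i \<omega> = X i \<omega>))"

text \<open>
  Derivatives are taken within \<open>S\<close>, so they are one-sided at boundary points. On a
  one-point set, every function is continuously differentiable to all orders.
\<close>

primrec times_cont_diff_on :: "nat \<Rightarrow> ('a::euclidean_space \<Rightarrow> real) \<Rightarrow> 'a set \<Rightarrow> bool" where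
  "times_cont_diff_on 0 f S \<longleftrightarrow> continuous_on S f"
| "times_cont_diff_on (Suc k) f S \<longleftrightarrow>
     (\<exists>D. (\<forall>x\<in>S. (f has_derivative D x) (at x within S)) \<and>
          (\<forall>v\<in>Basis. times_cont_diff_on k (\<lambda>x. D x v) S))"

text \<open>
  The fields \<open>X n H\<close> are indexed by positive integers \<open>n\<close> and by \<open>H\<close> in the open
  interval \<open>(1/2, 1)\<close>; values of \<open>X\<close> at other indices are irrelevant.
\<close>

definition gaussian_sequence_field :: "'a measure \<Rightarrow> (nat \<Rightarrow> real \<Rightarrow> 'a \<Rightarrow> real) \<Rightarrow> bool" where
  "gaussian_sequence_field M X \<longleftrightarrow>
     centered_gaussian_field M ({1..} \<times> {1/2<..<1}) (\<lambda>(n, H). X n H)"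

definition assumption_i :: "real \<Rightarrow> real \<Rightarrow> 'a measure \<Rightarrow> (nat \<Rightarrow> real \<Rightarrow> 'a \<Rightarrow> real) \<Rightarrow> bool" where
  "assumption_i a b M X \<longleftrightarrow>
     (\<forall>m::real. m > 0 \<longrightarrow>
        bounded ((\<lambda>(j, k, H\<^sub>1, H\<^sub>2). LINT \<omega>|M. X j H\<^sub>1 \<omega> * X k H\<^sub>2 \<omega>) `
          {(j, k, H\<^sub>1, H\<^sub>2). j \<ge> 1 \<and> k \<ge> 1 \<and> \<bar>real j - real k\<bar> \<le> m \<and>
             H\<^sub>1 \<in> {a..b} \<and> H\<^sub>2 \<in> {a..b}}))"

text \<open>
  The filter expresses \<open>j - k \<rightarrow> \<infinity>\<close> over all pairs of positive integers, with no
  constraint on \<open>k\<close>. The supremum is taken in the extended reals because it may be infinite.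
\<close>

definition assumption_ii ::
  "real \<Rightarrow> real \<Rightarrow> (real \<times> real \<Rightarrow> real) \<Rightarrow> 'a measure \<Rightarrow> (nat \<Rightarrow> real \<Rightarrow> 'a \<Rightarrow> real) \<Rightarrow> bool" where
  "assumption_ii a b R M X \<longleftrightarrow>
     continuous_on ({a..b} \<times> {a..b}) R \<and>
     (\<forall>p \<in> {a..b} \<times> {a..b}. R p > 0) \<and>
     ((\<lambda>(j, k). SUP (H\<^sub>1, H\<^sub>2) \<in> {a..b} \<times> {a..b}.
          ereal \<bar>(real j - real k) powr (2 - H\<^sub>1 - H\<^sub>2) * (LINT \<omega>|M. X j H\<^sub>1 \<omega> * X k H\<^sub>2 \<omega>)
                 - R (H\<^sub>1, H\<^sub>2)\<bar>)
        \<longlongrightarrow> 0)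
       (filtercomap (\<lambda>(j::nat, k::nat). int j - int k) at_top \<sqinter> principal ({1..} \<times> {1..}))"

text \<open>
  The existential is over fields on a probability space carried by \<open>nat \<times> real \<Rightarrow> real\<close>.
  This loses no generality: only the law of the field matters, and every field indexed by
  \<open>(n, H)\<close> can be realised as the coordinate process there.
\<close>

definition asymptotic_covariance :: "real \<Rightarrow> real \<Rightarrow> (real \<times> real \<Rightarrow> real) \<Rightarrow> bool" where
  "asymptotic_covariance a b R \<longleftrightarrow>
     R \<in> borel_measurable (restrict_space borel ({a..b} \<times> {a..b})) \<and>
     bounded (R ` ({a..b} \<times> {a..b})) \<and>
     (\<forall>p \<in> {a..b} \<times> {a..b}. R p > 0) \<and>
     (\<exists>(M :: (nat \<times> real \<Rightarrow> real) measure) X.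
        gaussian_sequence_field M X \<and> assumption_ii a b R M X)"

definition in_G ::
  "real \<Rightarrow> real \<Rightarrow> (real \<times> real \<Rightarrow> real) \<Rightarrow> 'a measure \<Rightarrow> (nat \<Rightarrow> real \<Rightarrow> 'a \<Rightarrow> real) \<Rightarrow> bool" where
  "in_G a b R M X \<longleftrightarrow>
     gaussian_sequence_field M X \<and> assumption_i a b M X \<and> assumption_ii a b R M X"

definition calR :: "(real \<times> real \<Rightarrow> real) \<Rightarrow> real \<Rightarrow> real \<Rightarrow> real \<Rightarrow> real \<Rightarrow> real" where
  "calR R t s H\<^sub>1 H\<^sub>2 = R (H\<^sub>1, H\<^sub>2) * of_bool (t \<ge> s) + R (H\<^sub>2, H\<^sub>1) * of_bool (t < s)"

text \<open>
  Each limit is described both as a limit in finite-dimensional distributions of normalised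
  sums of the field \<open>X\<close> (on \<open>M\<close>) and as a centered Gaussian field with explicit covariance.
  The limit may live on a different probability space (\<open>P\<close> below).
\<close>

definition is_S_tilde ::
  "(real \<times> real \<Rightarrow> real) \<Rightarrow> (real \<Rightarrow> real) \<Rightarrow>
   'a measure \<Rightarrow> (nat \<Rightarrow> real \<Rightarrow> 'a \<Rightarrow> real) \<Rightarrow> 'b measure \<Rightarrow> (real \<Rightarrow> 'b \<Rightarrow> real) \<Rightarrow> bool" where
  "is_S_tilde R h M X P S \<longleftrightarrow>
     fdd_converges {0..} M
       (\<lambda>N t \<omega>. \<Sum>n = 1..nat \<lfloor>real N * t\<rfloor>.
          real N powr (- h (real n / real N)) * X n (h (real n / real N)) \<omega>) P S \<and>
     centered_gaussian_field P {0..} S \<and>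
     (\<forall>t\<ge>0. \<forall>s\<ge>0.
        (LINT \<omega>|P. S t \<omega> * S s \<omega>) =
        (LBINT \<theta>:{0..t}. (LBINT \<sigma>:{0..s}.
           calR R \<theta> \<sigma> (h \<theta>) (h \<sigma>) * \<bar>\<theta> - \<sigma>\<bar> powr (h \<theta> + h \<sigma> - 2))))"

definition is_W_tilde ::
  "real \<Rightarrow> real \<Rightarrow> (real \<times> real \<Rightarrow> real) \<Rightarrow>
   'a measure \<Rightarrow> (nat \<Rightarrow> real \<Rightarrow> 'a \<Rightarrow> real) \<Rightarrow> 'b measure \<Rightarrow> (real \<times> real \<Rightarrow> 'b \<Rightarrow> real) \<Rightarrow> bool" where
  "is_W_tilde a b R M X P W \<longleftrightarrow>
     fdd_converges ({0..} \<times> {a..b}) M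
       (\<lambda>N (t, H) \<omega>. real N powr (- H) * (\<Sum>n = 1..nat \<lfloor>real N * t\<rfloor>. X n H \<omega>)) P W \<and>
     centered_gaussian_field P ({0..} \<times> {a..b}) W \<and>
     (\<forall>t\<ge>0. \<forall>s\<ge>0. \<forall>H\<^sub>1\<in>{a..b}. \<forall>H\<^sub>2\<in>{a..b}.
        (LINT \<omega>|P. W (t, H\<^sub>1) \<omega> * W (s, H\<^sub>2) \<omega>) =
        (R (H\<^sub>2, H\<^sub>1) * s powr (H\<^sub>1 + H\<^sub>2) + R (H\<^sub>1, H\<^sub>2) * t powr (H\<^sub>1 + H\<^sub>2)
           - calR R t s H\<^sub>1 H\<^sub>2 * \<bar>t - s\<bar> powr (H\<^sub>1 + H\<^sub>2))
        / ((H\<^sub>1 + H\<^sub>2) * (H\<^sub>1 + H\<^sub>2 - 1)))"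

text \<open>
  If \<open>a = b\<close>, the derivative within the one-point set \<open>{a..b}\<close> is an unspecified number;
  in \<open>W_integrand\<close> it is then multiplied by \<open>h' = 0\<close>.
\<close>

definition partial_H ::
  "real \<Rightarrow> real \<Rightarrow> (real \<times> real \<Rightarrow> 'b \<Rightarrow> real) \<Rightarrow> real \<Rightarrow> real \<Rightarrow> 'b \<Rightarrow> real" where
  "partial_H a b W \<theta> H \<omega> = vector_derivative (\<lambda>K. W (\<theta>, K) \<omega>) (at H within {a..b})"

definition W_integrand ::
  "real \<Rightarrow> real \<Rightarrow> (real \<Rightarrow> real) \<Rightarrow> (real \<times> real \<Rightarrow> 'b \<Rightarrow> real) \<Rightarrow> 'b \<Rightarrow> real \<Rightarrow> real" where
  "W_integrand a b h W \<omega> \<theta> =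
     vector_derivative h (at \<theta> within {0..}) * partial_H a b W \<theta> (h \<theta>) \<omega>"

end

theory Submission
  imports Defs
begin

text \<open>
  The field \<open>W\<close> formally satisfies \<open>d/d\<theta> W(\<theta>, h \<theta>) = dW/d\<theta> (\<theta>, H) + h' \<partial>\<^sub>H W\<close> at \<open>H = h \<theta>\<close>, so the
  right-hand side of the theorem is the \<open>L\<^sup>2\<close> limit of the Euler sums
  \<open>\<Sum>\<^sub>i W(t\<^sub>i\<^sub>+\<^sub>1, h t\<^sub>i) - W(t\<^sub>i, h t\<^sub>i)\<close>: telescoping turns them into \<open>W(t, h t)\<close> minus increments of \<open>W\<close> in
  \<open>H\<close>. Their covariances are integrals of the kernel of \<open>W\<close> over rectangles and converge to the
  covariance of \<open>S\<close> by dominated convergence, and centered Gaussian laws are determined by covariances.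

  Since \<open>R\<close> is three times continuously differentiable, the \<open>L\<^sup>2\<close> distance between two difference
  quotients of \<open>W\<close> in \<open>H\<close> is at most of the order of the square root of the distance between their
  arguments. Hence an \<open>L\<^sup>2\<close> derivative \<open>D\<close> exists, with a jointly measurable version. No chaining
  argument is needed for the modification: \<open>W(\<theta>, a) + \<integral> D(\<theta>, u) du\<close> (over \<open>a \<le> u \<le> H\<close>) has, for each
  fixed \<open>\<theta>\<close> and almost surely, the derivative \<open>D(\<theta>, h \<theta>)\<close> at the single point \<open>H = h \<theta>\<close>, and the
  exceptional null sets may depend on \<open>\<theta>\<close>.
\<close>

subsection \<open>Centered normal variables and the Cramer--Wold device\<close>

text \<open>Everything rests on one gain: the mean square distance of difference quotients is
  Lipschitz. In time this comes from the term \<bar>t - s\<bar> powr (H1 + H2): differentiating in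
  both exponents leaves a power with exponent at least 2a > 1 times logarithms, hence O(\<bar>t -
  s\<bar>). In H it comes from a Lipschitz mixed derivative of \<open>R\<close>, where the third
  derivative is spent. The gain pays twice. Each term of the telescoped sum has error of mean square
  O(n^-3), which survives the factor n^2 of Cauchy--Schwarz without any orthogonality. And the mean
  square of D(\<theta>, u) - D(\<theta>, H) stays integrable against a weight singular enough to
  force differentiability at H. The second obstacle is that differentiability and integrability are
  claimed for every \<omega> and every \<theta>.\<close>

lemma centered_normal_moments:
  assumes "prob_space M" "centered_normal M Z"
  shows centered_normal_square_integrable: "integrable M (\<lambda>\<omega>. (Z \<omega>)\<^sup>2)"
    and centered_normal_cos:
      "(LINT \<omega>|M. cos (Z \<omega> + \<phi>)) = cos \<phi> * exp (- (LINT \<omega>|M. (Z \<omega>)\<^sup>2) / 2)"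
proof -
  interpret prob_space M by fact
  have Z[measurable]: "Z \<in> borel_measurable M"
    using assms(2) by (simp add: centered_normal_def)
  \<comment> \<open>The phase \<phi> lets one real family of integrals carry the whole
    characteristic function: \<phi> = 0 gives the real part, \<phi> = - pi/2 the imaginary
    part.\<close>
  have "integrable M (\<lambda>\<omega>. (Z \<omega>)\<^sup>2) \<and>
    (LINT \<omega>|M. cos (Z \<omega> + \<phi>)) = cos \<phi> * exp (- (LINT \<omega>|M. (Z \<omega>)\<^sup>2) / 2)"
  proof (cases "AE \<omega> in M. Z \<omega> = 0")
    case True
    have "integrable M (\<lambda>\<omega>. (Z \<omega>)\<^sup>2)"
      by (rule integrable_cong_AE_imp[of M "\<lambda>_. 0"]) (use True in auto)
    moreover have "(LINT \<omega>|M. (Z \<omega>)\<^sup>2) = (LINT \<omega>|M. 0)"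
      by (rule integral_cong_AE) (use True in auto)
    moreover have "(LINT \<omega>|M. cos (Z \<omega> + \<phi>)) = (LINT \<omega>|M. cos \<phi>)"
      by (rule integral_cong_AE) (use True in auto)
    ultimately show ?thesis by (simp add: prob_space)
  next
    case False
    then obtain \<sigma> where \<sigma>: "\<sigma> > 0" "distributed M lborel Z (\<lambda>y. ennreal (normal_density 0 \<sigma> y))"
      using assms(2) by (auto simp: centered_normal_def)
    have D: "distributed M lborel (\<lambda>x. Z x / \<sigma>) std_normal_density"
      using normal_standard_normal_convert[OF \<sigma>(1), of Z 0] \<sigma>(2) by simp
    have dst: "distr M lborel (\<lambda>x. Z x / \<sigma>) = std_normal_distribution"
      using distributed_distr_eq_density[OF D] .
    interpret S: prob_space std_normal_distribution by (rule prob_space_normal_density) simp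
    have meas[measurable]: "(\<lambda>x. Z x / \<sigma>) \<in> measurable M lborel" by simp
    have E: "(LINT \<omega>|M. g (Z \<omega>)) = (LINT x|std_normal_distribution. g (\<sigma> * x))"
      if [measurable]: "g \<in> borel_measurable borel" for g :: "real \<Rightarrow> real"
      unfolding dst[symmetric] by (subst integral_distr[OF meas]) (use \<sigma>(1) in auto)
    have I: "integrable M (\<lambda>\<omega>. g (Z \<omega>)) \<longleftrightarrow> integrable std_normal_distribution (\<lambda>x. g (\<sigma> * x))"
      if [measurable]: "g \<in> borel_measurable borel" for g :: "real \<Rightarrow> real"
      unfolding dst[symmetric] by (subst integrable_distr_eq[OF meas]) (use \<sigma>(1) in auto)
    have int2: "integrable M (\<lambda>\<omega>. (Z \<omega>)\<^sup>2)"
      using integrable_std_normal_moment[of 2] 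
      by (subst I) (auto simp: integrable_density power_mult_distrib mult.left_commute)
    have var: "(LINT \<omega>|M. (Z \<omega>)\<^sup>2) = \<sigma>\<^sup>2"
      using integral_std_normal_moment_even[of 1]
      by (subst E) (auto simp: integral_density power_mult_distrib mult.left_commute)
    have ch: "char std_normal_distribution \<sigma> = of_real (exp (- (\<sigma>\<^sup>2) / 2))"
      by (simp add: char_std_normal_distribution)
    have ic: "integrable std_normal_distribution (\<lambda>x. iexp (\<sigma> * x))"
      by (intro S.integrable_const_bound[of _ 1]) auto
    have c: "(LINT x|std_normal_distribution. cos (\<sigma> * x)) = exp (- (\<sigma>\<^sup>2) / 2)"
      and s: "(LINT x|std_normal_distribution. sin (\<sigma> * x)) = 0"
    proof -
      have "(LINT x|std_normal_distribution. cos (\<sigma> * x)) = Re (char std_normal_distribution \<sigma>)"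
        unfolding char_def integral_Re[OF ic, symmetric] by (simp add: Re_exp)
      then show "(LINT x|std_normal_distribution. cos (\<sigma> * x)) = exp (- (\<sigma>\<^sup>2) / 2)" using ch by simp
      have "(LINT x|std_normal_distribution. sin (\<sigma> * x)) = Im (char std_normal_distribution \<sigma>)"
        unfolding char_def integral_Im[OF ic, symmetric] by (simp add: Im_exp)
      then show "(LINT x|std_normal_distribution. sin (\<sigma> * x)) = 0" using ch by simp
    qed
    have "(LINT \<omega>|M. cos (Z \<omega> + \<phi>)) = (LINT x|std_normal_distribution. cos \<phi> * cos (\<sigma> * x) - sin \<phi> * sin (\<sigma> * x))"
      by (subst E) (auto simp: cos_add mult_ac)
    also have "\<dots> = cos \<phi> * exp (- (\<sigma>\<^sup>2) / 2)"
    proof -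
      have "integrable std_normal_distribution (\<lambda>x. cos (\<sigma> * x))" "integrable std_normal_distribution (\<lambda>x. sin (\<sigma> * x))"
        by (intro S.integrable_const_bound[of _ 1]; simp)+
      then show ?thesis by (simp add: c s)
    qed
    finally show ?thesis using int2 var by simp
  qed
  then show "integrable M (\<lambda>\<omega>. (Z \<omega>)\<^sup>2)"
    "(LINT \<omega>|M. cos (Z \<omega> + \<phi>)) = cos \<phi> * exp (- (LINT \<omega>|M. (Z \<omega>)\<^sup>2) / 2)" by auto
qed

text \<open>Dividing by the total mass turns the weights into probability densities, and the phases
  0 and - pi/2 in the hypothesis give the real and imaginary parts of the characteristic functions
  of \<open>Z\<close> and \<open>Z'\<close> under them, so Levy uniqueness applies. The masses agree
  by taking s = \<phi> = 0; if they vanish, both weights are zero almost everywhere.\<close>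

lemma weighted_distribution_eqI:
  fixes Z :: "'a \<Rightarrow> real" and Z' :: "'b \<Rightarrow> real"
  assumes "prob_space P" "prob_space Q"
    and Z[measurable]: "Z \<in> borel_measurable P" and Z'[measurable]: "Z' \<in> borel_measurable Q"
    and w[measurable]: "w \<in> borel_measurable P" and w'[measurable]: "w' \<in> borel_measurable Q"
    and w_bd: "\<And>x. 0 \<le> w x \<and> w x \<le> K" and w'_bd: "\<And>x. 0 \<le> w' x \<and> w' x \<le> K"
    and eq: "\<And>s \<phi>. (LINT x|P. w x * cos (s * Z x + \<phi>)) = (LINT x|Q. w' x * cos (s * Z' x + \<phi>))"
    and B[measurable]: "B \<in> sets borel"
  shows "(LINT x|P. w x * indicator B (Z x)) = (LINT x|Q. w' x * indicator B (Z' x))"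
proof -
  interpret P: prob_space P by fact
  interpret Q: prob_space Q by fact
  have iw: "integrable P w" using w_bd by (intro P.integrable_const_bound[of _ K]) auto
  have iw': "integrable Q w'" using w'_bd by (intro Q.integrable_const_bound[of _ K]) auto
  define m where "m = (LINT x|P. w x)"
  have m': "m = (LINT x|Q. w' x)" using eq[of 0 0] by (simp add: m_def)
  have m0: "m \<ge> 0" unfolding m_def using w_bd by (intro Bochner_Integration.integral_nonneg) auto
  show ?thesis
  proof (cases "m = 0")
    case True
    have "AE x in P. w x = 0"
      using True integral_nonneg_eq_0_iff_AE[OF iw] w_bd by (auto simp: m_def)
    then have "(LINT x|P. w x * indicator B (Z x)) = (LINT x|P. 0)"
      by (intro integral_cong_AE) auto
    moreover have "AE x in Q. w' x = 0"
      using True m' integral_nonneg_eq_0_iff_AE[OF iw'] w'_bd by auto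
    then have "(LINT x|Q. w' x * indicator B (Z' x)) = (LINT x|Q. 0)"
      by (intro integral_cong_AE) auto
    ultimately show ?thesis by simp
  next
    case False
    then have mp: "m > 0" using m0 by simp
    \<comment> \<open>Stated for a generic space because it is applied once to \<open>P\<close> and
      once to \<open>Q\<close>.\<close>
    have real_dist: "real_distribution (distr (density N (\<lambda>x. ennreal (v x / m))) borel Y)"
      and ch: "char (distr (density N (\<lambda>x. ennreal (v x / m))) borel Y) s =
          Complex ((LINT x|N. v x * cos (s * Y x + 0)) / m) ((LINT x|N. v x * cos (s * Y x + (- pi/2))) / m)"
      and meas: "measure (distr (density N (\<lambda>x. ennreal (v x / m))) borel Y) B = (LINT x|N. v x * indicator B (Y x)) / m"
      if N: "prob_space N" and [measurable]: "Y \<in> borel_measurable N" "v \<in> borel_measurable N"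
        and v: "\<And>x. 0 \<le> v x \<and> v x \<le> K" and im: "m = (LINT x|N. v x)"
      for N :: "'c measure" and Y v s
    proof -
      interpret N: prob_space N by fact
      have iv: "integrable N v" using v by (intro N.integrable_const_bound[of _ K]) auto
      have vm: "0 \<le> v x / m" for x using v[of x] mp by simp
      have "emeasure (density N (\<lambda>x. ennreal (v x / m))) (space N) = (\<integral>\<^sup>+ x. ennreal (v x / m) \<partial>N)"
        by (subst emeasure_density) (auto intro!: nn_integral_cong)
      also have "\<dots> = ennreal (LINT x|N. v x / m)"
        using iv vm by (intro nn_integral_eq_integral) auto
      also have "(LINT x|N. v x / m) = 1" using im mp by simp
      finally interpret D: prob_space "density N (\<lambda>x. ennreal (v x / m))"
        by (intro prob_spaceI) simp
      show rd: "real_distribution (distr (density N (\<lambda>x. ennreal (v x / m))) borel Y)"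
        unfolding real_distribution_def real_distribution_axioms_def
        by (auto intro!: D.prob_space_distr)
      have icv: "integrable N (\<lambda>x. v x * cos (s * Y x + \<phi>))" for \<phi>
      proof (rule N.integrable_const_bound[of _ K])
        have "\<bar>v x * cos z\<bar> \<le> K" for x z
          using mult_mono[of "v x" K "\<bar>cos z\<bar>" 1] v[of x] by (auto simp: abs_mult)
        then show "AE x in N. norm (v x * cos (s * Y x + \<phi>)) \<le> K" by auto
      qed measurable
      have "char (distr (density N (\<lambda>x. ennreal (v x / m))) borel Y) s =
         (LINT x|N. (v x / m) *\<^sub>R iexp (s * Y x))"
        unfolding char_def using vm
        by (subst integral_distr) (auto simp: integral_density)
      also have "\<dots> = (LINT x|N. of_real (v x * cos (s * Y x + 0) / m) + \<i> * of_real (v x * cos (s * Y x + (- pi/2)) / m))"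
        by (intro Bochner_Integration.integral_cong refl)
          (auto simp: complex_eq_iff Re_exp Im_exp cos_diff)
      also have "\<dots> = of_real (LINT x|N. v x * cos (s * Y x + 0) / m) + \<i> * of_real (LINT x|N. v x * cos (s * Y x + (- pi/2)) / m)"
        using icv[of 0] icv[of "- pi/2"]
        by (subst Bochner_Integration.integral_add)
          (auto simp del: of_real_mult of_real_divide intro!: integrable_divide)
      finally show "char (distr (density N (\<lambda>x. ennreal (v x / m))) borel Y) s =
          Complex ((LINT x|N. v x * cos (s * Y x + 0)) / m) ((LINT x|N. v x * cos (s * Y x + (- pi/2))) / m)"
        by (simp add: complex_eq_iff)
      have "measure (distr (density N (\<lambda>x. ennreal (v x / m))) borel Y) B =
         (LINT x|distr (density N (\<lambda>x. ennreal (v x / m))) borel Y. indicator B x)" by simp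
      also have "\<dots> = (LINT x|N. (v x / m) * indicator B (Y x))"
        using vm by (subst integral_distr) (auto simp: integral_density)
      also have "\<dots> = (LINT x|N. v x * indicator B (Y x)) / m" by simp
      finally show "measure (distr (density N (\<lambda>x. ennreal (v x / m))) borel Y) B = (LINT x|N. v x * indicator B (Y x)) / m" .
    qed
    have "distr (density P (\<lambda>x. ennreal (w x / m))) borel Z = distr (density Q (\<lambda>x. ennreal (w' x / m))) borel Z'"
    proof (rule Levy_uniqueness)
      show "char (distr (density P (\<lambda>x. ennreal (w x / m))) borel Z) = char (distr (density Q (\<lambda>x. ennreal (w' x / m))) borel Z')"
      proof
        fix s
        show "char (distr (density P (\<lambda>x. ennreal (w x / m))) borel Z) s = char (distr (density Q (\<lambda>x. ennreal (w' x / m))) borel Z') s"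
          unfolding ch[OF assms(1) Z w w_bd m_def] ch[OF assms(2) Z' w' w'_bd m'] eq ..
      qed
    qed (fact real_dist[OF assms(1) Z w w_bd m_def] real_dist[OF assms(2) Z' w' w'_bd m'])+
    then show ?thesis
      using meas[OF assms(1) Z w w_bd m_def] meas[OF assms(2) Z' w' w'_bd m'] mp by simp
  qed
qed

text \<open>
  The Cramer--Wold device: the Fourier variables are replaced by indicators one coordinate at
  a time. The remaining trigonometric factor becomes a nonnegative weight after adding \<open>1\<close>, so
  each step is an instance of the one-dimensional uniqueness theorem.
\<close>

lemma distr_PiM_eqI_cos:
  fixes X :: "'i \<Rightarrow> 'a \<Rightarrow> real" and Y :: "'i \<Rightarrow> 'b \<Rightarrow> real"
  assumes "prob_space P" "prob_space Q" and J: "finite J"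
    and X: "\<And>i. i \<in> J \<Longrightarrow> X i \<in> borel_measurable P"
    and Y: "\<And>i. i \<in> J \<Longrightarrow> Y i \<in> borel_measurable Q"
    and eq: "\<And>c \<phi>. (LINT x|P. cos ((\<Sum>i\<in>J. c i * X i x) + \<phi>)) = (LINT x|Q. cos ((\<Sum>i\<in>J. c i * Y i x) + \<phi>))"
  shows "distr P (\<Pi>\<^sub>M i\<in>J. borel) (\<lambda>x. \<lambda>i\<in>J. X i x) = distr Q (\<Pi>\<^sub>M i\<in>J. borel) (\<lambda>x. \<lambda>i\<in>J. Y i x)"
proof -
  interpret P: prob_space P by fact
  interpret Q: prob_space Q by fact
  \<comment> \<open>\<open>A\<close> collects the coordinates already converted to indicators.
    \<open>A = {}\<close> is the hypothesis; \<open>A = J\<close> leaves only probabilities of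
    boxes.\<close>
  have step: "(\<forall>c \<phi>. (LINT x|P. (\<Prod>i\<in>A. indicator (B i) (X i x)) * cos ((\<Sum>i\<in>J - A. c i * X i x) + \<phi>)) =
                (LINT x|Q. (\<Prod>i\<in>A. indicator (B i) (Y i x)) * cos ((\<Sum>i\<in>J - A. c i * Y i x) + \<phi>)))"
    if "A \<subseteq> J" and B: "\<And>i. i \<in> J \<Longrightarrow> B i \<in> sets borel" for A and B :: "'i \<Rightarrow> real set"
  proof -
    have "finite A" using that J finite_subset by blast
    then show ?thesis using \<open>A \<subseteq> J\<close>
    proof (induction A rule: finite_induct)
      case empty
      then show ?case using eq by simp
    next
      case (insert j A)
      then have j: "j \<in> J" "j \<notin> A" "A \<subseteq> J" by auto
      let ?J = "J - insert j A"
      have JA: "J - A = insert j ?J" using j by auto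
      have fJ: "finite ?J" using J by simp
      have mX[measurable]: "X i \<in> borel_measurable P" if "i \<in> J" for i using X that by auto
      have mY[measurable]: "Y i \<in> borel_measurable Q" if "i \<in> J" for i using Y that by auto
      have mB[measurable]: "B i \<in> sets borel" if "i \<in> J" for i using B that by auto
      have IH: "(LINT x|P. (\<Prod>i\<in>A. indicator (B i) (X i x)) * cos ((\<Sum>i\<in>J - A. c i * X i x) + \<phi>)) =
                (LINT x|Q. (\<Prod>i\<in>A. indicator (B i) (Y i x)) * cos ((\<Sum>i\<in>J - A. c i * Y i x) + \<phi>))" for c \<phi>
        using insert.IH j by blast
      \<comment> \<open>The frequency of the coordinate \<open>j\<close> to be converted next is
        singled out as \<open>s\<close>.\<close>
      have IH': "(LINT x|P. (\<Prod>i\<in>A. indicator (B i) (X i x)) * cos (s * X j x + (\<Sum>i\<in>?J. c i * X i x) + \<phi>)) =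
                (LINT x|Q. (\<Prod>i\<in>A. indicator (B i) (Y i x)) * cos (s * Y j x + (\<Sum>i\<in>?J. c i * Y i x) + \<phi>))" for c s \<phi>
      proof -
        have "(\<Sum>i\<in>?J. (if i = j then s else c i) * f i) = (\<Sum>i\<in>?J. c i * f i)" for f
          by (intro sum.cong) auto
        then have *: "(\<Sum>i\<in>insert j ?J. (if i = j then s else c i) * f i) = s * f j + (\<Sum>i\<in>?J. c i * f i)" for f
          using sum.insert[OF fJ, of j "\<lambda>i. (if i = j then s else c i) * f i"] by simp
        show ?thesis using IH[of "\<lambda>i. if i = j then s else c i" \<phi>]
          unfolding JA * .
      qed
      show ?case
      proof (intro allI)
        fix c \<phi>
        let ?\<theta> = "\<lambda>x. (\<Sum>i\<in>?J. c i * X i x) + \<phi>" and ?\<theta>' = "\<lambda>x. (\<Sum>i\<in>?J. c i * Y i x) + \<phi>"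
        let ?p = "\<lambda>x. (\<Prod>i\<in>A. indicator (B i) (X i x)) :: real" and ?p' = "\<lambda>x. (\<Prod>i\<in>A. indicator (B i) (Y i x)) :: real"
        have mp[measurable]: "?p \<in> borel_measurable P" "?p' \<in> borel_measurable Q"
          using j(3) by (auto intro!: borel_measurable_prod)
        have m\<theta>[measurable]: "?\<theta> \<in> borel_measurable P" "?\<theta>' \<in> borel_measurable Q" by auto
        have mj[measurable]: "X j \<in> borel_measurable P" "Y j \<in> borel_measurable Q" "B j \<in> sets borel" using j by auto
        have p_bd: "0 \<le> ?p x" "?p x \<le> 1" "0 \<le> ?p' y" "?p' y \<le> 1" for x y
          by (auto intro!: prod_nonneg prod_le_1 simp: indicator_def)
        have bd: "\<bar>p * c\<bar> \<le> 1" if "0 \<le> p" "p \<le> 1" "\<bar>c\<bar> \<le> 1" for p c :: real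
          using that by (simp add: abs_mult mult_le_one)
        have iP: "integrable P (\<lambda>x. ?p x * g x)" if "g \<in> borel_measurable P" "\<And>x. \<bar>g x\<bar> \<le> 1" for g
          using that p_bd by (intro P.integrable_const_bound[of _ 1]) (auto intro!: bd)
        have iQ: "integrable Q (\<lambda>x. ?p' x * g x)" if "g \<in> borel_measurable Q" "\<And>x. \<bar>g x\<bar> \<le> 1" for g
          using that p_bd by (intro Q.integrable_const_bound[of _ 1]) (auto intro!: bd)
        \<comment> \<open>Frequency zero on the remaining coordinates removes their cosine. This
          instance is subtracted at the end to undo the added 1.\<close>
        have w1: "(LINT x|P. ?p x * cos (s * X j x + \<psi>)) = (LINT x|Q. ?p' x * cos (s * Y j x + \<psi>))" for s \<psi>
          using IH'[of s "\<lambda>_. 0" \<psi>] by simp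
        \<comment> \<open>The product-to-sum formula turns this into two instances of
          \<open>IH'\<close>, at frequencies - s and s with shifted phases.\<close>
        have w2: "(LINT x|P. ?p x * cos (?\<theta> x) * cos (s * X j x + \<psi>)) = (LINT x|Q. ?p' x * cos (?\<theta>' x) * cos (s * Y j x + \<psi>))" for s \<psi>
        proof -
          have tr: "p * cos (T + \<phi>) * cos (z + \<psi>) = 
            (1/2) * (p * cos (- z + T + (\<phi> - \<psi>))) + (1/2) * (p * cos (z + T + (\<phi> + \<psi>)))" for p T z :: real
          proof -
            have "cos (T + \<phi>) * cos (z + \<psi>) = (cos (T + \<phi> - (z + \<psi>)) + cos (T + \<phi> + (z + \<psi>))) / 2"
              by (rule cos_times_cos)
            moreover have "T + \<phi> - (z + \<psi>) = - z + T + (\<phi> - \<psi>)" "T + \<phi> + (z + \<psi>) = z + T + (\<phi> + \<psi>)" by auto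
            ultimately have "cos (T + \<phi>) * cos (z + \<psi>) = (cos (- z + T + (\<phi> - \<psi>)) + cos (z + T + (\<phi> + \<psi>))) / 2"
              by metis
            then show ?thesis by (simp only: mult.assoc) (simp add: distrib_left)
          qed
          show ?thesis unfolding tr
            using IH'[of "-s" c "\<phi> - \<psi>"] IH'[of s c "\<phi> + \<psi>"]
            by (subst (1 2) Bochner_Integration.integral_add) (auto intro!: iP iQ integrable_divide simp: algebra_simps)
        qed
        have W1: "(LINT x|P. ?p x * indicator (B j) (X j x)) = (LINT x|Q. ?p' x * indicator (B j) (Y j x))"
          using p_bd w1 by (intro weighted_distribution_eqI[OF assms(1,2), where K=1]) auto
        have W2: "(LINT x|P. (?p x * (1 + cos (?\<theta> x))) * indicator (B j) (X j x)) = (LINT x|Q. (?p' x * (1 + cos (?\<theta>' x))) * indicator (B j) (Y j x))"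
        proof (rule weighted_distribution_eqI[OF assms(1,2), where K=2])
          fix s \<psi>
          show "(LINT x|P. (?p x * (1 + cos (?\<theta> x))) * cos (s * X j x + \<psi>)) = (LINT x|Q. (?p' x * (1 + cos (?\<theta>' x))) * cos (s * Y j x + \<psi>))"
          proof -
            have 1: "integrable P (\<lambda>x. ?p x * cos (?\<theta> x) * cos (s * X j x + \<psi>))"
              "integrable Q (\<lambda>x. ?p' x * cos (?\<theta>' x) * cos (s * Y j x + \<psi>))"
              unfolding mult.assoc by (rule iP iQ; auto simp: abs_mult intro!: mult_le_one)+
            show ?thesis 
              by (simp only: distrib_left distrib_right mult_1_right)
                (subst (1 2) Bochner_Integration.integral_add, auto intro!: iP iQ 1 simp: w1 w2)
          qed
          have "0 \<le> p * (1 + cos t) \<and> p * (1 + cos t) \<le> 2" if "0 \<le> p" "p \<le> 1" for p t :: real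
          proof -
            have "0 \<le> 1 + cos t" using cos_ge_minus_one[of t] by linarith
            then show ?thesis using that mult_mono[of p 1 "1 + cos t" 2] by auto
          qed
          then show "\<And>x. 0 \<le> (?p x * (1 + cos (?\<theta> x))) \<and> (?p x * (1 + cos (?\<theta> x))) \<le> 2"
            "\<And>x. 0 \<le> (?p' x * (1 + cos (?\<theta>' x))) \<and> (?p' x * (1 + cos (?\<theta>' x))) \<le> 2"
            using p_bd by blast+
        qed measurable
        have 2: "integrable P (\<lambda>x. ?p x * cos (?\<theta> x) * indicator (B j) (X j x))"
              "integrable Q (\<lambda>x. ?p' x * cos (?\<theta>' x) * indicator (B j) (Y j x))"
          unfolding mult.assoc by (rule iP iQ; auto simp: abs_mult indicator_def)+
        have 3: "integrable P (\<lambda>x. ?p x * indicator (B j) (X j x))"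
              "integrable Q (\<lambda>x. ?p' x * indicator (B j) (Y j x))"
          by (rule iP iQ; auto simp: indicator_def)+
        have "(LINT x|P. ?p x * cos (?\<theta> x) * indicator (B j) (X j x)) = (LINT x|Q. ?p' x * cos (?\<theta>' x) * indicator (B j) (Y j x))"
          using W2 W1 unfolding distrib_left distrib_right mult_1_right
          by (simp add: Bochner_Integration.integral_add[OF 3(1) 2(1)] Bochner_Integration.integral_add[OF 3(2) 2(2)])
        then show "(LINT x|P. (\<Prod>i\<in>insert j A. indicator (B i) (X i x)) * cos ((\<Sum>i\<in>?J. c i * X i x) + \<phi>)) =
                (LINT x|Q. (\<Prod>i\<in>insert j A. indicator (B i) (Y i x)) * cos ((\<Sum>i\<in>?J. c i * Y i x) + \<phi>))"
          using insert.hyps by (simp add: prod.insert mult_ac)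
      qed
    qed
  qed
  have mX: "(\<lambda>x. \<lambda>i\<in>J. X i x) \<in> measurable P (\<Pi>\<^sub>M i\<in>J. borel)" using X by (intro measurable_restrict) auto
  have mY: "(\<lambda>x. \<lambda>i\<in>J. Y i x) \<in> measurable Q (\<Pi>\<^sub>M i\<in>J. borel)" using Y by (intro measurable_restrict) auto
  interpret DP: prob_space "distr P (\<Pi>\<^sub>M i\<in>J. borel) (\<lambda>x. \<lambda>i\<in>J. X i x)" using mX by (rule P.prob_space_distr)
  have box: "emeasure (distr N (\<Pi>\<^sub>M i\<in>J. borel) (\<lambda>x. \<lambda>i\<in>J. Z i x)) (Pi\<^sub>E J A) = ennreal (LINT x|N. (\<Prod>i\<in>J. indicator (A i) (Z i x)))"
    if "prob_space N" and A: "\<And>i. i \<in> J \<Longrightarrow> A i \<in> sets borel" and Z: "\<And>i. i \<in> J \<Longrightarrow> Z i \<in> borel_measurable N"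
    for N :: "'c measure" and Z :: "'i \<Rightarrow> 'c \<Rightarrow> real" and A
  proof -
    interpret N: prob_space N by fact
    have mZ: "(\<lambda>x. \<lambda>i\<in>J. Z i x) \<in> measurable N (\<Pi>\<^sub>M i\<in>J. borel)" using Z by (intro measurable_restrict) auto
    have sA: "Pi\<^sub>E J A \<in> sets (\<Pi>\<^sub>M i\<in>J. borel)" using J A by (intro sets_PiM_I_finite) auto
    have "emeasure (distr N (\<Pi>\<^sub>M i\<in>J. borel) (\<lambda>x. \<lambda>i\<in>J. Z i x)) (Pi\<^sub>E J A) = 
      emeasure N ((\<lambda>x. \<lambda>i\<in>J. Z i x) -` Pi\<^sub>E J A \<inter> space N)"
      by (rule emeasure_distr[OF mZ sA])
    also have "\<dots> = ennreal (measure N ((\<lambda>x. \<lambda>i\<in>J. Z i x) -` Pi\<^sub>E J A \<inter> space N))" by (rule N.emeasure_eq_measure)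
    also have "measure N ((\<lambda>x. \<lambda>i\<in>J. Z i x) -` Pi\<^sub>E J A \<inter> space N) = (LINT x|N. indicator ((\<lambda>x. \<lambda>i\<in>J. Z i x) -` Pi\<^sub>E J A \<inter> space N) x)"
      using measurable_sets[OF mZ sA] by simp
    also have "\<dots> = (LINT x|N. (\<Prod>i\<in>J. indicator (A i) (Z i x)))"
    proof (rule Bochner_Integration.integral_cong[OF refl])
      fix x assume x: "x \<in> space N"
      show "indicator ((\<lambda>x. \<lambda>i\<in>J. Z i x) -` Pi\<^sub>E J A \<inter> space N) x = (\<Prod>i\<in>J. indicator (A i) (Z i x) :: real)"
      proof (cases "\<forall>i\<in>J. Z i x \<in> A i")
        case True
        then show ?thesis using x by (auto simp: indicator_def)
      next
        case False
        then obtain k where k: "k \<in> J" "Z k x \<notin> A k" by blast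
        then have "(indicator (A k) (Z k x) :: real) = 0" by simp
        then have "(\<Prod>i\<in>J. indicator (A i) (Z i x) :: real) = 0"
          by (rule prod_zero[OF J bexI[OF _ k(1)]])
        then show ?thesis using False by (auto simp: indicator_def PiE_iff)
      qed
    qed
    finally show ?thesis .
  qed
  show ?thesis
  proof (rule measure_eqI_PiM_finite[OF J])
    fix A :: "'i \<Rightarrow> real set" assume A: "\<And>i. i \<in> J \<Longrightarrow> A i \<in> sets borel"
    show "emeasure (distr P (\<Pi>\<^sub>M i\<in>J. borel) (\<lambda>x. \<lambda>i\<in>J. X i x)) (Pi\<^sub>E J A) = emeasure (distr Q (\<Pi>\<^sub>M i\<in>J. borel) (\<lambda>x. \<lambda>i\<in>J. Y i x)) (Pi\<^sub>E J A)"
      \<comment> \<open>With all coordinates converted, the empty sum and phase 0 reduce the cosine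
        to 1.\<close>
      using box[of P A X] box[of Q A Y] assms(1,2) A X Y
        step[OF subset_refl A, THEN spec[of _ "\<lambda>_. 0"], THEN spec[of _ 0]] by simp
  next
    show "range (\<lambda>_::nat. \<Pi>\<^sub>E i\<in>J. (UNIV::real set)) \<subseteq> prod_algebra J (\<lambda>_. borel)"
      using J by (auto intro!: prod_algebraI_finite)
  qed (auto simp: space_PiM)
qed

subsection \<open>Regularity of the covariance in the Hurst parameters\<close>

lemma times_cont_diff_on_imp_continuous_on:
  "times_cont_diff_on n f S \<Longrightarrow> continuous_on S f"
  by (cases n) (auto simp: continuous_on_eq_continuous_within intro: has_derivative_continuous)

text \<open>Compactness bounds the partial derivatives, the sum of their bounds dominates the
  operator norm of the derivative, and convexity allows the mean value inequality.\<close>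

lemma times_cont_diff_on_1_lipschitz:
  fixes f :: "'a::euclidean_space \<Rightarrow> real"
  assumes f: "times_cont_diff_on (Suc n) f S" and S: "compact S" "convex S"
  obtains L where "L \<ge> 0" "\<And>x y. x \<in> S \<Longrightarrow> y \<in> S \<Longrightarrow> \<bar>f x - f y\<bar> \<le> L * norm (x - y)"
proof -
  from f obtain D where D: "\<And>x. x \<in> S \<Longrightarrow> (f has_derivative D x) (at x within S)"
    and DC: "\<And>v. v \<in> Basis \<Longrightarrow> times_cont_diff_on n (\<lambda>x. D x v) S" by auto
  have "\<exists>B. \<forall>x\<in>S. \<bar>D x v\<bar> \<le> B" if "v \<in> Basis" for v
  proof -
    have "bounded ((\<lambda>x. D x v) ` S)"
      using times_cont_diff_on_imp_continuous_on[OF DC[OF that]] S(1)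
      by (intro compact_imp_bounded compact_continuous_image)
    then show ?thesis by (auto simp: bounded_iff)
  qed
  then obtain B where B: "\<And>v x. v \<in> Basis \<Longrightarrow> x \<in> S \<Longrightarrow> \<bar>D x v\<bar> \<le> B v" by metis
  define L where "L = (\<Sum>v\<in>(Basis::'a set). \<bar>B v\<bar>)"
  have "onorm (D x) \<le> L" if "x \<in> S" for x
  proof (rule onorm_le)
    fix y
    have lin: "linear (D x)" using D[OF that] by (auto dest: has_derivative_linear)
    have "D x y = (\<Sum>v\<in>Basis. (y \<bullet> v) * D x v)"
      by (subst euclidean_representation[of y, symmetric]) (simp add: linear_sum[OF lin] linear_scale[OF lin])
    also have "\<bar>\<dots>\<bar> \<le> (\<Sum>v\<in>Basis. \<bar>y \<bullet> v\<bar> * \<bar>D x v\<bar>)"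
      by (rule order_trans[OF sum_abs]) (simp add: abs_mult)
    also have "\<dots> \<le> (\<Sum>v\<in>Basis. norm y * \<bar>B v\<bar>)"
      using B[OF _ that] by (intro sum_mono mult_mono Basis_le_norm) force+
    finally show "norm (D x y) \<le> L * norm y" by (simp add: L_def sum_distrib_left mult.commute)
  qed
  then have "\<bar>f x - f y\<bar> \<le> L * norm (x - y)" if "x \<in> S" "y \<in> S" for x y
    using differentiable_bound[OF S(2) D, of L x y] that by simp
  then show thesis using that[of L] by (auto simp: L_def sum_nonneg)
qed

text \<open>Only those partial derivatives that occur in the mixed derivative of
  \<open>R (x, y)\<close> times a function of \<open>x + y\<close>: both first ones and
  \<open>R12\<close>, no pure second ones.\<close>

definition C2_lipschitz_on :: "real \<Rightarrow> real \<Rightarrow> (real \<times> real \<Rightarrow> real) \<Rightarrow> (real \<times> real \<Rightarrow> real) \<Rightarrow> (real \<times> real \<Rightarrow> real) \<Rightarrow> (real \<times> real \<Rightarrow> real) \<Rightarrow> real \<Rightarrow> bool" where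
  "C2_lipschitz_on a b R R1 R2 R12 B \<longleftrightarrow>
    (\<forall>x\<in>{a..b}. \<forall>y\<in>{a..b}.
       ((\<lambda>x. R (x, y)) has_real_derivative R1 (x, y)) (at x within {a..b}) \<and>
       ((\<lambda>y. R (x, y)) has_real_derivative R2 (x, y)) (at y within {a..b}) \<and>
       ((\<lambda>y. R1 (x, y)) has_real_derivative R12 (x, y)) (at y within {a..b})) \<and>
    (\<forall>f\<in>{R, R1, R2, R12}. \<forall>x\<in>{a..b}. \<forall>y\<in>{a..b}. \<bar>f (x, y)\<bar> \<le> B \<and>
       (\<forall>x'\<in>{a..b}. \<forall>y'\<in>{a..b}. \<bar>f (x, y) - f (x', y')\<bar> \<le> B * (\<bar>x - x'\<bar> + \<bar>y - y'\<bar>)))"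

lemma partial_derivatives_on_square:
  fixes f :: "real \<times> real \<Rightarrow> real"
  assumes D: "(f has_derivative D) (at (x, y) within {a..b} \<times> {a..b})"
    and x: "x \<in> {a..b}" and y: "y \<in> {a..b}"
  shows "((\<lambda>x. f (x, y)) has_real_derivative D (1, 0)) (at x within {a..b})"
    and "((\<lambda>y. f (x, y)) has_real_derivative D (0, 1)) (at y within {a..b})"
proof -
  have A: "((\<lambda>x. f (x, y)) has_derivative (\<lambda>h. D (h, 0))) (at x within {a..b})"
    by (rule has_derivative_in_compose[where f="\<lambda>x. (x, y)", OF _ has_derivative_subset[OF D]])
      (use y in \<open>auto intro: has_derivative_Pair has_derivative_ident has_derivative_const\<close>)
  have B: "((\<lambda>y. f (x, y)) has_derivative (\<lambda>h. D (0, h))) (at y within {a..b})"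
    by (rule has_derivative_in_compose[where f="\<lambda>y. (x, y)", OF _ has_derivative_subset[OF D]])
      (use x in \<open>auto intro: has_derivative_Pair has_derivative_ident has_derivative_const\<close>)
  have E: "(\<lambda>h. D (h, 0)) = (*) (D (1, 0))" "(\<lambda>h. D (0, h)) = (*) (D (0, 1))"
  proof -
    have "D (h, 0) = D (1, 0) * h" "D (0, h) = D (0, 1) * h" for h
      using linear_scale[OF has_derivative_linear[OF D], of h "(1, 0)"]
        linear_scale[OF has_derivative_linear[OF D], of h "(0, 1)"] by auto
    then show "(\<lambda>h. D (h, 0)) = (*) (D (1, 0))" "(\<lambda>h. D (0, h)) = (*) (D (0, 1))"
      by (rule_tac [!] ext)
  qed
  show "((\<lambda>x. f (x, y)) has_real_derivative D (1, 0)) (at x within {a..b})"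
    and "((\<lambda>y. f (x, y)) has_real_derivative D (0, 1)) (at y within {a..b})"
    unfolding has_field_derivative_def by (rule has_derivative_eq_rhs[OF A E(1)] has_derivative_eq_rhs[OF B E(2)])+
qed

text \<open>A Lipschitz bound costs one derivative more than the function itself, so the bound for
  \<open>R12\<close> consumes the third order. The sum of the individual constants serves as the
  common one.\<close>

lemma times_cont_diff_on_imp_C2_lipschitz_on:
  assumes R: "times_cont_diff_on 3 R ({a..b} \<times> {a..b})"
  obtains R1 R2 R12 B where "B \<ge> 0" "C2_lipschitz_on a b R R1 R2 R12 B"
proof -
  let ?S = "{a..b} \<times> {a..b}"
  have S: "compact ?S" "convex ?S" by (auto intro!: compact_Times convex_Times)
  have basis: "(1, 0) \<in> (Basis :: (real \<times> real) set)" "(0, 1) \<in> (Basis :: (real \<times> real) set)"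
    by (simp_all add: Basis_prod_def)
  from R obtain D where D: "\<And>p. p \<in> ?S \<Longrightarrow> (R has_derivative D p) (at p within ?S)"
    and D2: "\<And>v. v \<in> Basis \<Longrightarrow> times_cont_diff_on (Suc (Suc 0)) (\<lambda>x. D x v) ?S"
    unfolding numeral_3_eq_3 times_cont_diff_on.simps(2)[of "Suc (Suc 0)"] by blast
  from D2[OF basis(1)] obtain E where E: "\<And>p. p \<in> ?S \<Longrightarrow> ((\<lambda>x. D x (1, 0)) has_derivative E p) (at p within ?S)"
    and E2: "\<And>v. v \<in> Basis \<Longrightarrow> times_cont_diff_on (Suc 0) (\<lambda>x. E x v) ?S"
    unfolding times_cont_diff_on.simps(2)[of "Suc 0"] by blast
  have ex: "\<exists>B. B \<ge> 0 \<and> (\<forall>x\<in>{a..b}. \<forall>y\<in>{a..b}. \<bar>f (x, y)\<bar> \<le> B \<and>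
       (\<forall>x'\<in>{a..b}. \<forall>y'\<in>{a..b}. \<bar>f (x, y) - f (x', y')\<bar> \<le> B * (\<bar>x - x'\<bar> + \<bar>y - y'\<bar>)))"
    if f: "times_cont_diff_on (Suc n) f ?S" for f n
  proof -
    obtain L where L: "L \<ge> 0" "\<And>x y. x \<in> ?S \<Longrightarrow> y \<in> ?S \<Longrightarrow> \<bar>f x - f y\<bar> \<le> L * norm (x - y)"
      using times_cont_diff_on_1_lipschitz[OF f S] by auto
    have "bounded (f ` ?S)"
      using times_cont_diff_on_imp_continuous_on[OF f] S(1)
      by (intro compact_imp_bounded compact_continuous_image)
    then obtain B where B: "\<And>p. p \<in> ?S \<Longrightarrow> \<bar>f p\<bar> \<le> B" by (auto simp: bounded_iff)
    have "\<bar>f (x, y) - f (x', y')\<bar> \<le> max L \<bar>B\<bar> * (\<bar>x - x'\<bar> + \<bar>y - y'\<bar>)"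
      if "x \<in> {a..b}" "y \<in> {a..b}" "x' \<in> {a..b}" "y' \<in> {a..b}" for x y x' y'
    proof -
      have "\<bar>f (x, y) - f (x', y')\<bar> \<le> L * norm ((x, y) - (x', y'))" using L(2) that by blast
      also have "\<dots> \<le> max L \<bar>B\<bar> * (\<bar>x - x'\<bar> + \<bar>y - y'\<bar>)"
        using L(1) norm_Pair_le[of "x - x'" "y - y'"] by (intro mult_mono) (auto simp: minus_prod_def)
      finally show ?thesis .
    qed
    moreover have "\<bar>f (x, y)\<bar> \<le> max L \<bar>B\<bar>" if "x \<in> {a..b}" "y \<in> {a..b}" for x y
      using B[of "(x, y)"] that by auto
    ultimately show ?thesis using L(1) by (intro exI[of _ "max L \<bar>B\<bar>"]) auto
  qed
  define R1 where "R1 = (\<lambda>p. D p (1, 0))"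
  define R2 where "R2 = (\<lambda>p. D p (0, 1))"
  define R12 where "R12 = (\<lambda>p. E p (0, 1))"
  have "\<forall>f\<in>{R, R1, R2, R12}. \<exists>n. times_cont_diff_on (Suc n) f ?S"
    using R[unfolded numeral_3_eq_3] D2[OF basis(1)] D2[OF basis(2)] E2[OF basis(2)]
    unfolding R1_def R2_def R12_def by blast
  then have "\<forall>f\<in>{R, R1, R2, R12}. \<exists>B. B \<ge> 0 \<and> (\<forall>x\<in>{a..b}. \<forall>y\<in>{a..b}. \<bar>f (x, y)\<bar> \<le> B \<and>
       (\<forall>x'\<in>{a..b}. \<forall>y'\<in>{a..b}. \<bar>f (x, y) - f (x', y')\<bar> \<le> B * (\<bar>x - x'\<bar> + \<bar>y - y'\<bar>)))"
    using ex by blast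
  then obtain B where B0: "\<forall>f\<in>{R, R1, R2, R12}. B f \<ge> 0"
    and B: "\<forall>f\<in>{R, R1, R2, R12}. \<forall>x\<in>{a..b}. \<forall>y\<in>{a..b}. \<bar>f (x, y)\<bar> \<le> B f \<and>
       (\<forall>x'\<in>{a..b}. \<forall>y'\<in>{a..b}. \<bar>f (x, y) - f (x', y')\<bar> \<le> B f * (\<bar>x - x'\<bar> + \<bar>y - y'\<bar>))"
    by metis
  define C where "C = (\<Sum>f\<in>{R, R1, R2, R12}. B f)"
  have BC: "B f \<le> C" if "f \<in> {R, R1, R2, R12}" for f
    unfolding C_def using B0 that by (intro member_le_sum) auto
  have "C2_lipschitz_on a b R R1 R2 R12 C"
    unfolding C2_lipschitz_on_def
  proof (intro conjI ballI)
    fix f x y assume f: "f \<in> {R, R1, R2, R12}" and x: "x \<in> {a..b}" and y: "y \<in> {a..b}"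
    show "\<bar>f (x, y)\<bar> \<le> C" using B f x y BC[OF f] by (meson order_trans)
    fix x' y' assume x': "x' \<in> {a..b}" and y': "y' \<in> {a..b}"
    have "\<bar>f (x, y) - f (x', y')\<bar> \<le> B f * (\<bar>x - x'\<bar> + \<bar>y - y'\<bar>)" using B f x y x' y' by blast
    also have "\<dots> \<le> C * (\<bar>x - x'\<bar> + \<bar>y - y'\<bar>)" using BC[OF f] by (intro mult_right_mono) auto
    finally show "\<bar>f (x, y) - f (x', y')\<bar> \<le> C * (\<bar>x - x'\<bar> + \<bar>y - y'\<bar>)" .
  next
    fix x y assume x: "x \<in> {a..b}" and y: "y \<in> {a..b}"
    show "((\<lambda>x. R (x, y)) has_real_derivative R1 (x, y)) (at x within {a..b})"
      "((\<lambda>y. R (x, y)) has_real_derivative R2 (x, y)) (at y within {a..b})"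
      "((\<lambda>y. R1 (x, y)) has_real_derivative R12 (x, y)) (at y within {a..b})"
      unfolding R1_def R2_def R12_def using x y
      by (auto intro!: partial_derivatives_on_square D E)
  qed
  moreover have "C \<ge> 0" unfolding C_def using B0 by (intro sum_nonneg) auto
  ultimately show thesis using that by blast
qed

section \<open>Derivatives of \<tau> powr \<alpha> / (\<alpha> (\<alpha> - 1)) in the
  exponent\<close>

lemma powr_ln_bound:
  assumes a: "1/2 < (a::real)"
  obtains C where "C \<ge> 0"
    "\<And>\<tau> \<alpha>. 0 < \<tau> \<Longrightarrow> \<tau> \<le> T \<Longrightarrow> 2 * a \<le> \<alpha> \<Longrightarrow> \<alpha> \<le> 2 \<Longrightarrow> \<tau> powr \<alpha> * (1 + \<bar>ln \<tau>\<bar>) ^ 3 \<le> C * \<tau>"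
proof -
  \<comment> \<open>As \<alpha> - 1 \<ge> 2a - 1 = 3e, one factor \<tau> powr e is available for
    each of the three logarithms when \<tau> \<le> 1. What remains is a full power of
    \<tau>.\<close>
  define e where "e = (2 * a - 1) / 3"
  have e: "e > 0" using a by (simp add: e_def)
  \<comment> \<open>The first summand serves \<tau> \<le> 1, the second \<tau> > 1, where \<alpha> -
    1 \<le> 1 and ln \<tau> \<le> \<tau> give crude bounds by T.\<close>
  define C where "C = (1 + 1 / e) ^ 3 + \<bar>T\<bar> * (1 + \<bar>T\<bar>) ^ 3"
  have C: "C \<ge> 0" using e by (simp add: C_def)
  have "\<tau> powr \<alpha> * (1 + \<bar>ln \<tau>\<bar>) ^ 3 \<le> C * \<tau>" if t: "0 < \<tau>" "\<tau> \<le> T" and al: "2 * a \<le> \<alpha>" "\<alpha> \<le> 2" for \<tau> \<alpha>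
  proof -
    have "\<tau> powr (\<alpha> - 1) * (1 + \<bar>ln \<tau>\<bar>) ^ 3 \<le> C"
    proof (cases "\<tau> \<le> 1")
      case True
      have "\<bar>ln \<tau>\<bar> = ln (1 / \<tau>)" using True t by (simp add: ln_div)
      also have "\<dots> \<le> (1 / \<tau>) powr e / e" using True t e by (intro ln_powr_bound) auto
      finally have 1: "\<bar>ln \<tau>\<bar> \<le> \<tau> powr (- e) / e" using t by (simp add: powr_divide powr_minus_divide)
      have "1 \<le> \<tau> powr (- e)" using t True e powr_mono'[of "-e" 0 \<tau>] by simp
      with 1 have "1 + \<bar>ln \<tau>\<bar> \<le> (1 + 1 / e) * \<tau> powr (- e)" by (simp add: algebra_simps)
      then have "(1 + \<bar>ln \<tau>\<bar>) ^ 3 \<le> ((1 + 1 / e) * \<tau> powr (- e)) ^ 3" by (intro power_mono) auto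
      also have "\<dots> = (1 + 1 / e) ^ 3 * \<tau> powr (- (3 * e))"
        using t by (simp add: power_mult_distrib powr_powr mult.commute flip: powr_realpow)
      finally have "\<tau> powr (\<alpha> - 1) * (1 + \<bar>ln \<tau>\<bar>) ^ 3 \<le> \<tau> powr (3 * e) * ((1 + 1 / e) ^ 3 * \<tau> powr (- (3 * e)))"
        using t True al by (intro mult_mono powr_mono' zero_le_power add_nonneg_nonneg) (simp_all add: e_def)
      also have "\<dots> = (1 + 1 / e) ^ 3" using t by (simp add: powr_minus)
      also have "\<dots> \<le> C" by (simp add: C_def)
      finally show ?thesis .
    next
      case False
      have "\<tau> powr (\<alpha> - 1) \<le> \<tau> powr 1" using False al a by (intro powr_mono) auto
      then have "\<tau> powr (\<alpha> - 1) \<le> \<bar>T\<bar>" using t by simp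
      moreover have "\<bar>ln \<tau>\<bar> \<le> \<bar>T\<bar>" using False t ln_le_minus_one[of \<tau>] by simp
      ultimately have "\<tau> powr (\<alpha> - 1) * (1 + \<bar>ln \<tau>\<bar>) ^ 3 \<le> \<bar>T\<bar> * (1 + \<bar>T\<bar>) ^ 3"
        by (intro mult_mono power_mono) auto
      also have "\<dots> \<le> C" using e by (simp add: C_def)
      finally show ?thesis .
    qed
    then have "\<tau> * (\<tau> powr (\<alpha> - 1) * (1 + \<bar>ln \<tau>\<bar>) ^ 3) \<le> \<tau> * C" using t by (intro mult_left_mono) auto
    moreover have "\<tau> * \<tau> powr (\<alpha> - 1) = \<tau> powr \<alpha>" using t by (simp add: powr_diff)
    ultimately show ?thesis by (simp add: mult.assoc[symmetric] mult.commute)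
  qed
  then show thesis using that C by blast
qed

text \<open>\<open>powr_quot_deriv k \<tau>\<close> is the \<open>k\<close>-th derivative of \<open>\<alpha> \<mapsto> \<tau> powr \<alpha> / (\<alpha> (\<alpha> - 1))\<close>.\<close>

definition recip_deriv :: "nat \<Rightarrow> real \<Rightarrow> real" where
  "recip_deriv j \<alpha> = (- 1) ^ j * fact j * (1 / (\<alpha> - 1) ^ Suc j - 1 / \<alpha> ^ Suc j)"

definition powr_quot_deriv :: "nat \<Rightarrow> real \<Rightarrow> real \<Rightarrow> real" where
  "powr_quot_deriv k \<tau> \<alpha> = \<tau> powr \<alpha> * (\<Sum>j\<le>k. real (k choose j) * ln \<tau> ^ (k - j) * recip_deriv j \<alpha>)"

lemma powr_quot_deriv_0: "1 < \<alpha> \<Longrightarrow> powr_quot_deriv 0 \<tau> \<alpha> = \<tau> powr \<alpha> / (\<alpha> * (\<alpha> - 1))"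
  by (simp add: powr_quot_deriv_def recip_deriv_def field_simps)

text \<open>By partial fractions 1 / (\<alpha> (\<alpha> - 1)) = 1 / (\<alpha> - 1) - 1 / \<alpha>,
  which is \<open>recip_deriv 0\<close>; in this form derivatives of every order are
  explicit.\<close>

lemma has_real_derivative_recip_deriv:
  assumes "1 < \<alpha>"
  shows "(recip_deriv j has_real_derivative recip_deriv (Suc j) \<alpha>) (at \<alpha> within A)"
proof -
  have "((\<lambda>\<alpha>. 1 / (\<alpha> - c) ^ Suc j) has_real_derivative - real (Suc j) * (1 / (\<alpha> - c) ^ Suc (Suc j))) (at \<alpha> within A)"
    if "\<alpha> > c" for c
  proof -
    have "((\<lambda>\<alpha>. inverse ((\<alpha> - c) ^ Suc j)) has_real_derivative
        - (inverse ((\<alpha> - c) ^ Suc j) * (real (Suc j) * (\<alpha> - c) ^ j) * inverse ((\<alpha> - c) ^ Suc j))) (at \<alpha> within A)"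
      using that by (intro DERIV_inverse' DERIV_cong[OF DERIV_power]) (auto intro!: derivative_eq_intros)
    moreover have "inverse ((\<alpha> - c) ^ Suc j) * (real (Suc j) * (\<alpha> - c) ^ j) * inverse ((\<alpha> - c) ^ Suc j) =
        real (Suc j) * (1 / (\<alpha> - c) ^ Suc (Suc j))"
    proof -
      have "inverse (x ^ Suc j) * (real (Suc j) * x ^ j) * inverse (x ^ Suc j) = real (Suc j) * (1 / x ^ Suc (Suc j))"
        if "x > 0" for x :: real
        using that by (simp add: field_simps)
      then show ?thesis using that by simp
    qed
    ultimately show ?thesis by (simp only: inverse_eq_divide mult_minus_left)
  qed
  from DERIV_cmult[OF DERIV_diff[OF this[of 1] this[of 0]], of "(- 1) ^ j * fact j"] assms
  have "((\<lambda>\<alpha>. (- 1) ^ j * fact j * (1 / (\<alpha> - 1) ^ Suc j - 1 / \<alpha> ^ Suc j)) has_real_derivative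
      (- 1) ^ j * fact j * (- real (Suc j) * (1 / (\<alpha> - 1) ^ Suc (Suc j)) - - real (Suc j) * (1 / \<alpha> ^ Suc (Suc j)))) (at \<alpha> within A)"
    by (simp del: power_Suc)
  moreover have "(- 1) ^ j * fact j * (- real (Suc j) * (1 / (\<alpha> - 1) ^ Suc (Suc j)) - - real (Suc j) * (1 / \<alpha> ^ Suc (Suc j))) = recip_deriv (Suc j) \<alpha>"
  proof -
    have "p * f * (- n * X - - n * Y) = - 1 * p * (n * f) * (X - Y)" for p f n X Y :: real
      by (simp add: algebra_simps)
    then show ?thesis unfolding recip_deriv_def fact_Suc power_Suc[of "-1"] .
  qed
  ultimately show ?thesis unfolding recip_deriv_def[abs_def] by simp
qed

text \<open>Leibniz's rule for \<tau> powr \<alpha> times the reciprocal. Passing from k to k + 1 is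
  Pascal's rule, verified by expanding k = 0, 1, 2. At \<tau> = 0 everything vanishes because
  \<open>0 powr \<alpha> = 0\<close>.\<close>

lemma has_real_derivative_powr_quot_deriv:
  assumes "1 < \<alpha>" "0 \<le> \<tau>" "k \<le> 2"
  shows "(powr_quot_deriv k \<tau> has_real_derivative powr_quot_deriv (Suc k) \<tau> \<alpha>) (at \<alpha> within A)"
proof (cases "\<tau> = 0")
  case True
  then show ?thesis by (simp add: powr_quot_deriv_def[abs_def])
next
  case False
  then have t: "\<tau> > 0" using assms by simp
  have "((\<lambda>\<alpha>. \<tau> powr \<alpha>) has_real_derivative ln \<tau> * \<tau> powr \<alpha>) (at \<alpha> within A)"
    using t by (auto intro!: derivative_eq_intros simp: powr_def mult.commute)
  moreover have "((\<lambda>\<alpha>. \<Sum>j\<le>k. real (k choose j) * ln \<tau> ^ (k - j) * recip_deriv j \<alpha>) has_real_derivative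
      (\<Sum>j\<le>k. real (k choose j) * ln \<tau> ^ (k - j) * recip_deriv (Suc j) \<alpha>)) (at \<alpha> within A)"
    by (intro DERIV_sum DERIV_cmult has_real_derivative_recip_deriv assms)
  ultimately have "(powr_quot_deriv k \<tau> has_real_derivative
      ln \<tau> * \<tau> powr \<alpha> * (\<Sum>j\<le>k. real (k choose j) * ln \<tau> ^ (k - j) * recip_deriv j \<alpha>) +
      (\<Sum>j\<le>k. real (k choose j) * ln \<tau> ^ (k - j) * recip_deriv (Suc j) \<alpha>) * \<tau> powr \<alpha>) (at \<alpha> within A)"
    unfolding powr_quot_deriv_def[abs_def] by (rule DERIV_mult)
  moreover have "ln \<tau> * \<tau> powr \<alpha> * (\<Sum>j\<le>k. real (k choose j) * ln \<tau> ^ (k - j) * recip_deriv j \<alpha>) +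
      (\<Sum>j\<le>k. real (k choose j) * ln \<tau> ^ (k - j) * recip_deriv (Suc j) \<alpha>) * \<tau> powr \<alpha> = powr_quot_deriv (Suc k) \<tau> \<alpha>"
  proof -
    have "k = 0 \<or> k = 1 \<or> k = 2" using assms(3) by auto
    then show ?thesis
      by (elim disjE; simp add: powr_quot_deriv_def eval_nat_numeral; simp add: algebra_simps)
  qed
  ultimately show ?thesis by simp
qed

text \<open>As \<alpha> stays above 2a > 1, the reciprocal factors are uniformly bounded, and the
  powers of ln \<tau> are absorbed by \<tau> powr (\<alpha> - 1). The linear rate in \<tau> later
  becomes the Lipschitz bound in time.\<close>

lemma powr_quot_deriv_bound:
  assumes a: "1/2 < (a::real)" and b: "b < 1"
  obtains C where "C \<ge> 0"
    "\<And>\<tau> \<alpha> k. 0 \<le> \<tau> \<Longrightarrow> \<tau> \<le> T \<Longrightarrow> 2 * a \<le> \<alpha> \<Longrightarrow> \<alpha> \<le> 2 * b \<Longrightarrow> k \<le> 3 \<Longrightarrow> \<bar>powr_quot_deriv k \<tau> \<alpha>\<bar> \<le> C * \<tau>"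
proof -
  obtain C where C: "C \<ge> 0"
    "\<And>\<tau> \<alpha>. 0 < \<tau> \<Longrightarrow> \<tau> \<le> T \<Longrightarrow> 2 * a \<le> \<alpha> \<Longrightarrow> \<alpha> \<le> 2 \<Longrightarrow> \<tau> powr \<alpha> * (1 + \<bar>ln \<tau>\<bar>) ^ 3 \<le> C * \<tau>"
    by (rule powr_ln_bound[OF a]) (rule that)
  \<comment> \<open>6 = 3! bounds the factorials for j \<le> 3. The powers 1 to 4 of 1 / (2a - 1)
    cover \<open>1 / (\<alpha> - 1) ^ Suc j\<close>, and the final 1 covers
    \<open>1 / \<alpha> ^ Suc j\<close>.\<close>
  define V where "V = 6 * (1 / (2 * a - 1) ^ 4 + 1 / (2 * a - 1) ^ 3 + 1 / (2 * a - 1) ^ 2 + 1 / (2 * a - 1) + 1)"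
  have V: "\<bar>recip_deriv j \<alpha>\<bar> \<le> V" if "j \<le> 3" "2 * a \<le> \<alpha>" for j \<alpha>
  proof -
    have 1: "1 / \<alpha> ^ Suc j \<le> 1 / (2 * a) ^ Suc j" "1 / (\<alpha> - 1) ^ Suc j \<le> 1 / (2 * a - 1) ^ Suc j"
      using that a by (intro divide_left_mono power_mono mult_pos_pos zero_less_power; simp)+
    have 0: "0 \<le> 1 / \<alpha> ^ Suc j" "0 \<le> 1 / (\<alpha> - 1) ^ Suc j"
      using that a by (intro divide_nonneg_nonneg zero_le_power; simp)+
    have 2: "1 / (2 * a) ^ Suc j \<le> 1" using divide_left_mono[OF one_le_power[of "2 * a" "Suc j"], of 1] a by simp
    have j: "j = 0 \<or> j = 1 \<or> j = 2 \<or> j = 3" using that by auto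
    have 3: "0 \<le> 1 / (2 * a - 1) ^ i" for i :: nat using a by simp
    have "1 / (2 * a - 1) ^ Suc j + 1 \<le> V / 6" 
      using j 3[of 1] 3[of 2] 3[of 3] 3[of 4] unfolding V_def by (auto simp: eval_nat_numeral)
    then have "\<bar>1 / (\<alpha> - 1) ^ Suc j - 1 / \<alpha> ^ Suc j\<bar> \<le> V / 6" using 0 1 2 by linarith
    moreover have "(fact j :: real) \<le> 6" using j by (auto simp: eval_nat_numeral)
    ultimately have "fact j * \<bar>1 / (\<alpha> - 1) ^ Suc j - 1 / \<alpha> ^ Suc j\<bar> \<le> 6 * (V / 6)"
      by (intro mult_mono) auto
    then show ?thesis by (simp add: recip_deriv_def abs_mult)
  qed
  then have V0: "V \<ge> 0" using V[of 0 "2 * a"] by linarith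
  \<comment> \<open>8 = 2^3 bounds the sum of the binomial coefficients in row k \<le> 3.\<close>
  have "\<bar>powr_quot_deriv k \<tau> \<alpha>\<bar> \<le> (8 * V * C) * \<tau>" if h: "0 \<le> \<tau>" "\<tau> \<le> T" "2 * a \<le> \<alpha>" "\<alpha> \<le> 2 * b" "k \<le> 3" for \<tau> \<alpha> k
  proof (cases "\<tau> = 0")
    case False
    let ?l = "1 + \<bar>ln \<tau>\<bar>"
    have "\<bar>\<Sum>j\<le>k. real (k choose j) * ln \<tau> ^ (k - j) * recip_deriv j \<alpha>\<bar> \<le> (\<Sum>j\<le>k. real (k choose j) * (?l ^ 3 * V))"
    proof (rule order_trans[OF sum_abs], rule sum_mono)
      fix j assume j: "j \<in> {..k}"
      have "\<bar>ln \<tau> ^ (k - j)\<bar> \<le> ?l ^ (k - j)" by (simp add: power_abs power_mono)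
      also have "\<dots> \<le> ?l ^ 3" using h j by (intro power_increasing) auto
      finally have "\<bar>ln \<tau> ^ (k - j)\<bar> * \<bar>recip_deriv j \<alpha>\<bar> \<le> ?l ^ 3 * V"
        using V[of j \<alpha>] h j by (intro mult_mono) auto
      then show "\<bar>real (k choose j) * ln \<tau> ^ (k - j) * recip_deriv j \<alpha>\<bar> \<le> real (k choose j) * (?l ^ 3 * V)"
        by (simp add: abs_mult mult.assoc mult_left_mono)
    qed
    also have "\<dots> = 2 ^ k * (?l ^ 3 * V)"
      by (simp add: sum_distrib_right[symmetric] choose_row_sum flip: of_nat_sum)
    also have "\<dots> \<le> 2 ^ 3 * (?l ^ 3 * V)" using h V0 by (intro mult_right_mono power_increasing) auto
    finally have "\<bar>powr_quot_deriv k \<tau> \<alpha>\<bar> \<le> \<tau> powr \<alpha> * (8 * (?l ^ 3 * V))"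
      by (simp add: powr_quot_deriv_def abs_mult mult_left_mono)
    also have "\<dots> = 8 * V * (\<tau> powr \<alpha> * ?l ^ 3)" by simp
    also have "\<dots> \<le> 8 * V * (C * \<tau>)" using C(2)[of \<tau> \<alpha>] h False b V0 by (intro mult_left_mono) auto
    finally show ?thesis by simp
  qed (simp add: powr_quot_deriv_def)
  then show thesis using that[of "8 * V * C"] V0 C(1) by auto
qed

section \<open>Mixed second differences of the covariance\<close>

lemma mixed_difference_mvt:
  fixes u ux uxy :: "real \<Rightarrow> real \<Rightarrow> real"
  assumes x: "a \<le> x1" "x1 \<le> x2" "x2 \<le> b" and y: "a \<le> y1" "y1 \<le> y2" "y2 \<le> b"
    and ux: "\<And>x y. x \<in> {a..b} \<Longrightarrow> y \<in> {a..b} \<Longrightarrow> ((\<lambda>x. u x y) has_real_derivative ux x y) (at x within {a..b})"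
    and uxy: "\<And>x y. x \<in> {a..b} \<Longrightarrow> y \<in> {a..b} \<Longrightarrow> ((\<lambda>y. ux x y) has_real_derivative uxy x y) (at y within {a..b})"
  shows "\<exists>\<xi>\<in>{x1..x2}. \<exists>\<eta>\<in>{y1..y2}. u x2 y2 - u x1 y2 - u x2 y1 + u x1 y1 = (x2 - x1) * (y2 - y1) * uxy \<xi> \<eta>"
proof -
  \<comment> \<open>The mean value theorem in x is applied to the difference of the sections at y2
    and y1, and then the one in y to \<open>ux\<close> at the point just found.\<close>
  have "((\<lambda>x. u x y2 - u x y1) has_derivative (*) (ux x y2 - ux x y1)) (at x within {x1..x2})"
    if "x1 \<le> x" "x \<le> x2" for x
  proof -
    have "((\<lambda>x. u x y2 - u x y1) has_real_derivative (ux x y2 - ux x y1)) (at x within {a..b})"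
      using that x y by (intro DERIV_diff ux) auto
    then show ?thesis using x has_field_derivative_subset[of _ _ x "{a..b}" "{x1..x2}"]
      by (auto simp: has_field_derivative_def[symmetric])
  qed
  from mvt_very_simple[OF x(2) this] obtain \<xi>
    where \<xi>: "\<xi> \<in> {x1..x2}" "u x2 y2 - u x2 y1 - (u x1 y2 - u x1 y1) = (ux \<xi> y2 - ux \<xi> y1) * (x2 - x1)"
    by auto
  have "((\<lambda>y. ux \<xi> y) has_derivative (*) (uxy \<xi> y)) (at y within {y1..y2})"
    if "y1 \<le> y" "y \<le> y2" for y
  proof -
    have "((\<lambda>y. ux \<xi> y) has_real_derivative (uxy \<xi> y)) (at y within {a..b})"
      using that x y \<xi>(1) by (intro uxy) auto
    then show ?thesis using y has_field_derivative_subset[of _ _ y "{a..b}" "{y1..y2}"]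
      by (auto simp: has_field_derivative_def[symmetric])
  qed
  from mvt_very_simple[OF y(2) this] obtain \<eta>
    where \<eta>: "\<eta> \<in> {y1..y2}" "ux \<xi> y2 - ux \<xi> y1 = uxy \<xi> \<eta> * (y2 - y1)"
    by auto
  have "u x2 y2 - u x1 y2 - u x2 y1 + u x1 y1 = (ux \<xi> y2 - ux \<xi> y1) * (x2 - x1)"
    using \<xi>(2) by linarith
  also have "\<dots> = (x2 - x1) * (y2 - y1) * uxy \<xi> \<eta>" unfolding \<eta>(2) by simp
  finally show ?thesis using \<xi>(1) \<eta>(1) by blast
qed

definition mixed_diff :: "(real \<Rightarrow> real \<Rightarrow> real) \<Rightarrow> real \<Rightarrow> real \<Rightarrow> real \<Rightarrow> real \<Rightarrow> real" where
  "mixed_diff u x1 x2 y1 y2 = u x2 y2 - u x1 y2 - u x2 y1 + u x1 y1"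

text \<open>\<open>g\<close> stands for the mixed partial derivative of \<open>u\<close>, recorded
  only through its mean value property. The bound \<open>e\<close> is kept apart from the Lipschitz
  constant \<open>L\<close> because for the covariance \<open>e\<close> shrinks with the time
  parameter while \<open>L\<close> does not.\<close>

definition lipschitz_mixed_partial ::
  "real \<Rightarrow> real \<Rightarrow> (real \<Rightarrow> real \<Rightarrow> real) \<Rightarrow> real \<Rightarrow> real \<Rightarrow> (real \<Rightarrow> real \<Rightarrow> real) \<Rightarrow> bool" where
  "lipschitz_mixed_partial a b u L e g \<longleftrightarrow>
    (\<forall>x1 x2 y1 y2. a \<le> x1 \<and> x1 \<le> x2 \<and> x2 \<le> b \<and> a \<le> y1 \<and> y1 \<le> y2 \<and> y2 \<le> b \<longrightarrow>
      (\<exists>\<xi>\<in>{x1..x2}. \<exists>\<eta>\<in>{y1..y2}. mixed_diff u x1 x2 y1 y2 = (x2 - x1) * (y2 - y1) * g \<xi> \<eta>)) \<and>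
    (\<forall>x\<in>{a..b}. \<forall>y\<in>{a..b}. \<bar>g x y\<bar> \<le> e \<and>
      (\<forall>x'\<in>{a..b}. \<forall>y'\<in>{a..b}. \<bar>g x y - g x' y'\<bar> \<le> L * (\<bar>x - x'\<bar> + \<bar>y - y'\<bar>)))"

text \<open>The common shape of the three terms of the covariance of W, at \<tau> = t, s and \<bar>t
  - s\<bar>.\<close>

definition cov_part :: "(real \<times> real \<Rightarrow> real) \<Rightarrow> real \<Rightarrow> real \<Rightarrow> real \<Rightarrow> real" where
  "cov_part R \<tau> x y = R (x, y) * (\<tau> powr (x + y) / ((x + y) * (x + y - 1)))"

lemma abs_mult_diff_le:
  fixes f f' g g' :: real
  assumes "\<bar>f'\<bar> \<le> B" "\<bar>f - f'\<bar> \<le> B * d" "\<bar>g\<bar> \<le> E" "\<bar>g - g'\<bar> \<le> E * d"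
  shows "\<bar>f * g - f' * g'\<bar> \<le> 2 * (B * E * d)"
proof -
  have "f * g - f' * g' = (f - f') * g + f' * (g - g')" by (simp add: algebra_simps)
  also have "\<bar>\<dots>\<bar> \<le> \<bar>f - f'\<bar> * \<bar>g\<bar> + \<bar>f'\<bar> * \<bar>g - g'\<bar>"
    by (rule order_trans[OF abs_triangle_ineq]) (simp add: abs_mult)
  also have "\<dots> \<le> (B * d) * E + B * (E * d)"
    using assms by (intro add_mono mult_mono) linarith+
  finally show ?thesis by (simp add: algebra_simps)
qed

text \<open>By the product rule the mixed derivative is a sum of four products of a partial
  derivative of \<open>R\<close> with a \<open>powr_quot_deriv\<close> of order at most 2; order 3
  enters through the Lipschitz bounds. The factor \<tau> in the sup bound makes the term at \<tau> =
  \<bar>t - s\<bar> small near the diagonal.\<close>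

lemma cov_part_mixed_difference:
  assumes R: "C2_lipschitz_on a b R R1 R2 R12 B" and B: "B \<ge> 0"
    and a: "1/2 < a" and b: "b < 1" and T: "T \<ge> 0"
  obtains C where "C \<ge> 0"
    "\<And>\<tau>. 0 \<le> \<tau> \<Longrightarrow> \<tau> \<le> T \<Longrightarrow> \<exists>g. lipschitz_mixed_partial a b (cov_part R \<tau>) C (C * \<tau>) g"
proof -
  obtain E where E: "E \<ge> 0"
    "\<And>\<tau> \<alpha> k. 0 \<le> \<tau> \<Longrightarrow> \<tau> \<le> T \<Longrightarrow> 2 * a \<le> \<alpha> \<Longrightarrow> \<alpha> \<le> 2 * b \<Longrightarrow> k \<le> 3 \<Longrightarrow> \<bar>powr_quot_deriv k \<tau> \<alpha>\<bar> \<le> E * \<tau>"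
    by (rule powr_quot_deriv_bound[OF a b]) (rule that)
  have EL: "\<bar>powr_quot_deriv k \<tau> \<alpha> - powr_quot_deriv k \<tau> \<beta>\<bar> \<le> E * \<tau> * \<bar>\<alpha> - \<beta>\<bar>"
    if "0 \<le> \<tau>" "\<tau> \<le> T" "\<alpha> \<in> {2 * a..2 * b}" "\<beta> \<in> {2 * a..2 * b}" "k \<le> 2" for \<tau> \<alpha> \<beta> k
  proof -
    have "norm (powr_quot_deriv k \<tau> \<alpha> - powr_quot_deriv k \<tau> \<beta>) \<le> E * \<tau> * norm (\<alpha> - \<beta>)"
      by (rule field_differentiable_bound[where S="{2 * a..2 * b}" and f'="powr_quot_deriv (Suc k) \<tau>"])
        (use that a E(2) in \<open>auto intro!: has_real_derivative_powr_quot_deriv\<close>)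
    then show ?thesis by simp
  qed
  \<comment> \<open>8 is four products times the 2 of \<open>abs_mult_diff_le\<close>; T + 1
    dominates \<tau> in the Lipschitz bound and 1 in the sup bound.\<close>
  define C where "C = 8 * (B * E) * (T + 1)"
  have C0: "C \<ge> 0" using B E(1) T by (simp add: C_def)
  note R' = R[unfolded C2_lipschitz_on_def]
  have "\<exists>g. lipschitz_mixed_partial a b (cov_part R \<tau>) C (C * \<tau>) g"
    if t: "0 \<le> \<tau>" "\<tau> \<le> T" for \<tau>
  proof -
    define ux where "ux x y = R1 (x, y) * powr_quot_deriv 0 \<tau> (x + y) + R (x, y) * powr_quot_deriv 1 \<tau> (x + y)" for x y
    define g where "g x y = R12 (x, y) * powr_quot_deriv 0 \<tau> (x + y) + R1 (x, y) * powr_quot_deriv 1 \<tau> (x + y) +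
      (R2 (x, y) * powr_quot_deriv 1 \<tau> (x + y) + R (x, y) * powr_quot_deriv 2 \<tau> (x + y))" for x y
    have cov_part: "cov_part R \<tau> x y = R (x, y) * powr_quot_deriv 0 \<tau> (x + y)" if "x \<in> {a..b}" "y \<in> {a..b}" for x y
      using powr_quot_deriv_0[of "x + y" \<tau>] that a by (simp add: cov_part_def)
    have dw: "((\<lambda>x. powr_quot_deriv k \<tau> (x + y)) has_real_derivative powr_quot_deriv (Suc k) \<tau> (x + y)) (at x within {a..b})"
      "((\<lambda>x. powr_quot_deriv k \<tau> (y + x)) has_real_derivative powr_quot_deriv (Suc k) \<tau> (y + x)) (at x within {a..b})"
      if "x \<in> {a..b}" "y \<in> {a..b}" "k \<le> 2" for x y k
    proof -
      have 1: "1 < x + y" using that a by auto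
      show 2: "((\<lambda>x. powr_quot_deriv k \<tau> (x + y)) has_real_derivative powr_quot_deriv (Suc k) \<tau> (x + y)) (at x within {a..b})"
      proof -
        have "((\<lambda>x. x + y) has_real_derivative 1) (at x within {a..b})"
          by (auto intro!: derivative_eq_intros)
        from DERIV_chain2[where f="powr_quot_deriv k \<tau>" and g="\<lambda>x. x + y", OF has_real_derivative_powr_quot_deriv[OF 1 t(1) that(3)] this]
        show ?thesis by simp
      qed
      then show "((\<lambda>x. powr_quot_deriv k \<tau> (y + x)) has_real_derivative powr_quot_deriv (Suc k) \<tau> (y + x)) (at x within {a..b})"
        by (simp add: add.commute)
    qed
    have R_deriv: "((\<lambda>x. R (x, y)) has_real_derivative R1 (x, y)) (at x within {a..b})"
       "((\<lambda>y. R (x, y)) has_real_derivative R2 (x, y)) (at y within {a..b})"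
       "((\<lambda>y. R1 (x, y)) has_real_derivative R12 (x, y)) (at y within {a..b})"
      if "x \<in> {a..b}" "y \<in> {a..b}" for x y
      using R' that by auto
    have "((\<lambda>x. R (x, y) * powr_quot_deriv 0 \<tau> (x + y)) has_real_derivative ux x y) (at x within {a..b})"
      if "x \<in> {a..b}" "y \<in> {a..b}" for x y
      using DERIV_mult[OF R_deriv(1)[OF that] dw(1)[OF that, of 0]] by (simp add: ux_def mult.commute)
    moreover have "((\<lambda>y. ux x y) has_real_derivative g x y) (at y within {a..b})"
      if "x \<in> {a..b}" "y \<in> {a..b}" for x y
      unfolding ux_def
      using DERIV_add[OF DERIV_mult[OF R_deriv(3)[OF that] dw(2)[OF that(2,1), of 0]]
          DERIV_mult[OF R_deriv(2)[OF that] dw(2)[OF that(2,1), of 1]]]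
      by (simp add: g_def mult.commute numeral_2_eq_2)
    ultimately have mixed: "\<exists>\<xi>\<in>{x1..x2}. \<exists>\<eta>\<in>{y1..y2}. mixed_diff (cov_part R \<tau>) x1 x2 y1 y2 =
             (x2 - x1) * (y2 - y1) * g \<xi> \<eta>"
      if "a \<le> x1" "x1 \<le> x2" "x2 \<le> b" "a \<le> y1" "y1 \<le> y2" "y2 \<le> b" for x1 x2 y1 y2
      using mixed_difference_mvt[where u="\<lambda>x y. R (x, y) * powr_quot_deriv 0 \<tau> (x + y)" and ux=ux and uxy=g, OF that]
        that by (simp add: cov_part mixed_diff_def)
    have bd: "\<bar>f (x, y)\<bar> \<le> B" if "f \<in> {R, R1, R2, R12}" "x \<in> {a..b}" "y \<in> {a..b}" for f x y
      using R' that by blast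
    have lip: "\<bar>f (x, y) - f (x', y')\<bar> \<le> B * (\<bar>x - x'\<bar> + \<bar>y - y'\<bar>)"
      if "f \<in> {R, R1, R2, R12}" "x \<in> {a..b}" "y \<in> {a..b}" "x' \<in> {a..b}" "y' \<in> {a..b}" for f x y x' y'
      using R' that by blast
    have w_bd: "\<bar>powr_quot_deriv k \<tau> (x + y)\<bar> \<le> E * \<tau>" if "k \<le> 2" "x \<in> {a..b}" "y \<in> {a..b}" for k x y
      using E(2)[OF t, of "x + y" k] that by auto
    have w_lip: "\<bar>powr_quot_deriv k \<tau> (x + y) - powr_quot_deriv k \<tau> (x' + y')\<bar> \<le> E * \<tau> * (\<bar>x - x'\<bar> + \<bar>y - y'\<bar>)"
      if "k \<le> 2" "x \<in> {a..b}" "y \<in> {a..b}" "x' \<in> {a..b}" "y' \<in> {a..b}" for k x y x' y'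
    proof -
      have "\<bar>powr_quot_deriv k \<tau> (x + y) - powr_quot_deriv k \<tau> (x' + y')\<bar> \<le> E * \<tau> * \<bar>x + y - (x' + y')\<bar>"
        using EL[OF t, of "x + y" "x' + y'" k] that by auto
      also have "\<dots> \<le> E * \<tau> * (\<bar>x - x'\<bar> + \<bar>y - y'\<bar>)" using E(1) t by (intro mult_left_mono) auto
      finally show ?thesis .
    qed
    have p: "\<bar>f (x, y) * powr_quot_deriv k \<tau> (x + y)\<bar> \<le> B * (E * \<tau>)"
      if "f \<in> {R, R1, R2, R12}" "k \<le> 2" "x \<in> {a..b}" "y \<in> {a..b}" for f k x y
      unfolding abs_mult using bd w_bd that B by (intro mult_mono) auto
    have q: "\<bar>f (x, y) * powr_quot_deriv k \<tau> (x + y) - f (x', y') * powr_quot_deriv k \<tau> (x' + y')\<bar> \<le> 2 * (B * (E * \<tau>) * (\<bar>x - x'\<bar> + \<bar>y - y'\<bar>))"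
      if "f \<in> {R, R1, R2, R12}" "k \<le> 2" "x \<in> {a..b}" "y \<in> {a..b}" "x' \<in> {a..b}" "y' \<in> {a..b}" for f k x y x' y'
      using that by (intro abs_mult_diff_le bd lip w_bd w_lip) auto
    have "\<bar>g x y\<bar> \<le> C * \<tau>" if "x \<in> {a..b}" "y \<in> {a..b}" for x y
    proof -
      have "\<bar>g x y\<bar> \<le> 4 * (B * (E * \<tau>))"
        unfolding g_def using p[OF _ _ that, of R12 0] p[OF _ _ that, of R1 1] p[OF _ _ that, of R2 1] p[OF _ _ that, of R 2]
        by simp
      also have "\<dots> = 4 * (B * E) * \<tau>" by simp
      also have "\<dots> \<le> C * \<tau>"
      proof (rule mult_right_mono[OF _ t(1)])
        have "4 * (B * E) * 1 \<le> 8 * (B * E) * (T + 1)" using B E(1) T by (intro mult_mono) auto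
        then show "4 * (B * E) \<le> C" by (simp add: C_def)
      qed
      finally show ?thesis .
    qed
    moreover have "\<bar>g x y - g x' y'\<bar> \<le> C * (\<bar>x - x'\<bar> + \<bar>y - y'\<bar>)"
      if "x \<in> {a..b}" "y \<in> {a..b}" "x' \<in> {a..b}" "y' \<in> {a..b}" for x y x' y'
    proof -
      have sum4: "\<bar>p1 + p2 + (p3 + p4) - (q1 + q2 + (q3 + q4))\<bar> \<le> 4 * e"
        if "\<bar>p1 - q1\<bar> \<le> e" "\<bar>p2 - q2\<bar> \<le> e" "\<bar>p3 - q3\<bar> \<le> e" "\<bar>p4 - q4\<bar> \<le> e" for p1 p2 p3 p4 q1 q2 q3 q4 e :: real
        using that by linarith
      have "\<bar>g x y - g x' y'\<bar> \<le> 4 * (2 * (B * (E * \<tau>) * (\<bar>x - x'\<bar> + \<bar>y - y'\<bar>)))"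
        unfolding g_def using that by (intro sum4 q) auto
      also have "\<dots> = 8 * (B * E) * \<tau> * (\<bar>x - x'\<bar> + \<bar>y - y'\<bar>)" by simp
      also have "\<dots> \<le> C * (\<bar>x - x'\<bar> + \<bar>y - y'\<bar>)"
        unfolding C_def using B E(1) t T by (intro mult_right_mono mult_left_mono) auto
      finally show ?thesis .
    qed
    ultimately show ?thesis using mixed unfolding lipschitz_mixed_partial_def by (intro exI[of _ g]) blast
  qed
  then show thesis using that C0 by blast
qed

subsection \<open>The covariance as a double integral\<close>

text \<open>As \<open>R\<close> need not be symmetric, the covariance kernel takes
  \<open>R (x, y)\<close> on one side of the diagonal and \<open>R (y, x)\<close> on the other, so
  \<bar>\<theta> - \<sigma>\<bar> powr (\<alpha> - 2) is split into two halves. The diagonal,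
  included here, carries the value 0 because \<open>0 powr c = 0\<close>.\<close>

definition upper_kernel :: "real \<Rightarrow> real \<Rightarrow> real \<Rightarrow> real" where
  "upper_kernel \<alpha> \<theta> \<sigma> = (if \<sigma> \<le> \<theta> then (\<theta> - \<sigma>) powr (\<alpha> - 2) else 0)"

text \<open>The integral of the half kernel over (0, t] times (0, s]. The truncation
  \<open>max 0\<close> covers s > t, where the strip \<sigma> > t contributes nothing.\<close>

definition upper_integral :: "real \<Rightarrow> real \<Rightarrow> real \<Rightarrow> real" where
  "upper_integral \<alpha> t s = (t powr \<alpha> - max 0 (t - s) powr \<alpha>) / (\<alpha> * (\<alpha> - 1))"

lemma upper_kernel_measurable [measurable]: "case_prod (upper_kernel \<alpha>) \<in> borel_measurable (lborel \<Otimes>\<^sub>M lborel)"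
  unfolding upper_kernel_def[abs_def] by measurable

lemma nn_integral_powr_Icc:
  assumes "-1 < \<beta>" "0 \<le> c"
  shows "(\<integral>\<^sup>+ x. ennreal (x powr \<beta>) * indicator {0..c} x \<partial>lborel) = ennreal (c powr (\<beta> + 1) / (\<beta> + 1))"
  using has_integral_powr_from_0[OF assms] by (intro nn_integral_has_integral_lebesgue') auto

lemma nn_integral_powr_Ioc:
  assumes "-1 < \<beta>" "0 \<le> c" "c \<le> d"
  shows "(\<integral>\<^sup>+ x. ennreal (x powr \<beta>) * indicator {c<..d} x \<partial>lborel) = ennreal ((d powr (\<beta> + 1) - c powr (\<beta> + 1)) / (\<beta> + 1))"
proof -
  let ?X = "\<integral>\<^sup>+ x. ennreal (x powr \<beta>) * indicator {c<..d} x \<partial>lborel"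
  have "ennreal (d powr (\<beta> + 1) / (\<beta> + 1)) = (\<integral>\<^sup>+ x. ennreal (x powr \<beta>) * indicator {0..d} x \<partial>lborel)"
    using assms by (simp add: nn_integral_powr_Icc)
  also have "\<dots> = (\<integral>\<^sup>+ x. ennreal (x powr \<beta>) * indicator {0..c} x + ennreal (x powr \<beta>) * indicator {c<..d} x \<partial>lborel)"
    using assms by (intro nn_integral_cong) (auto simp: indicator_def)
  also have "\<dots> = ennreal (c powr (\<beta> + 1) / (\<beta> + 1)) + ?X"
    using assms by (subst nn_integral_add) (auto simp: nn_integral_powr_Icc)
  finally have "?X = ennreal (d powr (\<beta> + 1) / (\<beta> + 1)) - ennreal (c powr (\<beta> + 1) / (\<beta> + 1))"
    by simp
  also have "\<dots> = ennreal (d powr (\<beta> + 1) / (\<beta> + 1) - c powr (\<beta> + 1) / (\<beta> + 1))"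
    using assms by (intro ennreal_minus) auto
  finally show ?thesis by (simp add: diff_divide_distrib)
qed

text \<open>Nonnegative integrals let Tonelli deal with the diagonal singularity; finiteness, due to
  \<alpha> > 1, then yields integrability. The inner variable is translated by \<sigma>, the outer
  one replaced by t - \<sigma>.\<close>

lemma nn_integral_upper_kernel:
  assumes \<alpha>: "1 < \<alpha>" and t: "0 \<le> t" and s: "0 \<le> s"
  shows "(\<integral>\<^sup>+ p. ennreal (indicator {0<..t} (fst p) * indicator {0<..s} (snd p) * upper_kernel \<alpha> (fst p) (snd p)) \<partial>(lborel \<Otimes>\<^sub>M lborel))
    = ennreal (upper_integral \<alpha> t s)" (is "?L = _")
proof -
  have "?L = (\<integral>\<^sup>+ \<sigma>. \<integral>\<^sup>+ \<theta>. ennreal (indicator {0<..t} \<theta> * indicator {0<..s} \<sigma> * upper_kernel \<alpha> \<theta> \<sigma>) \<partial>lborel \<partial>lborel)"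
    by (subst lborel_pair.nn_integral_snd[symmetric]) auto
  also have "\<dots> = (\<integral>\<^sup>+ \<sigma>. ennreal (indicator {0<..s} \<sigma> * (max 0 (t - \<sigma>) powr (\<alpha> - 1) / (\<alpha> - 1))) \<partial>lborel)"
  proof (intro nn_integral_cong)
    fix \<sigma> :: real
    show "(\<integral>\<^sup>+ \<theta>. ennreal (indicator {0<..t} \<theta> * indicator {0<..s} \<sigma> * upper_kernel \<alpha> \<theta> \<sigma>) \<partial>lborel) =
        ennreal (indicator {0<..s} \<sigma> * (max 0 (t - \<sigma>) powr (\<alpha> - 1) / (\<alpha> - 1)))"
    proof (cases "\<sigma> \<in> {0<..s}")
      case True
      have "(\<integral>\<^sup>+ \<theta>. ennreal (indicator {0<..t} \<theta> * indicator {0<..s} \<sigma> * upper_kernel \<alpha> \<theta> \<sigma>) \<partial>lborel) =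
         (\<integral>\<^sup>+ \<theta>. ennreal (indicator {0<..t} \<theta> * upper_kernel \<alpha> \<theta> \<sigma>) \<partial>lborel)"
        using True by simp
      also have "\<dots> = (\<integral>\<^sup>+ x. ennreal (indicator {0<..t} (\<sigma> + 1 * x) * upper_kernel \<alpha> (\<sigma> + 1 * x) \<sigma>) \<partial>lborel)"
        by (subst nn_integral_real_affine[where c=1 and t=\<sigma>]) (auto simp: upper_kernel_def)
      also have "\<dots> = (\<integral>\<^sup>+ x. ennreal (x powr (\<alpha> - 2)) * indicator {0..t - \<sigma>} x \<partial>lborel)"
        using True by (intro nn_integral_cong) (auto simp: upper_kernel_def indicator_def)
      also have "\<dots> = ennreal (max 0 (t - \<sigma>) powr (\<alpha> - 1) / (\<alpha> - 1))"
      proof (cases "\<sigma> \<le> t")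
        case True
        then show ?thesis using \<alpha> by (subst nn_integral_powr_Icc) (auto simp: max_def)
      next
        case False
        then show ?thesis by simp
      qed
      finally show ?thesis using True by simp
    qed simp
  qed
  also have "\<dots> = (\<integral>\<^sup>+ x. ennreal (indicator {0<..s} (t + (-1) * x) * (max 0 (t - (t + (-1) * x)) powr (\<alpha> - 1) / (\<alpha> - 1))) \<partial>lborel)"
    by (subst nn_integral_real_affine[where c="-1" and t=t]) auto
  also have "\<dots> = (\<integral>\<^sup>+ x. ennreal (1 / (\<alpha> - 1)) * (ennreal (x powr (\<alpha> - 1)) * indicator {max 0 (t - s)<..t} x) \<partial>lborel)"
  proof (rule nn_integral_cong_AE)
    \<comment> \<open>The reflection exchanges open and closed ends, so the integrands agree only
      off the two endpoints.\<close>
    have "AE x in lborel. x \<noteq> t" "AE x in lborel. x \<noteq> max 0 (t - s)" by (rule AE_lborel_singleton)+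
    then show "AE x in lborel. ennreal (indicator {0<..s} (t + (-1) * x) * (max 0 (t - (t + (-1) * x)) powr (\<alpha> - 1) / (\<alpha> - 1))) =
      ennreal (1 / (\<alpha> - 1)) * (ennreal (x powr (\<alpha> - 1)) * indicator {max 0 (t - s)<..t} x)"
    proof eventually_elim
      case (elim x)
      then show ?case using \<alpha> by (auto simp: indicator_def max_def ennreal_mult[symmetric])
    qed
  qed
  also have "\<dots> = ennreal (1 / (\<alpha> - 1)) * ennreal ((t powr \<alpha> - max 0 (t - s) powr \<alpha>) / \<alpha>)"
    using assms nn_integral_powr_Ioc[of "\<alpha> - 1" "max 0 (t - s)" t] by (subst nn_integral_cmult) auto
  also have "\<dots> = ennreal (upper_integral \<alpha> t s)"
    using assms by (subst ennreal_mult[symmetric]) (auto simp: upper_integral_def mult.commute intro!: divide_nonneg_nonneg powr_mono2)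
  finally show ?thesis .
qed

lemma upper_integral_nonneg: "1 < \<alpha> \<Longrightarrow> 0 \<le> t \<Longrightarrow> 0 \<le> s \<Longrightarrow> 0 \<le> upper_integral \<alpha> t s"
  by (auto simp: upper_integral_def intro!: divide_nonneg_nonneg powr_mono2)

lemma has_bochner_integral_upper_kernel:
  assumes \<alpha>: "1 < \<alpha>" and t: "0 \<le> t" and s: "0 \<le> s"
  shows "has_bochner_integral (lborel \<Otimes>\<^sub>M lborel)
      (\<lambda>p. indicator {0<..t} (fst p) * indicator {0<..s} (snd p) * upper_kernel \<alpha> (fst p) (snd p)) (upper_integral \<alpha> t s)" (is ?A)
    and "has_bochner_integral (lborel \<Otimes>\<^sub>M lborel)
      (\<lambda>p. indicator {0<..t} (fst p) * indicator {0<..s} (snd p) * upper_kernel \<alpha> (snd p) (fst p)) (upper_integral \<alpha> s t)" (is ?B)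
proof -
  have nn: "0 \<le> indicator {0<..t} x * indicator {0<..s} y * upper_kernel \<alpha> z w" for x y z w t s :: real
    by (auto simp: upper_kernel_def indicator_def)
  show ?A
    using nn_integral_upper_kernel[OF assms] upper_integral_nonneg[OF assms] nn by (intro has_bochner_integral_nn_integral) auto
  have "(\<integral>\<^sup>+ p. ennreal (indicator {0<..t} (fst p) * indicator {0<..s} (snd p) * upper_kernel \<alpha> (snd p) (fst p)) \<partial>(lborel \<Otimes>\<^sub>M lborel)) =
    (\<integral>\<^sup>+ \<sigma>. \<integral>\<^sup>+ \<theta>. ennreal (indicator {0<..t} \<theta> * indicator {0<..s} \<sigma> * upper_kernel \<alpha> \<sigma> \<theta>) \<partial>lborel \<partial>lborel)"
    by (subst lborel_pair.nn_integral_snd[symmetric]) auto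
  also have "\<dots> = (\<integral>\<^sup>+ \<theta>. \<integral>\<^sup>+ \<sigma>. ennreal (indicator {0<..s} \<theta> * indicator {0<..t} \<sigma> * upper_kernel \<alpha> \<theta> \<sigma>) \<partial>lborel \<partial>lborel)"
    by (simp add: mult_ac)
  also have "\<dots> = ennreal (upper_integral \<alpha> s t)"
    unfolding nn_integral_upper_kernel[OF \<alpha> s t, symmetric] by (subst lborel.nn_integral_fst[symmetric]) auto
  finally show ?B
    using upper_integral_nonneg[OF \<alpha> s t] nn by (intro has_bochner_integral_nn_integral) auto
qed

definition cov_kernel :: "(real \<times> real \<Rightarrow> real) \<Rightarrow> real \<Rightarrow> real \<Rightarrow> real \<Rightarrow> real \<Rightarrow> real" where
  "cov_kernel R x y \<theta> \<sigma> = calR R \<theta> \<sigma> x y * \<bar>\<theta> - \<sigma>\<bar> powr (x + y - 2)"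

text \<open>Both sides vanish on the diagonal, where the two half kernels overlap.\<close>

lemma cov_kernel_eq: "cov_kernel R x y \<theta> \<sigma> = R (x, y) * upper_kernel (x + y) \<theta> \<sigma> + R (y, x) * upper_kernel (x + y) \<sigma> \<theta>"
  by (auto simp: cov_kernel_def calR_def upper_kernel_def)

definition W_cov :: "(real \<times> real \<Rightarrow> real) \<Rightarrow> real \<Rightarrow> real \<Rightarrow> real \<Rightarrow> real \<Rightarrow> real" where
  "W_cov R t s x y = R (x, y) * upper_integral (x + y) t s + R (y, x) * upper_integral (x + y) s t"

definition W_cov_rect :: "(real \<times> real \<Rightarrow> real) \<Rightarrow> real \<Rightarrow> real \<Rightarrow> real \<Rightarrow> real \<Rightarrow> real \<Rightarrow> real \<Rightarrow> real" where
  "W_cov_rect R t t' s s' x y = W_cov R t' s' x y - W_cov R t s' x y - W_cov R t' s x y + W_cov R t s x y"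

text \<open>Links the integral form to the closed form of the covariance. The order of t and s
  decides which truncation in \<open>upper_integral\<close> is active, and \<open>calR\<close>
  selects the matching value of \<open>R\<close>; at t = s the last term is 0.\<close>

lemma W_cov_eq:
  "W_cov R t s x y = (R (y, x) * s powr (x + y) + R (x, y) * t powr (x + y) - calR R t s x y * \<bar>t - s\<bar> powr (x + y))
        / ((x + y) * (x + y - 1))"
  by (cases t s rule: linorder_cases) (simp_all add: W_cov_def upper_integral_def calR_def add_divide_distrib diff_divide_distrib algebra_simps)

text \<open>Inclusion and exclusion over the four corners. \<open>W_cov_rect\<close> is thus the
  covariance of two time increments of W, over (t, t'] at Hurst parameter x and over (s, s'] at
  y.\<close>

lemma has_bochner_integral_cov_kernel_rectangle:
  assumes \<alpha>: "1 < x + y" and t: "0 \<le> t" "t \<le> t'" and s: "0 \<le> s" "s \<le> s'"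
  shows "has_bochner_integral (lborel \<Otimes>\<^sub>M lborel)
      (\<lambda>p. indicator {t<..t'} (fst p) * indicator {s<..s'} (snd p) * cov_kernel R x y (fst p) (snd p))
      (W_cov_rect R t t' s s' x y)"
proof -
  have C: "has_bochner_integral (lborel \<Otimes>\<^sub>M lborel)
      (\<lambda>p. indicator {0<..t} (fst p) * indicator {0<..s} (snd p) * cov_kernel R x y (fst p) (snd p)) (W_cov R t s x y)"
    if "0 \<le> t" "0 \<le> s" for t s
  proof -
    have "has_bochner_integral (lborel \<Otimes>\<^sub>M lborel)
      (\<lambda>p. R (x, y) * (indicator {0<..t} (fst p) * indicator {0<..s} (snd p) * upper_kernel (x + y) (fst p) (snd p)) +
         R (y, x) * (indicator {0<..t} (fst p) * indicator {0<..s} (snd p) * upper_kernel (x + y) (snd p) (fst p))) (W_cov R t s x y)"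
      unfolding W_cov_def
      by (intro has_bochner_integral_add has_bochner_integral_mult_right has_bochner_integral_upper_kernel \<alpha> that)
    then show ?thesis by (simp add: cov_kernel_eq algebra_simps)
  qed
  have "has_bochner_integral (lborel \<Otimes>\<^sub>M lborel)
      (\<lambda>p. indicator {0<..t'} (fst p) * indicator {0<..s'} (snd p) * cov_kernel R x y (fst p) (snd p) -
           indicator {0<..t} (fst p) * indicator {0<..s'} (snd p) * cov_kernel R x y (fst p) (snd p) -
           indicator {0<..t'} (fst p) * indicator {0<..s} (snd p) * cov_kernel R x y (fst p) (snd p) +
           indicator {0<..t} (fst p) * indicator {0<..s} (snd p) * cov_kernel R x y (fst p) (snd p))
      (W_cov R t' s' x y - W_cov R t s' x y - W_cov R t' s x y + W_cov R t s x y)"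
    using t s by (intro has_bochner_integral_add has_bochner_integral_diff C) auto
  then show ?thesis
    unfolding W_cov_rect_def by (rule has_bochner_integral_cong[THEN iffD1, rotated -1]) (use t s in \<open>auto simp: indicator_def\<close>)
qed

text \<open>Measurability is at hand only for the integrand cut off to the half-open interval. The
  value at 0 is arbitrary but sits on one point, so it harms neither measurability nor the
  integral.\<close>

lemma integral_Icc_eq_Ioc:
  fixes f :: "real \<Rightarrow> real"
  assumes m: "(\<lambda>x. indicator {0<..s} x * f x) \<in> borel_measurable lborel" and s: "0 \<le> s"
  shows "(LBINT x:{0..s}. f x) = (LINT x|lborel. indicator {0<..s} x * f x)"
proof -
  have eq: "(\<lambda>x. indicator {0..s} x * f x) = (\<lambda>x. indicator {0<..s} x * f x + indicator {0} x * f 0)"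
    using s by (auto simp: indicator_def fun_eq_iff)
  have "(\<lambda>x. indicator {0..s} x * f x) \<in> borel_measurable lborel"
    unfolding eq using m by measurable
  moreover have "AE x in lborel. indicator {0..s} x * f x = indicator {0<..s} x * f x"
    using AE_lborel_singleton[of 0] by eventually_elim (auto simp: indicator_def)
  ultimately show ?thesis unfolding set_lebesgue_integral_def real_scaleR_def using m by (intro integral_cong_AE) auto
qed

section \<open>Riemann sums for the covariance of the limit process\<close>

text \<open>The left endpoint of the cell of the partition of \<open>(0, t]\<close> into \<open>n\<close> equal cells containing \<open>\<theta>\<close>.\<close>

definition left_node :: "real \<Rightarrow> nat \<Rightarrow> real \<Rightarrow> real" where
  "left_node t n \<theta> = t * (real_of_int \<lceil>real n * \<theta> / t\<rceil> - 1) / real n"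

text \<open>Cells are open on the left and closed on the right, hence the index is \<lceil>n
  \<theta> / t\<rceil> - 1 rather than a floor.\<close>

lemma partition_cell:
  assumes "\<theta> \<in> {0<..t}" "0 < n"
  obtains i where "i < n" "left_node t n \<theta> = real i * t / real n"
    "\<And>j. \<theta> \<in> {real j * t / real n<..real (Suc j) * t / real n} \<longleftrightarrow> j = i"
proof -
  have t: "t > 0" using assms by auto
  have pos: "0 < n * \<theta> / t" "n * \<theta> / t \<le> n" using assms t by (auto simp: field_simps)
  define i where "i = nat (\<lceil>n * \<theta> / t\<rceil> - 1)"
  have c: "1 \<le> \<lceil>n * \<theta> / t\<rceil>" "\<lceil>n * \<theta> / t\<rceil> \<le> n" using pos by linarith+
  then have i: "real i = \<lceil>n * \<theta> / t\<rceil> - 1" "i < n" using assms(2) by (auto simp: i_def)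
  have "\<theta> \<in> {real j * t / real n<..real (Suc j) * t / real n} \<longleftrightarrow> j = i" for j
  proof -
    have "\<theta> \<in> {real j * t / real n<..real (Suc j) * t / real n} \<longleftrightarrow> real j < n * \<theta> / t \<and> n * \<theta> / t \<le> real j + 1"
      using t assms(2) by (auto simp: field_simps)
    also have "\<dots> \<longleftrightarrow> \<lceil>n * \<theta> / t\<rceil> = int j + 1" by (auto simp: ceiling_eq_iff)
    also have "\<dots> \<longleftrightarrow> j = i" using i(1) by auto
    finally show ?thesis .
  qed
  then show thesis using i t by (intro that[of i]) (auto simp: left_node_def mult.commute)
qed

lemma left_node_bounds:
  assumes "\<theta> \<in> {0<..t}" "0 < n"
  shows "0 \<le> left_node t n \<theta>" "\<bar>left_node t n \<theta> - \<theta>\<bar> \<le> t / n"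
proof -
  obtain i where i: "i < n" "left_node t n \<theta> = real i * t / real n"
    "\<theta> \<in> {real i * t / real n<..real (Suc i) * t / real n}"
    using partition_cell[OF assms] by metis
  moreover have "real (Suc i) * t / real n = real i * t / real n + t / n" by (simp add: add_divide_distrib distrib_right)
  moreover have "0 \<le> real i * t / real n" using assms by simp
  ultimately show "0 \<le> left_node t n \<theta>" "\<bar>left_node t n \<theta> - \<theta>\<bar> \<le> t / n" by auto
qed

lemma left_node_tendsto:
  assumes "\<theta> \<in> {0<..t}"
  shows "(\<lambda>n. left_node t n \<theta>) \<longlonglongrightarrow> \<theta>"
proof -
  have "(\<lambda>n. t / real n) \<longlonglongrightarrow> 0" by (rule lim_const_over_n)
  then have "(\<lambda>n. left_node t n \<theta> - \<theta>) \<longlonglongrightarrow> 0"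
    by (rule Lim_null_comparison[rotated])
      (use left_node_bounds(2)[OF assms] in \<open>auto intro!: eventually_sequentiallyI[of 1]\<close>)
  then show ?thesis by (simp add: LIM_zero_iff)
qed

text \<open>The sum is exactly the integral of the kernel \<open>F n\<close> whose Hurst parameters
  are frozen at the left nodes of each cell; continuity of \<open>h\<close> and \<open>R\<close>
  gives its pointwise limit.\<close>

lemma covariance_sum_tendsto:
  assumes a: "1/2 < a" and ab: "a \<le> b" and b: "b < 1"
    and h: "\<And>\<theta>. 0 \<le> \<theta> \<Longrightarrow> h \<theta> \<in> {a..b}" and hc: "continuous_on {0..} h"
    and Rc: "continuous_on ({a..b} \<times> {a..b}) R"
    and t: "0 \<le> t" and s: "0 \<le> s"
  shows "(\<lambda>n. \<Sum>i<n. \<Sum>j<n.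
      W_cov_rect R (real i * t / n) (real (Suc i) * t / n) (real j * s / n) (real (Suc j) * s / n) (h (real i * t / n)) (h (real j * s / n)))
    \<longlonglongrightarrow> (LBINT \<theta>:{0..t}. (LBINT \<sigma>:{0..s}. cov_kernel R (h \<theta>) (h \<sigma>) \<theta> \<sigma>))"
proof -
  define f where "f p = indicator {0<..t} (fst p) * indicator {0<..s} (snd p) * cov_kernel R (h (fst p)) (h (snd p)) (fst p) (snd p)" for p
  define F where "F n p = indicator {0<..t} (fst p) * indicator {0<..s} (snd p) *
     cov_kernel R (h (left_node t n (fst p))) (h (left_node s n (snd p))) (fst p) (snd p)" for n p
  define c where "c n = (\<Sum>i<n. \<Sum>j<n.
      W_cov_rect R (real i * t / n) (real (Suc i) * t / n) (real j * s / n) (real (Suc j) * s / n) (h (real i * t / n)) (h (real j * s / n)))" for n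
  have F: "has_bochner_integral (lborel \<Otimes>\<^sub>M lborel) (F n) (c n)" if n: "n > 0" for n
  proof -
    have "has_bochner_integral (lborel \<Otimes>\<^sub>M lborel) (\<lambda>p. \<Sum>i<n. \<Sum>j<n. 
        indicator {real i * t / n<..real (Suc i) * t / n} (fst p) * indicator {real j * s / n<..real (Suc j) * s / n} (snd p) * 
         cov_kernel R (h (real i * t / n)) (h (real j * s / n)) (fst p) (snd p)) (c n)"
      unfolding c_def
    proof (intro has_bochner_integral_sum has_bochner_integral_cov_kernel_rectangle)
      fix i j
      show "1 < h (real i * t / n) + h (real j * s / n)"
        using h[of "real i * t / n"] h[of "real j * s / n"] t s a by auto
      show "real i * t / real n \<le> real (Suc i) * t / real n" "real j * s / real n \<le> real (Suc j) * s / real n"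
        using t s by (auto intro!: divide_right_mono mult_right_mono)
    qed (use t s in auto)
    moreover have "(\<Sum>i<n. \<Sum>j<n. 
        indicator {real i * t / n<..real (Suc i) * t / n} (fst p) * indicator {real j * s / n<..real (Suc j) * s / n} (snd p) * 
         cov_kernel R (h (real i * t / n)) (h (real j * s / n)) (fst p) (snd p)) = F n p" for p
    proof (cases "fst p \<in> {0<..t} \<and> snd p \<in> {0<..s}")
      case True
      obtain i where i: "i < n" "left_node t n (fst p) = real i * t / real n"
        "\<And>j. fst p \<in> {real j * t / real n<..real (Suc j) * t / real n} \<longleftrightarrow> j = i"
        using partition_cell[of "fst p" t n] True n by metis
      obtain j where j: "j < n" "left_node s n (snd p) = real j * s / real n"
        "\<And>i. snd p \<in> {real i * s / real n<..real (Suc i) * s / real n} \<longleftrightarrow> i = j"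
        using partition_cell[of "snd p" s n] True n by metis
      have "(\<Sum>i'<n. \<Sum>j'<n. 
        indicator {real i' * t / n<..real (Suc i') * t / n} (fst p) * indicator {real j' * s / n<..real (Suc j') * s / n} (snd p) * 
         cov_kernel R (h (real i' * t / n)) (h (real j' * s / n)) (fst p) (snd p)) = 
         (\<Sum>i'<n. \<Sum>j'<n. if i' = i then if j' = j then cov_kernel R (h (real i * t / n)) (h (real j * s / n)) (fst p) (snd p) else 0 else 0)"
        by (intro sum.cong refl) (simp add: indicator_def i(3) j(3) del: greaterThanAtMost_iff of_nat_Suc)
      also have "\<dots> = cov_kernel R (h (real i * t / n)) (h (real j * s / n)) (fst p) (snd p)"
      proof -
        have "(\<Sum>j'<n. if i' = i then if j' = j then v else 0 else 0) = (if i' = i then v else 0)" for i' and v :: real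
          using j by simp
        then show ?thesis using i by simp
      qed
      finally show ?thesis using True i j by (simp add: F_def)
    next
      case False
      have *: "x \<in> {0<..t}" if "x \<in> {real j * t / real n<..real (Suc j) * t / real n}" "j < n" "0 \<le> t" for x j t
      proof -
        have "0 \<le> real j * t / real n" using that by simp
        moreover have "real (Suc j) * t / real n \<le> t"
          using that n mult_right_mono[of "real (Suc j)" "real n" t] by (simp add: field_simps)
        ultimately show ?thesis using that(1) by auto
      qed
      then have "(\<Sum>i<n. \<Sum>j<n. 
        indicator {real i * t / n<..real (Suc i) * t / n} (fst p) * indicator {real j * s / n<..real (Suc j) * s / n} (snd p) * 
         cov_kernel R (h (real i * t / n)) (h (real j * s / n)) (fst p) (snd p)) = 0"
        using False t s by (intro sum.neutral ballI) (auto simp: indicator_def simp del: greaterThanAtMost_iff of_nat_Suc)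
      then show ?thesis using False by (auto simp: F_def)
    qed
    ultimately show ?thesis by simp
  qed
  have "compact ({a..b} \<times> {a..b})" by (intro compact_Times) auto
  then have "bounded (R ` ({a..b} \<times> {a..b}))"
    by (intro compact_imp_bounded compact_continuous_image Rc)
  then obtain B where B: "\<And>x y. x \<in> {a..b} \<Longrightarrow> y \<in> {a..b} \<Longrightarrow> \<bar>R (x, y)\<bar> \<le> B" 
    by (auto simp: bounded_iff simp del: atLeastAtMost_iff)
  have B0: "0 \<le> B" using B[of a a] ab by auto
  \<comment> \<open>The exponent x + y - 2 varies in [2a - 2, 2b - 2]. The power with exponent 2a -
    2 dominates at distances up to 1, the one with 2b - 2 beyond; both are integrable because 2a >
    1.\<close>
  define w where "w p = B * (indicator {0<..t} (fst p) * indicator {0<..s} (snd p) * upper_kernel (2 * a) (fst p) (snd p) +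
     indicator {0<..t} (fst p) * indicator {0<..s} (snd p) * upper_kernel (2 * b) (fst p) (snd p) + 
    (indicator {0<..t} (fst p) * indicator {0<..s} (snd p) * upper_kernel (2 * a) (snd p) (fst p) +
     indicator {0<..t} (fst p) * indicator {0<..s} (snd p) * upper_kernel (2 * b) (snd p) (fst p)))" for p
  have w: "integrable (lborel \<Otimes>\<^sub>M lborel) w"
    unfolding w_def using a ab t s
    by (intro integrable_mult_right Bochner_Integration.integrable_add has_bochner_integral_upper_kernel[THEN integrable.intros]) auto
  have upper_kernel_bd: "0 \<le> upper_kernel \<alpha> \<theta> \<sigma> \<and> upper_kernel \<alpha> \<theta> \<sigma> \<le> upper_kernel (2 * a) \<theta> \<sigma> + upper_kernel (2 * b) \<theta> \<sigma>" if "\<alpha> \<in> {2 * a..2 * b}" for \<alpha> \<theta> \<sigma>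
  proof (cases "\<theta> - \<sigma> \<le> 1")
    case True
    then show ?thesis using that powr_mono'[of "2 * a - 2" "\<alpha> - 2" "\<theta> - \<sigma>"] 
      by (auto simp: upper_kernel_def intro: add_increasing2)
  next
    case False
    then show ?thesis using that powr_mono[of "\<alpha> - 2" "2 * b - 2" "\<theta> - \<sigma>"] 
      by (auto simp: upper_kernel_def intro: add_increasing)
  qed
  have K_bd: "\<bar>cov_kernel R x y \<theta> \<sigma>\<bar> \<le> B * (upper_kernel (2 * a) \<theta> \<sigma> + upper_kernel (2 * b) \<theta> \<sigma> + (upper_kernel (2 * a) \<sigma> \<theta> + upper_kernel (2 * b) \<sigma> \<theta>))"
    if "x \<in> {a..b}" "y \<in> {a..b}" for x y \<theta> \<sigma>
  proof -
    have al: "x + y \<in> {2 * a..2 * b}" using that by auto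
    have "\<bar>cov_kernel R x y \<theta> \<sigma>\<bar> \<le> \<bar>R (x, y)\<bar> * upper_kernel (x + y) \<theta> \<sigma> + \<bar>R (y, x)\<bar> * upper_kernel (x + y) \<sigma> \<theta>"
      unfolding cov_kernel_eq using upper_kernel_bd[OF al] by (intro order_trans[OF abs_triangle_ineq]) (simp add: abs_mult)
    also have "\<dots> \<le> B * (upper_kernel (2 * a) \<theta> \<sigma> + upper_kernel (2 * b) \<theta> \<sigma>) + B * (upper_kernel (2 * a) \<sigma> \<theta> + upper_kernel (2 * b) \<sigma> \<theta>)"
      using upper_kernel_bd[OF al] B that B0 by (intro add_mono mult_mono) auto
    finally show ?thesis by (simp add: distrib_left)
  qed
  have gt: "left_node t n \<theta> \<in> {0..}" if "\<theta> \<in> {0<..t}" "n > 0" for n \<theta> t using left_node_bounds[OF that] by auto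
  have lim: "(\<lambda>n. F n p) \<longlonglongrightarrow> f p" for p
  proof (cases "fst p \<in> {0<..t} \<and> snd p \<in> {0<..s}")
    case True
    have hl: "(\<lambda>n. h (left_node t n \<theta>)) \<longlonglongrightarrow> h \<theta>" if "\<theta> \<in> {0<..t}" for t \<theta>
      using hc that
      by (intro continuous_on_tendsto_compose[OF hc left_node_tendsto[OF that]])
        (auto intro!: eventually_sequentiallyI[of 1] simp: left_node_bounds)
    have 1: "(\<lambda>n. h (left_node t n (fst p))) \<longlonglongrightarrow> h (fst p)" "(\<lambda>n. h (left_node s n (snd p))) \<longlonglongrightarrow> h (snd p)"
      using True hl by auto
    have 2: "\<forall>\<^sub>F n in sequentially. (h (left_node t n (fst p)), h (left_node s n (snd p))) \<in> {a..b} \<times> {a..b}"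
      "\<forall>\<^sub>F n in sequentially. (h (left_node s n (snd p)), h (left_node t n (fst p))) \<in> {a..b} \<times> {a..b}"
      using True h gt[of "fst p" t] gt[of "snd p" s] by (auto intro!: eventually_sequentiallyI[of 1] simp del: atLeastAtMost_iff)
    have 3: "(h (fst p), h (snd p)) \<in> {a..b} \<times> {a..b}" "(h (snd p), h (fst p)) \<in> {a..b} \<times> {a..b}"
      using True h by (auto simp del: atLeastAtMost_iff)
    have Rl: "(\<lambda>n. R (h (left_node t n (fst p)), h (left_node s n (snd p)))) \<longlonglongrightarrow> R (h (fst p), h (snd p))"
      "(\<lambda>n. R (h (left_node s n (snd p)), h (left_node t n (fst p)))) \<longlonglongrightarrow> R (h (snd p), h (fst p))"
      by (rule continuous_on_tendsto_compose[OF Rc tendsto_Pair[OF 1] 3(1) 2(1)])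
        (rule continuous_on_tendsto_compose[OF Rc tendsto_Pair[OF 1(2,1)] 3(2) 2(2)])
    have "(\<lambda>n. cov_kernel R (h (left_node t n (fst p))) (h (left_node s n (snd p))) (fst p) (snd p)) \<longlonglongrightarrow> cov_kernel R (h (fst p)) (h (snd p)) (fst p) (snd p)"
    \<comment> \<open>On the diagonal the kernel is constantly 0; off it the base of the power is
      positive and the power is continuous in its exponent.\<close>
    proof (cases "fst p = snd p")
      case False
      then show ?thesis unfolding cov_kernel_def calR_def
        by (intro tendsto_intros 1 Rl) auto
    qed (simp add: cov_kernel_def)
    then show ?thesis using True by (simp add: F_def f_def)
  qed (auto simp: F_def f_def)
  \<comment> \<open>Index 0 is skipped, since a partition into cells requires n > 0.\<close>
  have lim': "(\<lambda>n. F (Suc n) p) \<longlonglongrightarrow> f p" for p using lim by (rule LIMSEQ_Suc)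
  have Fm: "F (Suc n) \<in> borel_measurable (lborel \<Otimes>\<^sub>M lborel)" for n
    using F[of "Suc n"] by (auto dest: borel_measurable_has_bochner_integral)
  \<comment> \<open>\<open>h\<close> and \<open>R\<close> are arbitrary off the half-line and off
    the square, so measurability of \<open>f\<close> is obtained from its being a pointwise limit of
    the integrable functions \<open>F\<close>.\<close>
  have fm[measurable]: "f \<in> borel_measurable (lborel \<Otimes>\<^sub>M lborel)"
    by (rule borel_measurable_LIMSEQ_real[where u="\<lambda>n. F (Suc n)"]) (use Fm lim' in auto)
  have Fw: "norm (F (Suc n) p) \<le> w p" for n p
  proof (cases "fst p \<in> {0<..t} \<and> snd p \<in> {0<..s}")
    case True
    then show ?thesis using K_bd[of "h (left_node t (Suc n) (fst p))" "h (left_node s (Suc n) (snd p))" "fst p" "snd p"]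
      h gt[of "fst p" t "Suc n"] gt[of "snd p" s "Suc n"]
      by (simp add: F_def w_def)
  qed (auto simp: F_def w_def)
  have conv: "(\<lambda>n. LINT p|(lborel \<Otimes>\<^sub>M lborel). F (Suc n) p) \<longlonglongrightarrow> (LINT p|(lborel \<Otimes>\<^sub>M lborel). f p)"
    by (rule integral_dominated_convergence[where s="\<lambda>n. F (Suc n)", OF fm Fm w]) (use lim' Fw in auto)
  have fi: "integrable (lborel \<Otimes>\<^sub>M lborel) f"
    by (rule integrable_dominated_convergence[where s="\<lambda>n. F (Suc n)", OF fm Fm w]) (use lim' Fw in auto)
  have inner: "(LBINT \<sigma>:{0..s}. cov_kernel R (h \<theta>) (h \<sigma>) \<theta> \<sigma>) = (LINT \<sigma>|lborel. f (\<theta>, \<sigma>))" if th: "\<theta> \<in> {0<..t}" for \<theta>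
  proof -
    have eq: "f (\<theta>, \<sigma>) = indicator {0<..s} \<sigma> * cov_kernel R (h \<theta>) (h \<sigma>) \<theta> \<sigma>" for \<sigma>
      using th by (simp add: f_def)
    have "(\<lambda>\<sigma>. f (\<theta>, \<sigma>)) \<in> borel_measurable lborel" by measurable
    then show ?thesis unfolding eq by (rule integral_Icc_eq_Ioc) (rule s)
  qed
  have eq: "(\<lambda>\<theta>. indicator {0<..t} \<theta> * (LBINT \<sigma>:{0..s}. cov_kernel R (h \<theta>) (h \<sigma>) \<theta> \<sigma>)) = (\<lambda>\<theta>. LINT \<sigma>|lborel. f (\<theta>, \<sigma>))"
  proof
    fix \<theta>
    show "indicator {0<..t} \<theta> * (LBINT \<sigma>:{0..s}. cov_kernel R (h \<theta>) (h \<sigma>) \<theta> \<sigma>) = (LINT \<sigma>|lborel. f (\<theta>, \<sigma>))"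
      by (cases "\<theta> \<in> {0<..t}") (auto simp: inner f_def simp del: greaterThanAtMost_iff)
  qed
  have "(LBINT \<theta>:{0..t}. (LBINT \<sigma>:{0..s}. cov_kernel R (h \<theta>) (h \<sigma>) \<theta> \<sigma>)) = (LINT \<theta>|lborel. indicator {0<..t} \<theta> * (LBINT \<sigma>:{0..s}. cov_kernel R (h \<theta>) (h \<sigma>) \<theta> \<sigma>))"
    by (rule integral_Icc_eq_Ioc) (unfold eq, measurable, rule t)
  also have "\<dots> = (LINT \<theta>|lborel. LINT \<sigma>|lborel. f (\<theta>, \<sigma>))" unfolding eq ..
  also have "\<dots> = (LINT p|(lborel \<Otimes>\<^sub>M lborel). f p)"
    by (rule lborel_pair.integral_fst'[OF fi])
  finally have "(\<lambda>n. c (Suc n)) \<longlonglongrightarrow> (LBINT \<theta>:{0..t}. (LBINT \<sigma>:{0..s}. cov_kernel R (h \<theta>) (h \<sigma>) \<theta> \<sigma>))"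
    using conv has_bochner_integral_integral_eq[OF F] by simp
  then show ?thesis unfolding c_def by (rule LIMSEQ_imp_Suc)
qed

subsection \<open>Mean squares\<close>

text \<open>Extended real values make bounds, Tonelli and Fatou available without integrability
  conditions.\<close>

definition msq :: "'a measure \<Rightarrow> ('a \<Rightarrow> real) \<Rightarrow> ennreal" where
  "msq M f = (\<integral>\<^sup>+ x. ennreal ((f x)\<^sup>2) \<partial>M)"

lemma msq_add:
  assumes [measurable]: "f \<in> borel_measurable M" "g \<in> borel_measurable M"
  shows "msq M (\<lambda>x. f x + g x) \<le> 2 * msq M f + 2 * msq M g"
proof -
  have "(x + y)\<^sup>2 \<le> 2 * x\<^sup>2 + 2 * y\<^sup>2" for x y :: real
    using zero_le_power2[of "x - y"] by (simp add: power2_sum power2_diff)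
  then have "msq M (\<lambda>x. f x + g x) \<le> (\<integral>\<^sup>+ x. 2 * ennreal ((f x)\<^sup>2) + 2 * ennreal ((g x)\<^sup>2) \<partial>M)"
    unfolding msq_def
    by (intro nn_integral_mono) (simp add: ennreal_plus[symmetric] ennreal_mult''[symmetric] del: ennreal_plus flip: ennreal_numeral)
  also have "\<dots> = 2 * msq M f + 2 * msq M g" unfolding msq_def by (simp add: nn_integral_add nn_integral_cmult)
  finally show ?thesis .
qed

text \<open>Cauchy--Schwarz, with no orthogonality among the summands; the factor n has to be paid
  by the individual bounds.\<close>

lemma msq_sum:
  assumes [measurable]: "\<And>i. i < n \<Longrightarrow> f i \<in> borel_measurable M"
  shows "msq M (\<lambda>x. \<Sum>i<n. f i x) \<le> of_nat n * (\<Sum>i<n. msq M (f i))"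
proof -
  have "(\<Sum>i<n. x i)\<^sup>2 \<le> real n * (\<Sum>i<n. (x i)\<^sup>2)" for x :: "nat \<Rightarrow> real"
    using Cauchy_Schwarz_ineq_sum[of "\<lambda>_. 1" x "{..<n}"] by simp
  then have "msq M (\<lambda>x. \<Sum>i<n. f i x) \<le> (\<integral>\<^sup>+ x. of_nat n * (\<Sum>i<n. ennreal ((f i x)\<^sup>2)) \<partial>M)"
    unfolding msq_def
    by (intro nn_integral_mono) (simp add: ennreal_of_nat_eq_real_of_nat ennreal_mult''[symmetric] sum_nonneg)
  also have "\<dots> = of_nat n * (\<Sum>i<n. msq M (f i))"
  proof -
    have [measurable]: "f i \<in> borel_measurable M" if "i \<in> {..<n}" for i using that assms by auto
    show ?thesis unfolding msq_def by (subst nn_integral_cmult, measurable) (subst nn_integral_sum, auto)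
  qed
  finally show ?thesis .
qed

lemma msq_cmult:
  assumes [measurable]: "f \<in> borel_measurable M"
  shows "msq M (\<lambda>x. c * f x) = ennreal (c\<^sup>2) * msq M f"
  unfolding msq_def by (simp add: power_mult_distrib ennreal_mult nn_integral_cmult)

lemma LBINT_singleton: "(LBINT u:{d}. g u) = (0 :: real)"
proof -
  have "(LBINT u:{d}. g u) = (LINT u|lborel. indicator {d} u * g d)"
    unfolding set_lebesgue_integral_def by (intro Bochner_Integration.integral_cong) (auto simp: indicator_def)
  then show ?thesis by simp
qed

lemma square_integrable_Icc:
  fixes f :: "real \<Rightarrow> real"
  assumes m[measurable]: "f \<in> borel_measurable borel" and cd: "c \<le> d"
    and fin: "(\<integral>\<^sup>+ x. ennreal ((f x)\<^sup>2) * indicator {c..d} x \<partial>lborel) < \<infinity>"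
  shows "set_integrable lborel {c..d} f"
    and "set_integrable lborel {c..d} (\<lambda>x. (f x)\<^sup>2)"
    and "(LBINT x:{c..d}. f x)\<^sup>2 \<le> (d - c) * (LBINT x:{c..d}. (f x)\<^sup>2)"
proof -
  have one: "set_integrable lborel {c..d} (\<lambda>_. 1 :: real)" by (intro borel_integrable_atLeastAtMost') auto
  have vol: "(LBINT x:{c..d}. k) = (d - c) * k" for k :: real
    using cd by (simp add: set_lebesgue_integral_def)
  show sq: "set_integrable lborel {c..d} (\<lambda>x. (f x)\<^sup>2)"
    unfolding set_integrable_def
    using fin by (intro integrableI_bounded) (auto simp: ennreal_mult ennreal_indicator mult.commute)
  show f: "set_integrable lborel {c..d} f"
  proof (rule set_integrable_bound[of _ _ "\<lambda>x. 1 + (f x)\<^sup>2"])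
    show "set_integrable lborel {c..d} (\<lambda>x. 1 + (f x)\<^sup>2)" using one sq by (rule set_integral_add)
    show "set_borel_measurable lborel {c..d} f" by (auto simp: set_borel_measurable_def)
    have "\<bar>y\<bar> \<le> 1 + y\<^sup>2" for y :: real
      using zero_le_power2[of "\<bar>y\<bar> - 1"] by (simp add: power2_diff)
    then show "AE x in lborel. x \<in> {c..d} \<longrightarrow> norm (f x) \<le> norm (1 + (f x)\<^sup>2)" by simp
  qed
  show "(LBINT x:{c..d}. f x)\<^sup>2 \<le> (d - c) * (LBINT x:{c..d}. (f x)\<^sup>2)"
  proof (cases "c = d")
    case True
    then show ?thesis by (simp add: LBINT_singleton)
  next
    case False
    then have pos: "d - c > 0" using cd by simp
    define I where "I = (LBINT x:{c..d}. f x)"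
    \<comment> \<open>The mean value of \<open>f\<close>: nonnegativity of the variance around it is
      the Cauchy--Schwarz inequality.\<close>
    define m where "m = I / (d - c)"
    have "0 \<le> (LBINT x:{c..d}. (f x - m)\<^sup>2)"
      unfolding set_lebesgue_integral_def by (intro Bochner_Integration.integral_nonneg) auto
    also have "(LBINT x:{c..d}. (f x - m)\<^sup>2) = (LBINT x:{c..d}. (f x)\<^sup>2 - 2 * m * f x + m\<^sup>2)"
      by (simp add: power2_diff algebra_simps)
    also have "\<dots> = (LBINT x:{c..d}. (f x)\<^sup>2) - 2 * m * I + (d - c) * m\<^sup>2"
      using f sq one unfolding I_def vol[symmetric]
      by (subst set_integral_add(2)) (auto intro!: set_integral_diff(1) set_integrable_mult_right borel_integrable_atLeastAtMost')
    also have "\<dots> = (LBINT x:{c..d}. (f x)\<^sup>2) - I\<^sup>2 / (d - c)"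
    proof -
      have "D * (I / D)\<^sup>2 - 2 * (I / D) * I = - (I\<^sup>2 / D)" if "D > 0" for D
        using that by (simp add: power2_eq_square)
      from this[OF pos] show ?thesis by (simp add: m_def)
    qed
    finally show ?thesis using pos unfolding I_def[symmetric] by (simp add: field_simps)
  qed
qed

text \<open>Cauchy--Schwarz in u for each x, then Tonelli. Where a section is not square integrable
  the pointwise bound is infinite, whatever value the Bochner integral takes. The case c = d is
  separate because \<open>0 * \<infinity> = 0\<close> in the extended reals.\<close>

lemma msq_integral_le:
  fixes f :: "real \<Rightarrow> 'a \<Rightarrow> real"
  assumes "sigma_finite_measure M"
    and m[measurable]: "case_prod f \<in> borel_measurable (borel \<Otimes>\<^sub>M M)" and cd: "c \<le> d"
  shows "msq M (\<lambda>x. LBINT u:{c..d}. f u x) \<le> ennreal (d - c) * (\<integral>\<^sup>+ u. msq M (f u) * indicator {c..d} u \<partial>lborel)"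
proof (cases "c = d")
  case True
  then show ?thesis by (simp add: msq_def LBINT_singleton)
next
  case False
  interpret M: sigma_finite_measure M by fact
  interpret pair_sigma_finite lborel M ..
  have "msq M (\<lambda>x. LBINT u:{c..d}. f u x) \<le> (\<integral>\<^sup>+ x. ennreal (d - c) * (\<integral>\<^sup>+ u. ennreal ((f u x)\<^sup>2) * indicator {c..d} u \<partial>lborel) \<partial>M)"
    unfolding msq_def
  proof (rule nn_integral_mono)
    fix x assume x: "x \<in> space M"
    have mx[measurable]: "(\<lambda>u. f u x) \<in> borel_measurable borel" using x by measurable
    show "ennreal ((LBINT u:{c..d}. f u x)\<^sup>2) \<le> ennreal (d - c) * (\<integral>\<^sup>+ u. ennreal ((f u x)\<^sup>2) * indicator {c..d} u \<partial>lborel)"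
    proof (cases "(\<integral>\<^sup>+ u. ennreal ((f u x)\<^sup>2) * indicator {c..d} u \<partial>lborel) < \<infinity>")
      case True
      note * = square_integrable_Icc[OF mx cd True]
      have "(\<integral>\<^sup>+ u. ennreal ((f u x)\<^sup>2) * indicator {c..d} u \<partial>lborel) = (\<integral>\<^sup>+ u. ennreal (indicator {c..d} u * (f u x)\<^sup>2) \<partial>lborel)"
        by (intro nn_integral_cong) (auto simp: indicator_def)
      also have "\<dots> = ennreal (LBINT u:{c..d}. (f u x)\<^sup>2)"
        using *(2) unfolding set_lebesgue_integral_def set_integrable_def real_scaleR_def
        by (intro nn_integral_eq_integral) auto
      finally have "ennreal (d - c) * (\<integral>\<^sup>+ u. ennreal ((f u x)\<^sup>2) * indicator {c..d} u \<partial>lborel) = ennreal ((d - c) * (LBINT u:{c..d}. (f u x)\<^sup>2))"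
        using cd by (simp add: ennreal_mult')
      then show ?thesis using *(3) by (simp add: ennreal_leI)
    next
      case False
      then have "(\<integral>\<^sup>+ u. ennreal ((f u x)\<^sup>2) * indicator {c..d} u \<partial>lborel) = \<infinity>" by (simp add: not_less top_unique)
      then show ?thesis using cd \<open>c \<noteq> d\<close> by (simp add: ennreal_mult_top)
    qed
  qed
  also have "\<dots> = ennreal (d - c) * (\<integral>\<^sup>+ x. \<integral>\<^sup>+ u. ennreal ((f u x)\<^sup>2) * indicator {c..d} u \<partial>lborel \<partial>M)"
    by (rule nn_integral_cmult) measurable
  also have "(\<integral>\<^sup>+ x. \<integral>\<^sup>+ u. ennreal ((f u x)\<^sup>2) * indicator {c..d} u \<partial>lborel \<partial>M) = (\<integral>\<^sup>+ u. \<integral>\<^sup>+ x. ennreal ((f u x)\<^sup>2) * indicator {c..d} u \<partial>M \<partial>lborel)"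
    by (rule Fubini') measurable
  also have "\<dots> = (\<integral>\<^sup>+ u. msq M (f u) * indicator {c..d} u \<partial>lborel)"
    unfolding msq_def by (intro nn_integral_cong nn_integral_multc) measurable
  finally show ?thesis .
qed

text \<open>From (\<bar>y\<bar> - s)^2 \<ge> 0. The free parameter s replaces the square root of the
  Cauchy--Schwarz form and keeps the bound linear in \<open>msq\<close>.\<close>

lemma (in prob_space) nn_integral_abs_le_msq:
  assumes [measurable]: "f \<in> borel_measurable M" and s: "0 < s"
  shows "(\<integral>\<^sup>+ x. ennreal \<bar>f x\<bar> \<partial>M) \<le> ennreal s + ennreal (1 / s) * msq M f"
proof -
  have "\<bar>y\<bar> \<le> s + (1 / s) * y\<^sup>2" for y :: real
  proof -
    have "0 \<le> (\<bar>y\<bar> - s)\<^sup>2 / s" using s by simp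
    also have "\<dots> = (1 / s) * y\<^sup>2 - 2 * \<bar>y\<bar> + s" using s by (simp add: power2_diff field_simps power2_eq_square)
    finally show ?thesis using abs_ge_zero[of y] by linarith
  qed
  then have "(\<integral>\<^sup>+ x. ennreal \<bar>f x\<bar> \<partial>M) \<le> (\<integral>\<^sup>+ x. ennreal s + ennreal (1 / s) * ennreal ((f x)\<^sup>2) \<partial>M)"
    using s by (intro nn_integral_mono) (simp add: ennreal_plus[symmetric] ennreal_mult''[symmetric] del: ennreal_plus)
  also have "\<dots> = ennreal s + ennreal (1 / s) * msq M f"
    unfolding msq_def by (simp add: nn_integral_add nn_integral_cmult emeasure_space_1)
  finally show ?thesis .
qed

text \<open>With parameter \<open>s ^ n\<close>, \<open>nn_integral_abs_le_msq\<close> bounds the L1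
  norm of the n-th increment by \<open>(1 + C) * s ^ n\<close>. This is summable, so the series of
  increments converges absolutely almost everywhere.\<close>

lemma (in prob_space) AE_convergent_of_msq:
  fixes f :: "nat \<Rightarrow> 'a \<Rightarrow> real"
  assumes [measurable]: "\<And>n. f n \<in> borel_measurable M"
    and s: "0 < s" "s < 1" and C: "0 \<le> C"
    and bd: "\<And>n. msq M (\<lambda>x. f (Suc n) x - f n x) \<le> ennreal (C * (s ^ n)\<^sup>2)"
  shows "AE x in M. convergent (\<lambda>n. f n x)"
proof -
  have 1: "(\<integral>\<^sup>+ x. ennreal \<bar>f (Suc n) x - f n x\<bar> \<partial>M) \<le> ennreal ((1 + C) * s ^ n)" for n
  proof -
    have sn: "0 < s ^ n" using s by simp
    have "(\<integral>\<^sup>+ x. ennreal \<bar>f (Suc n) x - f n x\<bar> \<partial>M) \<le> ennreal (s ^ n) + ennreal (1 / s ^ n) * ennreal (C * (s ^ n)\<^sup>2)"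
      by (rule order_trans[OF nn_integral_abs_le_msq[OF _ sn]]) (auto intro!: add_left_mono mult_left_mono bd)
    also have "\<dots> = ennreal (s ^ n + (1 / s ^ n) * (C * (s ^ n)\<^sup>2))"
      using sn C by (simp add: ennreal_plus[symmetric] ennreal_mult[symmetric] del: ennreal_plus)
    also have "s ^ n + (1 / s ^ n) * (C * (s ^ n)\<^sup>2) = (1 + C) * s ^ n" using sn by (simp add: power2_eq_square field_simps)
    finally show ?thesis .
  qed
  have "(\<integral>\<^sup>+ x. (\<Sum>n. ennreal \<bar>f (Suc n) x - f n x\<bar>) \<partial>M) = (\<Sum>n. \<integral>\<^sup>+ x. ennreal \<bar>f (Suc n) x - f n x\<bar> \<partial>M)"
    by (rule nn_integral_suminf) measurable
  also have "\<dots> \<le> (\<Sum>n. ennreal ((1 + C) * s ^ n))" by (intro suminf_le 1) auto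
  also have "\<dots> = ennreal (\<Sum>n. (1 + C) * s ^ n)"
    using s C by (intro suminf_ennreal2 summable_mult summable_geometric) auto
  also have "\<dots> < \<infinity>" by simp
  finally have "AE x in M. (\<Sum>n. ennreal \<bar>f (Suc n) x - f n x\<bar>) \<noteq> \<infinity>"
    by (intro nn_integral_noteq_infinite) auto
  then show ?thesis
  proof eventually_elim
    case (elim x)
    then have "summable (\<lambda>n. \<bar>f (Suc n) x - f n x\<bar>)" by (intro summable_suminf_not_top) auto
    then have "summable (\<lambda>n. f (Suc n) x - f n x)" by (rule summable_rabs_cancel)
    then obtain l where "(\<lambda>n. \<Sum>i<n. f (Suc i) x - f i x) \<longlonglongrightarrow> l" by (auto simp: summable_def sums_def)
    then have "(\<lambda>n. f n x - f 0 x) \<longlonglongrightarrow> l" using sum_lessThan_telescope[of "\<lambda>n. f n x"] by simp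
    from tendsto_add[OF this tendsto_const[of "f 0 x"]] show ?case by (auto simp: convergent_def)
  qed
qed

text \<open>Fatou's lemma: mean square bounds survive almost sure limits, with no L2 convergence to
  be shown first.\<close>

lemma msq_diff_le_lim:
  fixes f g :: "nat \<Rightarrow> 'a \<Rightarrow> real"
  assumes [measurable]: "\<And>n. f n \<in> borel_measurable M" "\<And>n. g n \<in> borel_measurable M"
    and F: "AE x in M. (\<lambda>n. f n x) \<longlonglongrightarrow> F x" and G: "AE x in M. (\<lambda>n. g n x) \<longlonglongrightarrow> G x"
    and bd: "\<And>n. msq M (\<lambda>x. f n x - g n x) \<le> ennreal (e n)" and e: "e \<longlonglongrightarrow> e0"
  shows "msq M (\<lambda>x. F x - G x) \<le> ennreal e0"
proof -
  have "AE x in M. ennreal ((F x - G x)\<^sup>2) = liminf (\<lambda>n. ennreal ((f n x - g n x)\<^sup>2))"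
    using F G
  proof eventually_elim
    case (elim x)
    have "(\<lambda>n. ennreal ((f n x - g n x)\<^sup>2)) \<longlonglongrightarrow> ennreal ((F x - G x)\<^sup>2)"
      by (intro tendsto_ennrealI tendsto_intros elim)
    then show ?case by (metis lim_imp_Liminf trivial_limit_sequentially)
  qed
  then have "msq M (\<lambda>x. F x - G x) = (\<integral>\<^sup>+ x. liminf (\<lambda>n. ennreal ((f n x - g n x)\<^sup>2)) \<partial>M)"
    unfolding msq_def by (rule nn_integral_cong_AE)
  also have "\<dots> \<le> liminf (\<lambda>n. msq M (\<lambda>x. f n x - g n x))"
    unfolding msq_def by (intro nn_integral_liminf) measurable
  also have "\<dots> \<le> liminf (\<lambda>n. ennreal (e n))" by (intro Liminf_mono always_eventually allI bd)
  also have "\<dots> = ennreal e0" by (intro lim_imp_Liminf tendsto_ennrealI e) simp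
  finally show ?thesis .
qed

text \<open>Cauchy--Schwarz gives a remainder of order \<open>\<bar>H - x0\<bar> powr (5/4)\<close>.\<close>

lemma has_vector_derivative_integral_of_weight:
  fixes f :: "real \<Rightarrow> real"
  assumes m[measurable]: "f \<in> borel_measurable borel" and x0: "x0 \<in> {a..b}"
    and f2: "(\<integral>\<^sup>+ x. ennreal ((f x)\<^sup>2) * indicator {a..b} x \<partial>lborel) < \<infinity>"
    and w: "(\<integral>\<^sup>+ x. ennreal ((f x - f x0)\<^sup>2 * \<bar>x - x0\<bar> powr (-3/2)) * indicator {a..b} x \<partial>lborel) < \<infinity>"
  shows "((\<lambda>H. LBINT x:{a..H}. f x) has_vector_derivative f x0) (at x0 within {a..b})"
proof -
  have fi: "set_integrable lborel {a..b} f" using square_integrable_Icc[OF m _ f2] x0 by auto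
  define A where "A = enn2real (\<integral>\<^sup>+ x. ennreal ((f x - f x0)\<^sup>2 * \<bar>x - x0\<bar> powr (-3/2)) * indicator {a..b} x \<partial>lborel)"
  have A: "(\<integral>\<^sup>+ x. ennreal ((f x - f x0)\<^sup>2 * \<bar>x - x0\<bar> powr (-3/2)) * indicator {a..b} x \<partial>lborel) = ennreal A"
    using w by (simp add: A_def)
  have A0: "0 \<le> A" by (simp add: A_def)
  have fsub: "set_integrable lborel {c..d} f" if "{c..d} \<subseteq> {a..b}" for c d
    using that by (intro set_integrable_subset[OF fi]) auto
  have local: "(LBINT x:{c..d}. f x - f x0)\<^sup>2 \<le> (d - c) * ((d - c) powr (3/2) * A)"
    if cd: "a \<le> c" "c \<le> d" "d \<le> b" "x0 \<in> {c..d}" for c d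
  proof -
    have "(\<integral>\<^sup>+ x. ennreal ((f x - f x0)\<^sup>2) * indicator {c..d} x \<partial>lborel) \<le>
      (\<integral>\<^sup>+ x. ennreal ((d - c) powr (3/2)) * (ennreal ((f x - f x0)\<^sup>2 * \<bar>x - x0\<bar> powr (-3/2)) * indicator {a..b} x) \<partial>lborel)"
    proof (rule nn_integral_mono)
      fix x
      show "ennreal ((f x - f x0)\<^sup>2) * indicator {c..d} x \<le> 
        ennreal ((d - c) powr (3/2)) * (ennreal ((f x - f x0)\<^sup>2 * \<bar>x - x0\<bar> powr (-3/2)) * indicator {a..b} x)"
      proof (cases "x \<in> {c..d} \<and> x \<noteq> x0")
        case True
        have "1 = \<bar>x - x0\<bar> powr (3/2) * \<bar>x - x0\<bar> powr (-3/2)" using True by (simp flip: powr_add)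
        also have "\<dots> \<le> (d - c) powr (3/2) * \<bar>x - x0\<bar> powr (-3/2)"
          using True cd by (intro mult_right_mono powr_mono2) auto
        finally have "(f x - f x0)\<^sup>2 * 1 \<le> (f x - f x0)\<^sup>2 * ((d - c) powr (3/2) * \<bar>x - x0\<bar> powr (-3/2))"
          by (intro mult_left_mono) auto
        then show ?thesis using True cd by (auto simp: ennreal_mult'[symmetric] mult_ac intro!: ennreal_leI)
      qed (auto simp: indicator_def)
    qed
    also have "\<dots> = ennreal ((d - c) powr (3/2) * A)"
      by (subst nn_integral_cmult, measurable) (simp only: A, simp add: ennreal_mult A0)
    finally have le: "(\<integral>\<^sup>+ x. ennreal ((f x - f x0)\<^sup>2) * indicator {c..d} x \<partial>lborel) \<le> ennreal ((d - c) powr (3/2) * A)" .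
    then have fin: "(\<integral>\<^sup>+ x. ennreal ((f x - f x0)\<^sup>2) * indicator {c..d} x \<partial>lborel) < \<infinity>"
      by (rule le_less_trans) simp
    note * = square_integrable_Icc[OF _ cd(2) fin]
    have "ennreal (LBINT x:{c..d}. (f x - f x0)\<^sup>2) = (\<integral>\<^sup>+ x. ennreal (indicator {c..d} x * (f x - f x0)\<^sup>2) \<partial>lborel)"
      using *(2) unfolding set_lebesgue_integral_def set_integrable_def real_scaleR_def
      by (intro nn_integral_eq_integral[symmetric]) auto
    also have "\<dots> = (\<integral>\<^sup>+ x. ennreal ((f x - f x0)\<^sup>2) * indicator {c..d} x \<partial>lborel)"
      by (intro nn_integral_cong) (auto simp: indicator_def)
    finally have "ennreal (LBINT x:{c..d}. (f x - f x0)\<^sup>2) \<le> ennreal ((d - c) powr (3/2) * A)"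
      using le by simp
    then have "(LBINT x:{c..d}. (f x - f x0)\<^sup>2) \<le> (d - c) powr (3/2) * A"
      by (subst (asm) ennreal_le_iff) (use A0 in auto)
    then have "(d - c) * (LBINT x:{c..d}. (f x - f x0)\<^sup>2) \<le> (d - c) * ((d - c) powr (3/2) * A)"
      using cd by (intro mult_left_mono) auto
    then show ?thesis using *(3) by simp
  qed
  define F where "F H = (LBINT x:{a..H}. f x)" for H
  have comb: "F d - F c - (d - c) * f x0 = (LBINT x:{c..d}. f x - f x0)" if "a \<le> c" "c \<le> d" "d \<le> b" for c d
  proof -
    have "F d = integral {a..d} f" "F c = integral {a..c} f"
      unfolding F_def using that by (auto intro!: set_borel_integral_eq_integral fsub)
    moreover have "integral {a..c} f + integral {c..d} f = integral {a..d} f"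
      using that set_borel_integral_eq_integral(1)[OF fsub[of a d]] by (intro Henstock_Kurzweil_Integration.integral_combine) auto
    moreover have "integral {c..d} f = (LBINT x:{c..d}. f x)"
      using that by (intro set_borel_integral_eq_integral(2)[symmetric] fsub) auto
    moreover have "(LBINT x:{c..d}. f x - f x0) = (LBINT x:{c..d}. f x) - (LBINT x:{c..d}. f x0)"
      using that by (intro set_integral_diff fsub borel_integrable_atLeastAtMost') auto
    moreover have "(LBINT x:{c..d}. f x0) = (d - c) * f x0" using that by (simp add: set_lebesgue_integral_def)
    ultimately show ?thesis by linarith
  qed
  have rem: "(F H - F x0 - (H - x0) * f x0)\<^sup>2 \<le> A * \<bar>H - x0\<bar> powr (5/2)" if H: "H \<in> {a..b}" for H
  proof -
    have p: "d * d powr (3/2) = d powr (5/2)" if "0 \<le> d" for d :: real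
      using that powr_add[of d 1 "3/2"] by (cases "d = 0") auto
    show ?thesis
    proof (cases "x0 \<le> H")
      case True
      then show ?thesis using local[of x0 H] comb[of x0 H] H x0 p[of "H - x0"] by (simp add: mult_ac)
    next
      case False
      have "F x0 - F H - (x0 - H) * f x0 = - (F H - F x0 - (H - x0) * f x0)" by (simp add: algebra_simps)
      then show ?thesis using False local[of H x0] comb[of H x0] H x0 p[of "x0 - H"]
        by (simp add: mult_ac) (simp add: algebra_simps)
    qed
  qed
  have "((\<lambda>H. (F H - F x0 - (H - x0) * f x0) / (H - x0)) \<longlongrightarrow> 0) (at x0 within {a..b})"
  proof (rule Lim_null_comparison)
    show "\<forall>\<^sub>F H in at x0 within {a..b}. norm ((F H - F x0 - (H - x0) * f x0) / (H - x0)) \<le> sqrt A * \<bar>H - x0\<bar> powr (1/4)"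
      unfolding eventually_at_topological
    proof (intro exI[of _ UNIV] conjI ballI impI)
      fix H assume H: "H \<noteq> x0" "H \<in> {a..b}"
      have "((F H - F x0 - (H - x0) * f x0) / (H - x0))\<^sup>2 \<le> A * \<bar>H - x0\<bar> powr (5/2) / (H - x0)\<^sup>2"
        unfolding power_divide using rem[OF H(2)] by (intro divide_right_mono) auto
      also have "(H - x0)\<^sup>2 = \<bar>H - x0\<bar> powr 2" using H by simp
      also have "A * \<bar>H - x0\<bar> powr (5/2) / \<bar>H - x0\<bar> powr 2 = A * \<bar>H - x0\<bar> powr (1/2)"
        using powr_diff[of "\<bar>H - x0\<bar>" "5/2" 2] by simp
      also have "\<dots> = (sqrt A * \<bar>H - x0\<bar> powr (1/4))\<^sup>2"
      proof -
        have "(\<bar>H - x0\<bar> powr (1/4))\<^sup>2 = \<bar>H - x0\<bar> powr (1/2)"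
          by (simp add: power2_eq_square flip: powr_add)
        then show ?thesis using A0 by (simp add: power_mult_distrib)
      qed
      finally have sq: "((F H - F x0 - (H - x0) * f x0) / (H - x0))\<^sup>2 \<le> (sqrt A * \<bar>H - x0\<bar> powr (1/4))\<^sup>2" .
      have "0 \<le> sqrt A * \<bar>H - x0\<bar> powr (1/4)" using A0 by simp
      with sq show "norm ((F H - F x0 - (H - x0) * f x0) / (H - x0)) \<le> sqrt A * \<bar>H - x0\<bar> powr (1/4)"
        unfolding real_norm_def by (rule abs_le_square_iff[THEN iffD2, THEN order_trans[OF _ eq_refl[OF abs_of_nonneg]]])
    qed auto
    have "((\<lambda>H. \<bar>H - x0\<bar> powr (1/4)) \<longlongrightarrow> \<bar>x0 - x0\<bar> powr (1/4)) (at x0 within {a..b})"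
      by (intro tendsto_powr2 tendsto_intros) auto
    from tendsto_mult_left[OF this, of "sqrt A"]
    show "((\<lambda>H. sqrt A * \<bar>H - x0\<bar> powr (1/4)) \<longlongrightarrow> 0) (at x0 within {a..b})" by simp
  qed
  then have "((\<lambda>H. (F H - F x0) / (H - x0) - f x0) \<longlongrightarrow> 0) (at x0 within {a..b})"
    by (rule Lim_transform_eventually) (auto simp: eventually_at_topological diff_divide_distrib intro!: exI[of _ UNIV])
  then have "((\<lambda>H. (F H - F x0) / (H - x0)) \<longlongrightarrow> f x0) (at x0 within {a..b})"
    by (simp add: LIM_zero_iff)
  then show ?thesis
    unfolding F_def[abs_def, symmetric] has_real_derivative_iff_has_vector_derivative[symmetric] has_field_derivative_iff .
qed

lemma (in prob_space) integral_cos_tendsto: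
  fixes Y :: "nat \<Rightarrow> 'a \<Rightarrow> real"
  assumes [measurable]: "\<And>n. Y n \<in> borel_measurable M" "Z \<in> borel_measurable M"
    and lim: "(\<lambda>n. msq M (\<lambda>x. Y n x - Z x)) \<longlonglongrightarrow> 0"
  shows "(\<lambda>n. expectation (\<lambda>x. cos (Y n x + \<phi>))) \<longlonglongrightarrow> expectation (\<lambda>x. cos (Z x + \<phi>))"
proof (rule LIMSEQ_I)
  fix r :: real assume r: "0 < r"
  have ic: "integrable M (\<lambda>x. cos (f x + \<phi>))" if "f \<in> borel_measurable M" for f
    using that by (intro integrable_const_bound[of _ 1]) auto
  have "0 < ennreal (r\<^sup>2 / 8)" using r by simp
  with lim have "\<forall>\<^sub>F n in sequentially. msq M (\<lambda>x. Y n x - Z x) < ennreal (r\<^sup>2 / 8)"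
    by (auto simp: order_tendsto_iff)
  then obtain n0 where n0: "\<And>n. n \<ge> n0 \<Longrightarrow> msq M (\<lambda>x. Y n x - Z x) < ennreal (r\<^sup>2 / 8)"
    by (auto simp: eventually_sequentially)
  have "norm (expectation (\<lambda>x. cos (Y n x + \<phi>)) - expectation (\<lambda>x. cos (Z x + \<phi>))) < r" if n: "n \<ge> n0" for n
  proof -
    have "ennreal (norm (expectation (\<lambda>x. cos (Y n x + \<phi>) - cos (Z x + \<phi>)))) \<le> (\<integral>\<^sup>+ x. norm (cos (Y n x + \<phi>) - cos (Z x + \<phi>)) \<partial>M)"
      by (rule integral_norm_bound_ennreal) (auto intro!: Bochner_Integration.integrable_diff ic)
    also have "\<dots> \<le> (\<integral>\<^sup>+ x. ennreal \<bar>Y n x - Z x\<bar> \<partial>M)"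
    proof (intro nn_integral_mono ennreal_leI)
      fix x
      have "norm (cos (Y n x + \<phi>) - cos (Z x + \<phi>)) \<le> 1 * norm (Y n x + \<phi> - (Z x + \<phi>))"
        by (rule field_differentiable_bound[where S=UNIV and f'="\<lambda>x. - sin x"]) (auto intro!: derivative_eq_intros)
      then show "norm (cos (Y n x + \<phi>) - cos (Z x + \<phi>)) \<le> \<bar>Y n x - Z x\<bar>" by simp
    qed
    also have "\<dots> \<le> ennreal (r / 2) + ennreal (1 / (r / 2)) * msq M (\<lambda>x. Y n x - Z x)"
      using r by (intro nn_integral_abs_le_msq) auto
    also have "\<dots> \<le> ennreal (r / 2) + ennreal (1 / (r / 2)) * ennreal (r\<^sup>2 / 8)"
      using n0[OF n] by (intro add_left_mono mult_left_mono) auto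
    also have "\<dots> = ennreal (r / 2 + 1 / (r / 2) * (r\<^sup>2 / 8))"
      using r by (simp add: ennreal_plus[symmetric] ennreal_mult[symmetric] del: ennreal_plus)
    also have "r / 2 + 1 / (r / 2) * (r\<^sup>2 / 8) = 3 * r / 4" using r by (simp add: power2_eq_square field_simps)
    finally have "norm (expectation (\<lambda>x. cos (Y n x + \<phi>) - cos (Z x + \<phi>))) \<le> 3 * r / 4"
      using r by (simp add: ennreal_le_iff)
    then show ?thesis using r ic[of "Y n"] ic[of Z] by simp
  qed
  then show "\<exists>no. \<forall>n\<ge>no. norm (expectation (\<lambda>x. cos (Y n x + \<phi>)) - expectation (\<lambda>x. cos (Z x + \<phi>))) < r" by blast
qed

subsection \<open>The derivative with respect to the Hurst parameter\<close>

locale smooth_hurst_field = prob_space Q for Q :: "'c measure" +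
  fixes a b :: real and R :: "real \<times> real \<Rightarrow> real" and W :: "real \<times> real \<Rightarrow> 'c \<Rightarrow> real"
  assumes a: "1/2 < a" and ab: "a \<le> b" and b: "b < 1"
    and R_smooth: "times_cont_diff_on 3 R ({a..b} \<times> {a..b})"
    and W_measurable: "\<And>t x. 0 \<le> t \<Longrightarrow> x \<in> {a..b} \<Longrightarrow> W (t, x) \<in> borel_measurable Q"
    and W_square_integrable: "\<And>t x. 0 \<le> t \<Longrightarrow> x \<in> {a..b} \<Longrightarrow> integrable Q (\<lambda>\<omega>. (W (t, x) \<omega>)\<^sup>2)"
    and W_covariance: "\<And>t s x y. 0 \<le> t \<Longrightarrow> 0 \<le> s \<Longrightarrow> x \<in> {a..b} \<Longrightarrow> y \<in> {a..b} \<Longrightarrow>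
      expectation (\<lambda>\<omega>. W (t, x) \<omega> * W (s, y) \<omega>) = W_cov R t s x y"
begin

lemma W_mult_integrable:
  assumes "0 \<le> t" "0 \<le> s" "x \<in> {a..b}" "y \<in> {a..b}"
  shows "integrable Q (\<lambda>\<omega>. W (t, x) \<omega> * W (s, y) \<omega>)"
proof (rule Bochner_Integration.integrable_bound)
  show "integrable Q (\<lambda>\<omega>. (W (t, x) \<omega>)\<^sup>2 + (W (s, y) \<omega>)\<^sup>2)"
    using assms by (intro Bochner_Integration.integrable_add W_square_integrable)
  show "(\<lambda>\<omega>. W (t, x) \<omega> * W (s, y) \<omega>) \<in> borel_measurable Q"
    using assms by (intro borel_measurable_times W_measurable)
  have "\<bar>u * v\<bar> \<le> u\<^sup>2 + v\<^sup>2" for u v :: real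
  proof -
    have "0 \<le> (\<bar>u\<bar> - \<bar>v\<bar>)\<^sup>2" by simp
    then have "2 * (\<bar>u\<bar> * \<bar>v\<bar>) \<le> u\<^sup>2 + v\<^sup>2" by (simp add: power2_diff)
    moreover have "0 \<le> \<bar>u\<bar> * \<bar>v\<bar>" by simp
    ultimately have "\<bar>u\<bar> * \<bar>v\<bar> \<le> u\<^sup>2 + v\<^sup>2" by linarith
    then show ?thesis by (simp add: abs_mult)
  qed
  then show "AE \<omega> in Q. norm (W (t, x) \<omega> * W (s, y) \<omega>) \<le> norm ((W (t, x) \<omega>)\<^sup>2 + (W (s, y) \<omega>)\<^sup>2)"
    by simp
qed

definition H_incr :: "real \<Rightarrow> real \<Rightarrow> real \<Rightarrow> 'c \<Rightarrow> real" where
  "H_incr t x y \<omega> = W (t, y) \<omega> - W (t, x) \<omega>"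

lemma H_incr_measurable: "0 \<le> t \<Longrightarrow> x \<in> {a..b} \<Longrightarrow> y \<in> {a..b} \<Longrightarrow> H_incr t x y \<in> borel_measurable Q"
  unfolding H_incr_def[abs_def] by (intro borel_measurable_diff W_measurable)

lemma W_cov_eq_cov_part:
  "W_cov R t s x y = cov_part R t x y + cov_part R s y x - (if s \<le> t then cov_part R \<bar>t - s\<bar> x y else cov_part R \<bar>t - s\<bar> y x)"
  by (simp add: W_cov_eq cov_part_def calR_def add.commute[of y x] add_divide_distrib diff_divide_distrib)

lemma expectation_H_incr_mult:
  assumes t: "0 \<le> t" and s: "0 \<le> s"
    and x: "x1 \<in> {a..b}" "x2 \<in> {a..b}" "y1 \<in> {a..b}" "y2 \<in> {a..b}"
  shows "integrable Q (\<lambda>\<omega>. H_incr t x1 x2 \<omega> * H_incr s y1 y2 \<omega>)"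
    and "expectation (\<lambda>\<omega>. H_incr t x1 x2 \<omega> * H_incr s y1 y2 \<omega>) = 
     mixed_diff (cov_part R t) x1 x2 y1 y2 + mixed_diff (cov_part R s) y1 y2 x1 x2 - 
     (if s \<le> t then mixed_diff (cov_part R \<bar>t - s\<bar>) x1 x2 y1 y2 else mixed_diff (cov_part R \<bar>t - s\<bar>) y1 y2 x1 x2)"
proof -
  note I = W_mult_integrable[OF t s]
  have eq: "H_incr t x1 x2 \<omega> * H_incr s y1 y2 \<omega> = W (t, x2) \<omega> * W (s, y2) \<omega> - W (t, x1) \<omega> * W (s, y2) \<omega>
     - W (t, x2) \<omega> * W (s, y1) \<omega> + W (t, x1) \<omega> * W (s, y1) \<omega>" for \<omega>
    by (simp add: H_incr_def algebra_simps)
  show "integrable Q (\<lambda>\<omega>. H_incr t x1 x2 \<omega> * H_incr s y1 y2 \<omega>)"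
    unfolding eq by (intro Bochner_Integration.integrable_add Bochner_Integration.integrable_diff I x)
  have "expectation (\<lambda>\<omega>. H_incr t x1 x2 \<omega> * H_incr s y1 y2 \<omega>) = W_cov R t s x2 y2 - W_cov R t s x1 y2 - W_cov R t s x2 y1 + W_cov R t s x1 y1"
    unfolding eq using x
    by (simp add: Bochner_Integration.integral_add Bochner_Integration.integral_diff I W_covariance[OF t s])
  then show "expectation (\<lambda>\<omega>. H_incr t x1 x2 \<omega> * H_incr s y1 y2 \<omega>) = 
     mixed_diff (cov_part R t) x1 x2 y1 y2 + mixed_diff (cov_part R s) y1 y2 x1 x2 - 
     (if s \<le> t then mixed_diff (cov_part R \<bar>t - s\<bar>) x1 x2 y1 y2 else mixed_diff (cov_part R \<bar>t - s\<bar>) y1 y2 x1 x2)"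
    by (simp add: W_cov_eq_cov_part mixed_diff_def)
qed

definition H_quot :: "real \<Rightarrow> real \<Rightarrow> real \<Rightarrow> 'c \<Rightarrow> real" where
  "H_quot t x y \<omega> = H_incr t x y \<omega> / (y - x)"

lemma H_quot_measurable: "0 \<le> t \<Longrightarrow> x \<in> {a..b} \<Longrightarrow> y \<in> {a..b} \<Longrightarrow> H_quot t x y \<in> borel_measurable Q"
  unfolding H_quot_def[abs_def] by (intro borel_measurable_divide H_incr_measurable borel_measurable_const)

lemma msq_H_quot_diff_le:
  assumes T: "0 \<le> T"
  obtains C where "C \<ge> 0"
    "\<And>t s x1 x2 y1 y2 z d. 0 \<le> t \<Longrightarrow> t \<le> T \<Longrightarrow> 0 \<le> s \<Longrightarrow> s \<le> T \<Longrightarrow> \<bar>t - s\<bar> \<le> d \<Longrightarrow>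
       a \<le> x1 \<Longrightarrow> x1 < x2 \<Longrightarrow> x2 \<le> b \<Longrightarrow> a \<le> y1 \<Longrightarrow> y1 < y2 \<Longrightarrow> y2 \<le> b \<Longrightarrow>
       {x1, x2, y1, y2} \<subseteq> {z - d..z + d} \<Longrightarrow>
       msq Q (\<lambda>\<omega>. H_quot t x1 x2 \<omega> - H_quot s y1 y2 \<omega>) \<le> ennreal (C * d)"
proof -
  obtain R1 R2 R12 B where B: "B \<ge> 0" "C2_lipschitz_on a b R R1 R2 R12 B"
    by (rule times_cont_diff_on_imp_C2_lipschitz_on[OF R_smooth]) (rule that)
  obtain C where C0: "C \<ge> 0" and C: "\<And>\<tau>. 0 \<le> \<tau> \<Longrightarrow> \<tau> \<le> T \<Longrightarrow> \<exists>g. lipschitz_mixed_partial a b (cov_part R \<tau>) C (C * \<tau>) g"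
    by (rule cov_part_mixed_difference[OF B(2,1) a b T]) (rule that)
  define g where "g \<tau> = (SOME g. lipschitz_mixed_partial a b (cov_part R \<tau>) C (C * \<tau>) g)" for \<tau>
  note g' = someI_ex[OF C, folded g_def, unfolded lipschitz_mixed_partial_def]
  have g_mixed: "\<exists>\<xi>\<in>{x1..x2}. \<exists>\<eta>\<in>{y1..y2}. mixed_diff (cov_part R \<tau>) x1 x2 y1 y2 = (x2 - x1) * (y2 - y1) * g \<tau> \<xi> \<eta>"
    if "0 \<le> \<tau>" "\<tau> \<le> T" "a \<le> x1" "x1 < x2" "x2 \<le> b" "a \<le> y1" "y1 < y2" "y2 \<le> b" for \<tau> x1 x2 y1 y2
    using g'[OF that(1,2)] that by auto
  have g_bd: "\<bar>g \<tau> x y\<bar> \<le> C * \<tau>" if "0 \<le> \<tau>" "\<tau> \<le> T" "x \<in> {a..b}" "y \<in> {a..b}" for \<tau> x y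
    using g'[OF that(1,2)] that by blast
  have g_lip: "\<bar>g \<tau> x y - g \<tau> x' y'\<bar> \<le> C * (\<bar>x - x'\<bar> + \<bar>y - y'\<bar>)"
    if "0 \<le> \<tau>" "\<tau> \<le> T" "x \<in> {a..b}" "y \<in> {a..b}" "x' \<in> {a..b}" "y' \<in> {a..b}" for \<tau> x y x' y'
    using g'[OF that(1,2)] that by blast
  have "msq Q (\<lambda>\<omega>. H_quot t x1 x2 \<omega> - H_quot s y1 y2 \<omega>) \<le> ennreal (18 * (C * d))"
    if t: "0 \<le> t" "t \<le> T" and s: "0 \<le> s" "s \<le> T" and ts: "\<bar>t - s\<bar> \<le> d"
      and x: "a \<le> x1" "x1 < x2" "x2 \<le> b" and y: "a \<le> y1" "y1 < y2" "y2 \<le> b"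
      and z: "{x1, x2, y1, y2} \<subseteq> {z - d..z + d}" for t s x1 x2 y1 y2 z d
  proof -
    define p where "p = x2 - x1"
    define q where "q = y2 - y1"
    have pq: "p > 0" "q > 0" using x y by (auto simp: p_def q_def)
    have xy: "x1 \<in> {a..b}" "x2 \<in> {a..b}" "y1 \<in> {a..b}" "y2 \<in> {a..b}" using x y by auto
    have ivl: "u \<in> {a..b}" "u \<in> {z - d..z + d}" if "u \<in> {x1..x2} \<or> u \<in> {y1..y2}" for u
      using that x y z by auto
    have near: "\<bar>g \<tau> u v - g \<tau> u' v'\<bar> \<le> 4 * (C * d)"
      if \<tau>: "0 \<le> \<tau>" "\<tau> \<le> T" and u: "\<And>w. w \<in> {u, v, u', v'} \<Longrightarrow> w \<in> {x1..x2} \<or> w \<in> {y1..y2}" for \<tau> u v u' v'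
    proof -
      have "\<bar>g \<tau> u v - g \<tau> u' v'\<bar> \<le> C * (\<bar>u - u'\<bar> + \<bar>v - v'\<bar>)"
        by (intro g_lip \<tau> ivl(1) u) auto
      also have "\<dots> \<le> C * (4 * d)"
        using ivl(2)[OF u, of u] ivl(2)[OF u, of u'] ivl(2)[OF u, of v] ivl(2)[OF u, of v'] C0
        by (intro mult_left_mono) auto
      finally show ?thesis by simp
    qed
    have tt: "\<bar>t - s\<bar> \<le> T" using t s by auto
    obtain \<xi>1 \<eta>1 where 1: "\<xi>1 \<in> {x1..x2}" "\<eta>1 \<in> {x1..x2}" "mixed_diff (cov_part R t) x1 x2 x1 x2 = p * p * g t \<xi>1 \<eta>1"
      using g_mixed[OF t x x] unfolding p_def by blast
    obtain \<xi>2 \<eta>2 where 2: "\<xi>2 \<in> {x1..x2}" "\<eta>2 \<in> {y1..y2}" "mixed_diff (cov_part R t) x1 x2 y1 y2 = p * q * g t \<xi>2 \<eta>2"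
      using g_mixed[OF t x y] unfolding p_def q_def by blast
    obtain \<xi>3 \<eta>3 where 3: "\<xi>3 \<in> {y1..y2}" "\<eta>3 \<in> {x1..x2}" "mixed_diff (cov_part R s) y1 y2 x1 x2 = q * p * g s \<xi>3 \<eta>3"
      using g_mixed[OF s y x] unfolding p_def q_def by blast
    obtain \<xi>4 \<eta>4 where 4: "\<xi>4 \<in> {y1..y2}" "\<eta>4 \<in> {y1..y2}" "mixed_diff (cov_part R s) y1 y2 y1 y2 = q * q * g s \<xi>4 \<eta>4"
      using g_mixed[OF s y y] unfolding q_def by blast
    obtain e where e: "\<bar>e\<bar> \<le> C * d"
      "(if s \<le> t then mixed_diff (cov_part R \<bar>t - s\<bar>) x1 x2 y1 y2 else mixed_diff (cov_part R \<bar>t - s\<bar>) y1 y2 x1 x2) = p * q * e"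
    proof -
      obtain \<xi> \<eta> where 5: "\<xi> \<in> {x1..x2}" "\<eta> \<in> {y1..y2}" "mixed_diff (cov_part R \<bar>t - s\<bar>) x1 x2 y1 y2 = p * q * g \<bar>t - s\<bar> \<xi> \<eta>"
        using g_mixed[OF abs_ge_zero tt x y] unfolding p_def q_def by blast
      obtain \<xi>' \<eta>' where 6: "\<xi>' \<in> {y1..y2}" "\<eta>' \<in> {x1..x2}" "mixed_diff (cov_part R \<bar>t - s\<bar>) y1 y2 x1 x2 = q * p * g \<bar>t - s\<bar> \<xi>' \<eta>'"
        using g_mixed[OF abs_ge_zero tt y x] unfolding p_def q_def by blast
      have "\<bar>g \<bar>t - s\<bar> u v\<bar> \<le> C * d" if "u \<in> {a..b}" "v \<in> {a..b}" for u v
        using g_bd[OF abs_ge_zero tt that] mult_left_mono[OF ts C0] by linarith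
      then have "\<bar>g \<bar>t - s\<bar> \<xi> \<eta>\<bar> \<le> C * d" "\<bar>g \<bar>t - s\<bar> \<xi>' \<eta>'\<bar> \<le> C * d" using ivl(1) 5 6 by auto
      then show thesis
        using that[of "g \<bar>t - s\<bar> \<xi> \<eta>"] that[of "g \<bar>t - s\<bar> \<xi>' \<eta>'"] 5(3) 6(3) by (cases "s \<le> t") simp_all
    qed
    have zero: "mixed_diff (cov_part R 0) u v u' v' = 0" for u v u' v' by (simp add: mixed_diff_def cov_part_def)
    note E = expectation_H_incr_mult(2)[OF t(1) t(1) xy(1,2,1,2)] expectation_H_incr_mult(2)[OF t(1) s(1) xy] expectation_H_incr_mult(2)[OF s(1) s(1) xy(3,4,3,4)]
    note I = expectation_H_incr_mult(1)[OF t(1) t(1) xy(1,2,1,2)] expectation_H_incr_mult(1)[OF t(1) s(1) xy] expectation_H_incr_mult(1)[OF s(1) s(1) xy(3,4,3,4)]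
    have sq: "(H_quot t x1 x2 \<omega> - H_quot s y1 y2 \<omega>)\<^sup>2 = (1 / (p * p)) * (H_incr t x1 x2 \<omega> * H_incr t x1 x2 \<omega>) -
      (2 / (p * q)) * (H_incr t x1 x2 \<omega> * H_incr s y1 y2 \<omega>) + (1 / (q * q)) * (H_incr s y1 y2 \<omega> * H_incr s y1 y2 \<omega>)" for \<omega>
      using pq by (simp add: H_quot_def p_def[symmetric] q_def[symmetric] power2_eq_square field_simps)
    have int: "integrable Q (\<lambda>\<omega>. (H_quot t x1 x2 \<omega> - H_quot s y1 y2 \<omega>)\<^sup>2)"
      unfolding sq by (intro Bochner_Integration.integrable_add Bochner_Integration.integrable_diff integrable_mult_right I)
    have "expectation (\<lambda>\<omega>. (H_quot t x1 x2 \<omega> - H_quot s y1 y2 \<omega>)\<^sup>2) =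
      (1 / (p * p)) * (2 * (p * p * g t \<xi>1 \<eta>1)) - (2 / (p * q)) * (p * q * g t \<xi>2 \<eta>2 + q * p * g s \<xi>3 \<eta>3 - p * q * e) +
      (1 / (q * q)) * (2 * (q * q * g s \<xi>4 \<eta>4))"
      unfolding sq by (simp add: Bochner_Integration.integral_add Bochner_Integration.integral_diff I E zero 1(3) 2(3) 3(3) 4(3) e(2) del: if_split)
    also have "\<dots> = 2 * (g t \<xi>1 \<eta>1 - g t \<xi>2 \<eta>2) + 2 * (g s \<xi>4 \<eta>4 - g s \<xi>3 \<eta>3) + 2 * e"
      using pq by (simp add: field_simps)
    also have "\<dots> \<le> 18 * (C * d)"
    proof -
      have "\<bar>g t \<xi>1 \<eta>1 - g t \<xi>2 \<eta>2\<bar> \<le> 4 * (C * d)" by (rule near[OF t]) (use 1 2 in auto)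
      moreover have "\<bar>g s \<xi>4 \<eta>4 - g s \<xi>3 \<eta>3\<bar> \<le> 4 * (C * d)" by (rule near[OF s]) (use 3 4 in auto)
      moreover have "2 * A + 2 * B + 2 * E \<le> 18 * D" if "\<bar>A\<bar> \<le> 4 * D" "\<bar>B\<bar> \<le> 4 * D" "\<bar>E\<bar> \<le> D" for A B D E :: real
        using that by (simp add: abs_le_iff)
      ultimately show ?thesis using e(1) by blast
    qed
    finally show ?thesis
      unfolding msq_def using int by (subst nn_integral_eq_integral) (auto intro: ennreal_leI)
  qed
  then show thesis using that[of "18 * C"] C0 by (auto simp: mult.assoc)
qed

lemma msq_H_quot_0: "x \<in> {a..b} \<Longrightarrow> y \<in> {a..b} \<Longrightarrow> msq Q (H_quot 0 x y) = 0"
proof -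
  assume x: "x \<in> {a..b}" and y: "y \<in> {a..b}"
  have "(H_quot 0 x y \<omega>)\<^sup>2 = (1 / (y - x)\<^sup>2) * (H_incr 0 x y \<omega> * H_incr 0 x y \<omega>)" for \<omega>
    by (simp add: H_quot_def power2_eq_square)
  moreover have "mixed_diff (cov_part R 0) u v u' v' = 0" for u v u' v' by (simp add: mixed_diff_def cov_part_def)
  ultimately have "integrable Q (\<lambda>\<omega>. (H_quot 0 x y \<omega>)\<^sup>2)" "expectation (\<lambda>\<omega>. (H_quot 0 x y \<omega>)\<^sup>2) = 0"
    using expectation_H_incr_mult[OF order_refl order_refl x y x y] by simp_all
  then show ?thesis unfolding msq_def by (subst nn_integral_eq_integral) auto
qed

end

context smooth_hurst_field
begin

text \<open>The index is truncated so that \<open>x = b\<close> falls into the last cell.\<close>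

definition dyadic_cell :: "nat \<Rightarrow> nat \<Rightarrow> real" where
  "dyadic_cell k j = a + (b - a) * real (min j (2 ^ k - 1)) / 2 ^ k"

lemma dyadic_cell_bounds: "a \<le> dyadic_cell k j" "dyadic_cell k j + (b - a) / 2 ^ k \<le> b" "dyadic_cell k j \<le> b"
proof -
  have j: "real (min j (2 ^ k - 1)) \<le> 2 ^ k - 1"
  proof -
    have "real (min j (2 ^ k - 1)) \<le> real (2 ^ k - 1)" by (rule of_nat_mono) simp
    then show ?thesis by (simp add: of_nat_diff)
  qed
  show 1: "a \<le> dyadic_cell k j" using ab by (simp add: dyadic_cell_def)
  have "(b - a) * (real (min j (2 ^ k - 1)) + 1) / 2 ^ k \<le> (b - a) * 2 ^ k / 2 ^ k"
    using j ab by (intro divide_right_mono mult_left_mono) auto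
  then show 2: "dyadic_cell k j + (b - a) / 2 ^ k \<le> b" by (simp add: dyadic_cell_def distrib_left add_divide_distrib)
  show "dyadic_cell k j \<le> b" using 2 ab by (smt (verit) divide_nonneg_nonneg zero_le_power)
qed

definition dyadic_quot :: "nat \<Rightarrow> real \<Rightarrow> real \<Rightarrow> 'c \<Rightarrow> real" where
  "dyadic_quot k t x \<omega> = H_quot (real (nat \<lfloor>2 ^ k * t\<rfloor>) / 2 ^ k) (dyadic_cell k (nat \<lfloor>2 ^ k * ((x - a) / (b - a))\<rfloor>))
     (dyadic_cell k (nat \<lfloor>2 ^ k * ((x - a) / (b - a))\<rfloor>) + (b - a) / 2 ^ k) \<omega>"

lemma dyadic_cell_near:
  assumes "a < b" and x: "x \<in> {a..b}"
  shows "\<bar>dyadic_cell k (nat \<lfloor>2 ^ k * ((x - a) / (b - a))\<rfloor>) - x\<bar> \<le> 1 / 2 ^ k"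
    and "\<bar>dyadic_cell k (nat \<lfloor>2 ^ k * ((x - a) / (b - a))\<rfloor>) + (b - a) / 2 ^ k - x\<bar> \<le> 1 / 2 ^ k"
proof -
  define y where "y = 2 ^ k * ((x - a) / (b - a))"
  define j where "j = min (nat \<lfloor>y\<rfloor>) (2 ^ k - 1)"
  have y: "0 \<le> y" "y \<le> 2 ^ k" using assms by (auto simp: y_def divide_simps)
  have j: "real j \<le> y \<and> y \<le> real j + 1"
  proof (cases "nat \<lfloor>y\<rfloor> \<le> 2 ^ k - 1")
    case True
    then show ?thesis using y(1) by (simp add: j_def)
  next
    case False
    then have "real j = 2 ^ k - 1" by (simp add: j_def of_nat_diff)
    moreover have "real (2 ^ k) \<le> real (nat \<lfloor>y\<rfloor>)" using False by (intro of_nat_mono) linarith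
    from order_trans[OF this of_nat_floor[OF y(1)]] have "2 ^ k \<le> y" by simp
    ultimately show ?thesis using y by auto
  qed
  have x': "x = a + (b - a) * y / 2 ^ k" using assms by (simp add: y_def)
  have c: "dyadic_cell k (nat \<lfloor>y\<rfloor>) = a + (b - a) * real j / 2 ^ k" by (simp add: dyadic_cell_def j_def)
  have "dyadic_cell k (nat \<lfloor>y\<rfloor>) - x = (b - a) * (real j - y) / 2 ^ k"
    unfolding c x' by (simp add: algebra_simps add_divide_distrib diff_divide_distrib)
  then have 1: "dyadic_cell k (nat \<lfloor>y\<rfloor>) - x = ((b - a) * (real j - y)) * (1 / 2 ^ k)" by simp
  have r: "\<bar>(b - a) * r\<bar> * (1 / 2 ^ k) \<le> 1 / 2 ^ k" if "\<bar>r\<bar> \<le> 1" for r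
  proof -
    have "\<bar>(b - a) * r\<bar> \<le> 1 * 1" unfolding abs_mult using a b ab that by (intro mult_mono) auto
    then show ?thesis by (simp add: divide_right_mono)
  qed
  show "\<bar>dyadic_cell k (nat \<lfloor>2 ^ k * ((x - a) / (b - a))\<rfloor>) - x\<bar> \<le> 1 / 2 ^ k"
    unfolding y_def[symmetric] 1 abs_mult[of _ "1 / 2 ^ k"] using r[of "real j - y"] j by auto
  have 2: "dyadic_cell k (nat \<lfloor>y\<rfloor>) + (b - a) / 2 ^ k - x = ((b - a) * (real j - y + 1)) * (1 / 2 ^ k)"
  proof -
    have "dyadic_cell k (nat \<lfloor>y\<rfloor>) + (b - a) / 2 ^ k - x = (dyadic_cell k (nat \<lfloor>y\<rfloor>) - x) + (b - a) * (1 / 2 ^ k)" by simp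
    also have "\<dots> = ((b - a) * (real j - y + 1)) * (1 / 2 ^ k)" unfolding 1 by (simp only: distrib_left distrib_right mult_1_right)
    finally show ?thesis .
  qed
  show "\<bar>dyadic_cell k (nat \<lfloor>2 ^ k * ((x - a) / (b - a))\<rfloor>) + (b - a) / 2 ^ k - x\<bar> \<le> 1 / 2 ^ k"
    unfolding y_def[symmetric] 2 abs_mult[of _ "1 / 2 ^ k"] using r[of "real j - y + 1"] j by auto
qed

lemma dyadic_near: "0 \<le> t \<Longrightarrow> \<bar>real (nat \<lfloor>2 ^ k * t\<rfloor>) / 2 ^ k - t\<bar> \<le> 1 / 2 ^ k"
  "0 \<le> t \<Longrightarrow> real (nat \<lfloor>2 ^ k * t\<rfloor>) / 2 ^ k \<le> t"
proof -
  assume t: "0 \<le> t"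
  then have "0 \<le> 2 ^ k * t" by simp
  then have 1: "real (nat \<lfloor>2 ^ k * t\<rfloor>) \<le> 2 ^ k * t" "2 ^ k * t \<le> real (nat \<lfloor>2 ^ k * t\<rfloor>) + 1" by linarith+
  then show "real (nat \<lfloor>2 ^ k * t\<rfloor>) / 2 ^ k \<le> t" by (simp add: divide_le_eq mult.commute)
  have "real (nat \<lfloor>2 ^ k * t\<rfloor>) / 2 ^ k - t = (real (nat \<lfloor>2 ^ k * t\<rfloor>) - 2 ^ k * t) / 2 ^ k" by (simp add: diff_divide_distrib)
  also have "\<bar>\<dots>\<bar> \<le> 1 / 2 ^ k"
  proof -
    have "\<bar>real (nat \<lfloor>2 ^ k * t\<rfloor>) - 2 ^ k * t\<bar> \<le> 1" using 1 by linarith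
    from divide_right_mono[OF this, of "2 ^ k"] show ?thesis unfolding abs_divide by simp
  qed
  finally show "\<bar>real (nat \<lfloor>2 ^ k * t\<rfloor>) / 2 ^ k - t\<bar> \<le> 1 / 2 ^ k" .
qed

lemma dyadic_quot_measurable_joint:
  "(\<lambda>(t, x, \<omega>). dyadic_quot k t x \<omega>) \<in> borel_measurable (borel \<Otimes>\<^sub>M borel \<Otimes>\<^sub>M Q)"
proof -
  have 1: "(\<lambda>p. H_quot (real i / 2 ^ k) (dyadic_cell k j) (dyadic_cell k j + (b - a) / 2 ^ k) (snd (snd p))) \<in> borel_measurable (borel \<Otimes>\<^sub>M borel \<Otimes>\<^sub>M Q)" for i j
  proof -
    have "H_quot (real i / 2 ^ k) (dyadic_cell k j) (dyadic_cell k j + (b - a) / 2 ^ k) \<in> borel_measurable Q"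
      using dyadic_cell_bounds[of k j] ab by (intro H_quot_measurable) (auto intro: add_increasing2)
    then show ?thesis by measurable
  qed
  have 2: "(\<lambda>p. nat \<lfloor>2 ^ k * (fst p :: real)\<rfloor>) \<in> measurable (borel \<Otimes>\<^sub>M borel \<Otimes>\<^sub>M Q) (count_space UNIV)"
    "(\<lambda>p. nat \<lfloor>2 ^ k * ((fst (snd p) - a) / (b - a))\<rfloor>) \<in> measurable (borel \<Otimes>\<^sub>M borel \<Otimes>\<^sub>M Q) (count_space UNIV)"
    by measurable
  show ?thesis
    unfolding dyadic_quot_def split_beta
    by (rule measurable_compose_countable[OF measurable_compose_countable[OF 1 2(2)] 2(1)])
qed

lemma dyadic_quot_measurable: "dyadic_quot k t x \<in> borel_measurable Q"
  using measurable_compose[of "\<lambda>\<omega>. (t, x, \<omega>)", OF _ dyadic_quot_measurable_joint] by auto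

definition dyadic_deriv :: "real \<Rightarrow> real \<Rightarrow> 'c \<Rightarrow> real" where
  "dyadic_deriv t x \<omega> = lim (\<lambda>k. dyadic_quot k t x \<omega>)"

lemma dyadic_deriv_measurable_joint: "(\<lambda>(t, x, \<omega>). dyadic_deriv t x \<omega>) \<in> borel_measurable (borel \<Otimes>\<^sub>M borel \<Otimes>\<^sub>M Q)"
  using dyadic_quot_measurable_joint unfolding dyadic_deriv_def split_beta by (rule borel_measurable_lim_metric)

definition L2_derivative_bounded :: "real \<Rightarrow> real \<Rightarrow> (real \<Rightarrow> real \<Rightarrow> 'c \<Rightarrow> real) \<Rightarrow> bool" where
  "L2_derivative_bounded T C D \<longleftrightarrow>
      (\<forall>t\<in>{0..T}. \<forall>s\<in>{0..T}. \<forall>x\<in>{a..b}. \<forall>y\<in>{a..b}.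
         msq Q (\<lambda>\<omega>. D t x \<omega> - D s y \<omega>) \<le> ennreal (C * (\<bar>t - s\<bar> + \<bar>x - y\<bar>))) \<and>
      (\<forall>t\<in>{0..T}. \<forall>x\<in>{a..b}. \<forall>y\<in>{a..b}.
         msq Q (\<lambda>\<omega>. W (t, y) \<omega> - W (t, x) \<omega> - (y - x) * D t x \<omega>) \<le> ennreal (C * \<bar>y - x\<bar> ^ 3)) \<and>
      (\<forall>t\<in>{0..T}. \<forall>x\<in>{a..b}. msq Q (D t x) \<le> ennreal C)"

definition L2_derivative :: "(real \<Rightarrow> real \<Rightarrow> 'c \<Rightarrow> real) \<Rightarrow> bool" where
  "L2_derivative D \<longleftrightarrow> (\<lambda>(t, x, \<omega>). D t x \<omega>) \<in> borel_measurable (borel \<Otimes>\<^sub>M borel \<Otimes>\<^sub>M Q) \<and>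
    (\<forall>T\<ge>0. \<exists>C\<ge>0. L2_derivative_bounded T C D)"

lemma dyadic_deriv_bounded:
  assumes "a < b" and T: "0 \<le> T"
  shows "\<exists>C\<ge>0. L2_derivative_bounded T C dyadic_deriv"
proof -
  obtain C where C0: "C \<ge> 0" and C: 
    "\<And>t s x1 x2 y1 y2 z d. 0 \<le> t \<Longrightarrow> t \<le> T \<Longrightarrow> 0 \<le> s \<Longrightarrow> s \<le> T \<Longrightarrow> \<bar>t - s\<bar> \<le> d \<Longrightarrow>
       a \<le> x1 \<Longrightarrow> x1 < x2 \<Longrightarrow> x2 \<le> b \<Longrightarrow> a \<le> y1 \<Longrightarrow> y1 < y2 \<Longrightarrow> y2 \<le> b \<Longrightarrow>
       {x1, x2, y1, y2} \<subseteq> {z - d..z + d} \<Longrightarrow>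
       msq Q (\<lambda>\<omega>. H_quot t x1 x2 \<omega> - H_quot s y1 y2 \<omega>) \<le> ennreal (C * d)"
    by (rule msq_H_quot_diff_le[OF T]) (rule that)
  have near: "u \<in> {x - d..x + d}" if "\<bar>u - y\<bar> \<le> e" "\<bar>x - y\<bar> + e \<le> d" for u x y d e :: real
    using that by auto
  have grid: "msq Q (\<lambda>\<omega>. dyadic_quot k t x \<omega> - dyadic_quot l s y \<omega>) \<le> ennreal (C * (\<bar>t - s\<bar> + \<bar>x - y\<bar> + (1 / 2 ^ k + 1 / 2 ^ l)))"
    if t: "t \<in> {0..T}" and s: "s \<in> {0..T}" and x: "x \<in> {a..b}" and y: "y \<in> {a..b}" for k l t s x y
    unfolding dyadic_quot_def
  proof (rule C)
    have t0: "0 \<le> t" "0 \<le> s" using t s by auto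
    show "real (nat \<lfloor>2 ^ k * t\<rfloor>) / 2 ^ k \<le> T" "real (nat \<lfloor>2 ^ l * s\<rfloor>) / 2 ^ l \<le> T"
      using dyadic_near(2)[OF t0(1), of k] dyadic_near(2)[OF t0(2), of l] t s by simp_all
    show "\<bar>real (nat \<lfloor>2 ^ k * t\<rfloor>) / 2 ^ k - real (nat \<lfloor>2 ^ l * s\<rfloor>) / 2 ^ l\<bar> \<le> \<bar>t - s\<bar> + \<bar>x - y\<bar> + (1 / 2 ^ k + 1 / 2 ^ l)"
    proof -
      have tri: "\<bar>u - v\<bar> \<le> \<bar>t - s\<bar> + r + (p + q)" if "\<bar>u - t\<bar> \<le> p" "\<bar>v - s\<bar> \<le> q" "0 \<le> r" for u v p q r :: real
        using that by linarith
      show ?thesis by (rule tri[OF dyadic_near(1)[OF t0(1)] dyadic_near(1)[OF t0(2)] abs_ge_zero])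
    qed
    have "0 < (b - a) / 2 ^ n" for n :: nat using assms by simp
    then show "dyadic_cell k i < dyadic_cell k i + (b - a) / 2 ^ k" "dyadic_cell l i < dyadic_cell l i + (b - a) / 2 ^ l" for i by simp_all
    have e: "\<bar>x - x\<bar> + 1 / 2 ^ k \<le> \<bar>t - s\<bar> + \<bar>x - y\<bar> + (1 / 2 ^ k + 1 / 2 ^ l)"
      "\<bar>x - y\<bar> + 1 / 2 ^ l \<le> \<bar>t - s\<bar> + \<bar>x - y\<bar> + (1 / 2 ^ k + 1 / 2 ^ l)" by simp_all
    show "{dyadic_cell k (nat \<lfloor>2 ^ k * ((x - a) / (b - a))\<rfloor>), dyadic_cell k (nat \<lfloor>2 ^ k * ((x - a) / (b - a))\<rfloor>) + (b - a) / 2 ^ k,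
     dyadic_cell l (nat \<lfloor>2 ^ l * ((y - a) / (b - a))\<rfloor>), dyadic_cell l (nat \<lfloor>2 ^ l * ((y - a) / (b - a))\<rfloor>) + (b - a) / 2 ^ l}
      \<subseteq> {x - (\<bar>t - s\<bar> + \<bar>x - y\<bar> + (1 / 2 ^ k + 1 / 2 ^ l))..x + (\<bar>t - s\<bar> + \<bar>x - y\<bar> + (1 / 2 ^ k + 1 / 2 ^ l))}"
      by (intro insert_subsetI empty_subsetI near[OF dyadic_cell_near(1)[OF assms(1) x] e(1)] near[OF dyadic_cell_near(2)[OF assms(1) x] e(1)]
          near[OF dyadic_cell_near(1)[OF assms(1) y] e(2)] near[OF dyadic_cell_near(2)[OF assms(1) y] e(2)])
  qed (simp_all add: dyadic_cell_bounds)
  have lim: "AE \<omega> in Q. (\<lambda>k. dyadic_quot k t x \<omega>) \<longlonglongrightarrow> dyadic_deriv t x \<omega>" if t: "t \<in> {0..T}" and x: "x \<in> {a..b}" for t x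
  proof -
    have "AE \<omega> in Q. convergent (\<lambda>k. dyadic_quot k t x \<omega>)"
    proof (rule AE_convergent_of_msq[where s="sqrt (1/2)" and C="2 * C"])
      fix n
      have "msq Q (\<lambda>\<omega>. dyadic_quot (Suc n) t x \<omega> - dyadic_quot n t x \<omega>) \<le> ennreal (C * (\<bar>t - t\<bar> + \<bar>x - x\<bar> + (1 / 2 ^ Suc n + 1 / 2 ^ n)))"
        by (intro grid t x)
      also have "\<dots> \<le> ennreal (2 * C * (sqrt (1 / 2) ^ n)\<^sup>2)"
      proof (rule ennreal_leI)
        have "(sqrt (1 / 2) ^ n)\<^sup>2 = (1 / 2 :: real) ^ n"
          by (simp add: power_mult[symmetric] mult.commute[of n] power_mult)
        moreover have "C * (\<bar>t - t\<bar> + \<bar>x - x\<bar> + (1 / 2 ^ Suc n + 1 / 2 ^ n)) \<le> C * (2 * (1 / 2) ^ n)"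
          using C0 by (intro mult_left_mono) (auto simp: power_one_over field_simps)
        ultimately show "C * (\<bar>t - t\<bar> + \<bar>x - x\<bar> + (1 / 2 ^ Suc n + 1 / 2 ^ n)) \<le> 2 * C * (sqrt (1 / 2) ^ n)\<^sup>2" by simp
      qed
      finally show "msq Q (\<lambda>\<omega>. dyadic_quot (Suc n) t x \<omega> - dyadic_quot n t x \<omega>) \<le> ennreal (2 * C * (sqrt (1 / 2) ^ n)\<^sup>2)" .
    qed (use C0 in \<open>auto intro: dyadic_quot_measurable\<close>)
    then show ?thesis by eventually_elim (auto simp: dyadic_deriv_def convergent_LIMSEQ_iff)
  qed
  have pow0: "(\<lambda>k. 1 / (2::real) ^ k) \<longlonglongrightarrow> 0"
    using LIMSEQ_realpow_zero[of "1/2"] by (simp add: power_one_over)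
  have hoelder: "msq Q (\<lambda>\<omega>. dyadic_deriv t x \<omega> - dyadic_deriv s y \<omega>) \<le> ennreal (C * (\<bar>t - s\<bar> + \<bar>x - y\<bar>))"
    if t: "t \<in> {0..T}" and s: "s \<in> {0..T}" and x: "x \<in> {a..b}" and y: "y \<in> {a..b}" for t s x y
  proof (rule msq_diff_le_lim[OF dyadic_quot_measurable dyadic_quot_measurable lim[OF t x] lim[OF s y] grid[OF t s x y]])
    have "(\<lambda>k. C * (\<bar>t - s\<bar> + \<bar>x - y\<bar> + (1 / 2 ^ k + 1 / 2 ^ k))) \<longlonglongrightarrow> C * (\<bar>t - s\<bar> + \<bar>x - y\<bar> + (0 + 0))"
      by (intro tendsto_intros pow0)
    then show "(\<lambda>k. C * (\<bar>t - s\<bar> + \<bar>x - y\<bar> + (1 / 2 ^ k + 1 / 2 ^ k))) \<longlonglongrightarrow> C * (\<bar>t - s\<bar> + \<bar>x - y\<bar>)" by simp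
  qed
  have quot: "msq Q (\<lambda>\<omega>. dyadic_deriv t x \<omega> - H_quot s y1 y2 \<omega>) \<le> ennreal (C * d)"
    if t: "t \<in> {0..T}" and s: "s \<in> {0..T}" and x: "x \<in> {a..b}" and y: "a \<le> y1" "y1 < y2" "y2 \<le> b"
     and d: "\<bar>t - s\<bar> \<le> d" "\<bar>y1 - x\<bar> \<le> d" "\<bar>y2 - x\<bar> \<le> d" for t s x y1 y2 d
  proof (rule msq_diff_le_lim[OF dyadic_quot_measurable _ lim[OF t x], where g="\<lambda>_. H_quot s y1 y2" and e="\<lambda>k. C * (d + 1 / 2 ^ k)"])
    have "(\<lambda>k. C * (d + 1 / 2 ^ k)) \<longlonglongrightarrow> C * (d + 0)" by (intro tendsto_intros pow0)
    then show "(\<lambda>k. C * (d + 1 / 2 ^ k)) \<longlonglongrightarrow> C * d" by simp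
    show "H_quot s y1 y2 \<in> borel_measurable Q" using s y by (intro H_quot_measurable) auto
    fix k
    show "msq Q (\<lambda>\<omega>. dyadic_quot k t x \<omega> - H_quot s y1 y2 \<omega>) \<le> ennreal (C * (d + 1 / 2 ^ k))"
      unfolding dyadic_quot_def
    proof (rule C)
      show "real (nat \<lfloor>2 ^ k * t\<rfloor>) / 2 ^ k \<le> T" using dyadic_near(2)[of t k] t by simp
      show "\<bar>real (nat \<lfloor>2 ^ k * t\<rfloor>) / 2 ^ k - s\<bar> \<le> d + 1 / 2 ^ k"
      proof -
        have tri: "\<bar>u - s\<bar> \<le> d + p" if "\<bar>u - t\<bar> \<le> p" for u p :: real
          using that d by linarith
        show ?thesis by (rule tri[OF dyadic_near(1)]) (use t in simp)
      qed
      have "0 < (b - a) / 2 ^ k" using assms by simp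
      then show "dyadic_cell k i < dyadic_cell k i + (b - a) / 2 ^ k" for i by simp
      have e: "\<bar>x - x\<bar> + 1 / 2 ^ k \<le> d + 1 / 2 ^ k" "\<bar>x - x\<bar> + d \<le> d + 1 / 2 ^ k" using d(1) by simp_all
      show "{dyadic_cell k (nat \<lfloor>2 ^ k * ((x - a) / (b - a))\<rfloor>), dyadic_cell k (nat \<lfloor>2 ^ k * ((x - a) / (b - a))\<rfloor>) + (b - a) / 2 ^ k, y1, y2}
        \<subseteq> {x - (d + 1 / 2 ^ k)..x + (d + 1 / 2 ^ k)}"
        by (intro insert_subsetI empty_subsetI near[OF dyadic_cell_near(1)[OF assms(1) x] e(1)] near[OF dyadic_cell_near(2)[OF assms(1) x] e(1)]
          near[OF d(2) e(2)] near[OF d(3) e(2)])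
    qed (use s y in \<open>simp_all add: dyadic_cell_bounds\<close>)
  qed simp_all
  have incr: "msq Q (\<lambda>\<omega>. W (t, y) \<omega> - W (t, x) \<omega> - (y - x) * dyadic_deriv t x \<omega>) \<le> ennreal (C * \<bar>y - x\<bar> ^ 3)"
    if t: "t \<in> {0..T}" and x: "x \<in> {a..b}" and y: "y \<in> {a..b}" for t x y
  proof (cases "x = y")
    case True
    then show ?thesis by (simp add: msq_def)
  next
    case False
    define y1 where "y1 = min x y"
    define y2 where "y2 = max x y"
    have m[measurable]: "H_quot t y1 y2 \<in> borel_measurable Q" "dyadic_deriv t x \<in> borel_measurable Q"
      using t x y measurable_compose[of "\<lambda>\<omega>. (t, x, \<omega>)", OF _ dyadic_deriv_measurable_joint]
      by (auto simp: y1_def y2_def min_def max_def intro!: H_quot_measurable)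
    have eq: "W (t, y) \<omega> - W (t, x) \<omega> = (y - x) * H_quot t y1 y2 \<omega>" for \<omega>
      using False by (auto simp: H_quot_def H_incr_def y1_def y2_def min_def max_def field_simps)
    have "msq Q (\<lambda>\<omega>. W (t, y) \<omega> - W (t, x) \<omega> - (y - x) * dyadic_deriv t x \<omega>) = msq Q (\<lambda>\<omega>. (x - y) * (dyadic_deriv t x \<omega> - H_quot t y1 y2 \<omega>))"
      unfolding eq by (simp add: algebra_simps)
    also have "\<dots> = ennreal ((x - y)\<^sup>2) * msq Q (\<lambda>\<omega>. dyadic_deriv t x \<omega> - H_quot t y1 y2 \<omega>)" by (rule msq_cmult) measurable
    also have "\<dots> \<le> ennreal ((x - y)\<^sup>2) * ennreal (C * \<bar>y - x\<bar>)"
      using t x y False by (intro mult_left_mono quot) (auto simp: y1_def y2_def)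
    also have "\<dots> = ennreal (C * \<bar>y - x\<bar> ^ 3)"
    proof -
      have "(x - y)\<^sup>2 = \<bar>y - x\<bar>\<^sup>2" by (simp add: power2_commute)
      then show ?thesis using C0 by (simp only: ennreal_mult[symmetric] zero_le_power2) (simp add: ennreal_mult[symmetric] power3_eq_cube power2_eq_square mult_ac)
    qed
    finally show ?thesis .
  qed
  have bound: "msq Q (dyadic_deriv t x) \<le> ennreal (2 * (C * (T + 1)))" if t: "t \<in> {0..T}" and x: "x \<in> {a..b}" for t x
  proof -
    have m[measurable]: "H_quot 0 a b \<in> borel_measurable Q" "dyadic_deriv t x \<in> borel_measurable Q"
      using t x ab measurable_compose[of "\<lambda>\<omega>. (t, x, \<omega>)", OF _ dyadic_deriv_measurable_joint]
      by (auto intro!: H_quot_measurable)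
    have "msq Q (\<lambda>\<omega>. (dyadic_deriv t x \<omega> - H_quot 0 a b \<omega>) + H_quot 0 a b \<omega>) \<le> 2 * msq Q (\<lambda>\<omega>. dyadic_deriv t x \<omega> - H_quot 0 a b \<omega>) + 2 * msq Q (H_quot 0 a b)"
      by (rule msq_add) measurable
    also have "\<dots> \<le> 2 * ennreal (C * (T + 1)) + 2 * 0"
      using t x a b assms by (intro add_mono mult_left_mono quot) (auto simp: msq_H_quot_0)
    also have "\<dots> = ennreal (2 * (C * (T + 1)))" using C0 T by (simp add: ennreal_mult)
    finally show ?thesis by simp
  qed
  define C' where "C' = C + 2 * (C * (T + 1))"
  have le: "ennreal (C * r) \<le> ennreal (C' * r)" if "0 \<le> r" for r
    unfolding C'_def using C0 T that by (intro ennreal_leI mult_right_mono) auto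
  have "L2_derivative_bounded T C' dyadic_deriv"
    unfolding L2_derivative_bounded_def
  proof (intro conjI ballI)
    show "msq Q (\<lambda>\<omega>. dyadic_deriv t x \<omega> - dyadic_deriv s y \<omega>) \<le> ennreal (C' * (\<bar>t - s\<bar> + \<bar>x - y\<bar>))"
      if "t \<in> {0..T}" "s \<in> {0..T}" "x \<in> {a..b}" "y \<in> {a..b}" for t s x y
      by (rule order_trans[OF hoelder[OF that] le]) simp
    show "msq Q (\<lambda>\<omega>. W (t, y) \<omega> - W (t, x) \<omega> - (y - x) * dyadic_deriv t x \<omega>) \<le> ennreal (C' * \<bar>y - x\<bar> ^ 3)"
      if "t \<in> {0..T}" "x \<in> {a..b}" "y \<in> {a..b}" for t x y
      by (rule order_trans[OF incr[OF that] le]) simp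
    show "msq Q (dyadic_deriv t x) \<le> ennreal C'" if "t \<in> {0..T}" "x \<in> {a..b}" for t x
      unfolding C'_def using C0 by (intro order_trans[OF bound[OF that]] ennreal_leI) auto
  qed
  moreover have "0 \<le> C'" using C0 T by (simp add: C'_def)
  ultimately show ?thesis by blast
qed

lemma L2_derivative_exists: "\<exists>D. L2_derivative D"
proof (cases "a < b")
  case True
  then have "L2_derivative dyadic_deriv"
    using dyadic_deriv_measurable_joint dyadic_deriv_bounded by (simp add: L2_derivative_def)
  then show ?thesis by blast
next
  case False
  then have "a = b" using ab by simp
  then have "L2_derivative (\<lambda>_ _ _. 0)"
    unfolding L2_derivative_def L2_derivative_bounded_def by (auto simp: msq_def intro!: exI[of _ 0])
  then show ?thesis by blast
qed

end

subsection \<open>Integrals of the derivative\<close>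

lemma LBINT_partition:
  fixes x :: "nat \<Rightarrow> real" and g :: "real \<Rightarrow> real"
  assumes "\<And>i. i < n \<Longrightarrow> x i \<le> x (Suc i)" and "set_integrable lborel {x 0..x n} g"
  shows "(LBINT v:{x 0..x n}. g v) = (\<Sum>i<n. LBINT v:{x i..x (Suc i)}. g v)"
  using assms
proof (induction n)
  case 0
  show ?case by (simp add: LBINT_singleton)
next
  case (Suc n)
  have x0n: "x 0 \<le> x n"
  proof -
    have "x 0 \<le> x m" if "m \<le> n" for m using that Suc.prems(1) by (induction m) (auto intro: order_trans)
    then show ?thesis by simp
  qed
  have xn: "x n \<le> x (Suc n)" using Suc.prems(1) by simp
  have i1: "set_integrable lborel {x 0..x n} g" and i2: "set_integrable lborel {x n..x (Suc n)} g"
    by (rule set_integrable_subset[OF Suc.prems(2)]; use x0n xn in auto)+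
  have "(LBINT v:{x 0..x (Suc n)}. g v) = integral {x 0..x (Suc n)} g"
    using Suc.prems(2) by (rule set_borel_integral_eq_integral)
  also have "\<dots> = integral {x 0..x n} g + integral {x n..x (Suc n)} g"
    using x0n xn set_borel_integral_eq_integral(1)[OF Suc.prems(2)]
    by (intro Henstock_Kurzweil_Integration.integral_combine[symmetric]) auto
  also have "\<dots> = (LBINT v:{x 0..x n}. g v) + (LBINT v:{x n..x (Suc n)}. g v)"
    using i1 i2 by (simp add: set_borel_integral_eq_integral)
  also have "(LBINT v:{x 0..x n}. g v) = (\<Sum>i<n. LBINT v:{x i..x (Suc i)}. g v)"
    using Suc.prems(1) i1 by (intro Suc.IH) auto
  finally show ?case by simp
qed

lemma LBINT_measurable:
  fixes f :: "real \<Rightarrow> 'a \<Rightarrow> real"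
  assumes [measurable]: "case_prod f \<in> borel_measurable (borel \<Otimes>\<^sub>M M)"
  shows "(\<lambda>\<omega>. LBINT v:{c..d}. f v \<omega>) \<in> borel_measurable M"
  unfolding set_lebesgue_integral_def by measurable

context smooth_hurst_field
begin

lemma L2_derivative_measurable_comp:
  assumes D: "L2_derivative D" and [measurable]: "p \<in> borel_measurable N" "q \<in> borel_measurable N"
  shows "(\<lambda>(v, \<omega>). D (p v) (q v) \<omega>) \<in> borel_measurable (N \<Otimes>\<^sub>M Q)"
proof -
  have [measurable]: "(\<lambda>(t, x, \<omega>). D t x \<omega>) \<in> borel_measurable (borel \<Otimes>\<^sub>M borel \<Otimes>\<^sub>M Q)"
    using D by (simp add: L2_derivative_def)
  have "(\<lambda>z. (\<lambda>(t, x, \<omega>). D t x \<omega>) (p (fst z), q (fst z), snd z)) \<in> borel_measurable (N \<Otimes>\<^sub>M Q)"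
    by measurable
  then show ?thesis by (simp add: split_beta)
qed

lemma L2_derivative_measurable:
  assumes D: "L2_derivative D"
  shows "D t x \<in> borel_measurable Q"
proof -
  have [measurable]: "(\<lambda>(t, x, \<omega>). D t x \<omega>) \<in> borel_measurable (borel \<Otimes>\<^sub>M borel \<Otimes>\<^sub>M Q)"
    using D by (simp add: L2_derivative_def)
  have "(\<lambda>\<omega>. (\<lambda>(t, x, \<omega>). D t x \<omega>) (t, x, \<omega>)) \<in> borel_measurable Q"
    by measurable
  then show ?thesis by simp
qed

lemma L2_derivative_bounds:
  assumes D: "L2_derivative D" and T: "0 \<le> T"
  obtains C where "C \<ge> 0"
    and "\<And>t s x y. t \<in> {0..T} \<Longrightarrow> s \<in> {0..T} \<Longrightarrow> x \<in> {a..b} \<Longrightarrow> y \<in> {a..b} \<Longrightarrow>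
       msq Q (\<lambda>\<omega>. D t x \<omega> - D s y \<omega>) \<le> ennreal (C * (\<bar>t - s\<bar> + \<bar>x - y\<bar>))"
    and "\<And>t x y. t \<in> {0..T} \<Longrightarrow> x \<in> {a..b} \<Longrightarrow> y \<in> {a..b} \<Longrightarrow>
       msq Q (\<lambda>\<omega>. W (t, y) \<omega> - W (t, x) \<omega> - (y - x) * D t x \<omega>) \<le> ennreal (C * \<bar>y - x\<bar> ^ 3)"
    and "\<And>t x. t \<in> {0..T} \<Longrightarrow> x \<in> {a..b} \<Longrightarrow> msq Q (D t x) \<le> ennreal C"
proof -
  obtain C where C: "C \<ge> 0" "L2_derivative_bounded T C D"
    using D T by (auto simp: L2_derivative_def)
  note bd = C(2)[unfolded L2_derivative_bounded_def]
  show thesis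
    by (rule that[OF C(1) conjunct1[OF bd, rule_format] conjunct1[OF conjunct2[OF bd], rule_format]
        conjunct2[OF conjunct2[OF bd], rule_format]])
qed

lemma AE_square_integrable:
  fixes p q :: "real \<Rightarrow> real"
  assumes D: "L2_derivative D" and [measurable]: "p \<in> borel_measurable borel" "q \<in> borel_measurable borel"
    and p: "\<And>v. v \<in> {c..d} \<Longrightarrow> p v \<in> {0..T}" and q: "\<And>v. v \<in> {c..d} \<Longrightarrow> q v \<in> {a..b}" and T: "0 \<le> T"
  shows "AE \<omega> in Q. (\<integral>\<^sup>+ v. ennreal ((D (p v) (q v) \<omega>)\<^sup>2) * indicator {c..d} v \<partial>lborel) < \<infinity>"
proof -
  interpret P: pair_sigma_finite lborel Q ..
  note [measurable] = L2_derivative_measurable_comp[OF D, of p borel q]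
  obtain C where C: "\<And>t x. t \<in> {0..T} \<Longrightarrow> x \<in> {a..b} \<Longrightarrow> msq Q (D t x) \<le> ennreal C"
    by (rule L2_derivative_bounds[OF D T]) (rule that)
  have "(\<integral>\<^sup>+ \<omega>. \<integral>\<^sup>+ v. ennreal ((D (p v) (q v) \<omega>)\<^sup>2) * indicator {c..d} v \<partial>lborel \<partial>Q) =
    (\<integral>\<^sup>+ v. \<integral>\<^sup>+ \<omega>. ennreal ((D (p v) (q v) \<omega>)\<^sup>2) * indicator {c..d} v \<partial>Q \<partial>lborel)"
    by (rule P.Fubini') measurable
  also have "\<dots> = (\<integral>\<^sup>+ v. msq Q (D (p v) (q v)) * indicator {c..d} v \<partial>lborel)"
    unfolding msq_def using L2_derivative_measurable[OF D] by (intro nn_integral_cong nn_integral_multc) measurable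
  also have "\<dots> \<le> (\<integral>\<^sup>+ v. ennreal C * indicator {c..d} v \<partial>lborel)"
    using C p q by (intro nn_integral_mono) (auto simp: indicator_def)
  also have "\<dots> = ennreal C * ennreal (if c \<le> d then d - c else 0)" by (simp add: nn_integral_cmult)
  also have "\<dots> < \<infinity>" by (auto simp: ennreal_mult_less_top)
  finally have "AE \<omega> in Q. (\<integral>\<^sup>+ v. ennreal ((D (p v) (q v) \<omega>)\<^sup>2) * indicator {c..d} v \<partial>lborel) \<noteq> \<infinity>"
    by (intro nn_integral_noteq_infinite) auto
  then show ?thesis by eventually_elim (simp add: less_top)
qed

lemma set_integrable_bounded_mult:
  fixes q' f :: "real \<Rightarrow> real"
  assumes [measurable]: "q' \<in> borel_measurable borel" and q': "\<And>v. v \<in> {c..d} \<Longrightarrow> \<bar>q' v\<bar> \<le> L"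
    and f: "set_integrable lborel {c..d} f" and [measurable]: "f \<in> borel_measurable borel"
  shows "set_integrable lborel {c..d} (\<lambda>v. q' v * f v)"
proof (rule set_integrable_bound[of _ _ "\<lambda>v. L * f v"])
  show "set_integrable lborel {c..d} (\<lambda>v. L * f v)" using f by (rule set_integrable_mult_right)
  show "set_borel_measurable lborel {c..d} (\<lambda>v. q' v * f v)" by (auto simp: set_borel_measurable_def)
  have "norm (q' v * f v) \<le> norm (L * f v)" if "v \<in> {c..d}" for v
    using q'[OF that] by (auto simp: abs_mult intro!: mult_right_mono)
  then show "AE v in lborel. v \<in> {c..d} \<longrightarrow> norm (q' v * f v) \<le> norm (L * f v)" by auto
qed

lemma telescoping_sum_tendsto:
  fixes p q q' :: "real \<Rightarrow> real"
  assumes D: "L2_derivative D" and cd: "c \<le> d" and T: "0 \<le> T" and L: "0 \<le> L"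
    and [measurable]: "p \<in> borel_measurable borel" "q \<in> borel_measurable borel" "q' \<in> borel_measurable borel"
    and p_in: "\<And>v. v \<in> {c..d} \<Longrightarrow> p v \<in> {0..T}" and q_in: "\<And>v. v \<in> {c..d} \<Longrightarrow> q v \<in> {a..b}"
    and p_lip: "\<And>v w. v \<in> {c..d} \<Longrightarrow> w \<in> {c..d} \<Longrightarrow> \<bar>p v - p w\<bar> \<le> L * \<bar>v - w\<bar>"
    and q_lip: "\<And>v w. v \<in> {c..d} \<Longrightarrow> w \<in> {c..d} \<Longrightarrow> \<bar>q v - q w\<bar> \<le> L * \<bar>v - w\<bar>"
    and q'_bd: "\<And>v. v \<in> {c..d} \<Longrightarrow> \<bar>q' v\<bar> \<le> L"
    and q_deriv: "\<And>v. v \<in> {c..d} \<Longrightarrow> (q has_vector_derivative q' v) (at v within {c..d})"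
  defines "x \<equiv> \<lambda>n i. c + real i * (d - c) / real n"
  shows "(\<lambda>n. msq Q (\<lambda>\<omega>. (\<Sum>i<n. W (p (x n (Suc i)), q (x n (Suc i))) \<omega> - W (p (x n (Suc i)), q (x n i)) \<omega>) -
      (LBINT v:{c..d}. q' v * D (p v) (q v) \<omega>))) \<longlonglongrightarrow> 0"
proof -
  obtain C where C0: "C \<ge> 0" and
    C1: "\<And>t s x y. t \<in> {0..T} \<Longrightarrow> s \<in> {0..T} \<Longrightarrow> x \<in> {a..b} \<Longrightarrow> y \<in> {a..b} \<Longrightarrow>
       msq Q (\<lambda>\<omega>. D t x \<omega> - D s y \<omega>) \<le> ennreal (C * (\<bar>t - s\<bar> + \<bar>x - y\<bar>))" and
    C2: "\<And>t x y. t \<in> {0..T} \<Longrightarrow> x \<in> {a..b} \<Longrightarrow> y \<in> {a..b} \<Longrightarrow>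
       msq Q (\<lambda>\<omega>. W (t, y) \<omega> - W (t, x) \<omega> - (y - x) * D t x \<omega>) \<le> ennreal (C * \<bar>y - x\<bar> ^ 3)"
    by (rule L2_derivative_bounds[OF D T]) (rule that)
  note Dm = L2_derivative_measurable[OF D]
  note Dj[measurable] = L2_derivative_measurable_comp[OF D, of p borel q]
  let ?Y = "\<lambda>n \<omega>. (\<Sum>i<n. W (p (x n (Suc i)), q (x n (Suc i))) \<omega> - W (p (x n (Suc i)), q (x n i)) \<omega>) -
      (LBINT v:{c..d}. q' v * D (p v) (q v) \<omega>)"
  have bound: "msq Q (?Y n) \<le> ennreal (6 * C * L ^ 3 * (d - c) ^ 3 / real n)" if n: "n > 0" for n
  proof -
    define \<delta> where "\<delta> = (d - c) / real n"
    have \<delta>0: "0 \<le> \<delta>" using cd by (simp add: \<delta>_def)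
    have xS: "x n (Suc i) = x n i + \<delta>" for i by (simp add: x_def \<delta>_def add_divide_distrib distrib_right)
    have x0: "x n 0 = c" and xn: "x n n = d" using n by (simp_all add: x_def)
    have x_in: "x n i \<in> {c..d}" if "i \<le> n" for i
    proof -
      have "0 \<le> real i * (d - c) / real n" using cd by simp
      moreover have "real i * (d - c) / real n \<le> d - c"
        using that n cd mult_right_mono[of "real i" "real n" "d - c"] by (simp add: divide_le_eq mult.commute)
      ultimately show ?thesis by (simp add: x_def)
    qed
    have sub: "v \<in> {c..d}" if "v \<in> {x n i..x n (Suc i)}" "i < n" for i v
      using that x_in[of i] x_in[of "Suc i"] by auto
    define r where "r i \<omega> = W (p (x n (Suc i)), q (x n (Suc i))) \<omega> - W (p (x n (Suc i)), q (x n i)) \<omega>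
       - (q (x n (Suc i)) - q (x n i)) * D (p (x n (Suc i))) (q (x n i)) \<omega>" for i \<omega>
    define s where "s i \<omega> = (LBINT v:{x n i..x n (Suc i)}. q' v * (D (p (x n (Suc i))) (q (x n i)) \<omega> - D (p v) (q v) \<omega>))" for i \<omega>
    have rm[measurable]: "r i \<in> borel_measurable Q" if "i < n" for i
      unfolding r_def using that x_in[of i] x_in[of "Suc i"] p_in[OF x_in[of "Suc i"]] q_in[OF x_in[of i]] q_in[OF x_in[of "Suc i"]]
      by (intro borel_measurable_diff borel_measurable_times borel_measurable_const W_measurable Dm) auto
    have sj[measurable]: "(\<lambda>(v, \<omega>). q' v * (D t y \<omega> - D (p v) (q v) \<omega>)) \<in> borel_measurable (borel \<Otimes>\<^sub>M Q)" for t y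
    proof -
      have [measurable]: "D t y \<in> borel_measurable Q" by (rule Dm)
      show ?thesis by measurable
    qed
    have sm[measurable]: "s i \<in> borel_measurable Q" for i
      unfolding s_def by (rule LBINT_measurable) (use sj in simp)
    have "AE \<omega> in Q. (\<integral>\<^sup>+ v. ennreal ((D (p v) (q v) \<omega>)\<^sup>2) * indicator {c..d} v \<partial>lborel) < \<infinity>"
      using p_in q_in by (intro AE_square_integrable[OF D _ _ _ _ T]) auto
    then have "AE \<omega> in Q. ?Y n \<omega> = (\<Sum>i<n. r i \<omega> + s i \<omega>)"
      using AE_space
    proof (eventually_elim)
      case (elim \<omega>)
      have fm[measurable]: "(\<lambda>v. D (p v) (q v) \<omega>) \<in> borel_measurable borel" using elim(2) by measurable
      have fi: "set_integrable lborel {c..d} (\<lambda>v. D (p v) (q v) \<omega>)"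
        using square_integrable_Icc(1)[OF fm cd] elim(1) by simp
      have qf: "set_integrable lborel {c..d} (\<lambda>v. q' v * D (p v) (q v) \<omega>)"
        using q'_bd fi by (intro set_integrable_bounded_mult) auto
      have one: "set_integrable lborel {c..d} (\<lambda>v. 1 :: real)" by (intro borel_integrable_atLeastAtMost') auto
      have q'i: "set_integrable lborel {c..d} q'"
        using set_integrable_bounded_mult[OF _ q'_bd one] by simp
      have "(LBINT v:{c..d}. q' v * D (p v) (q v) \<omega>) = (\<Sum>i<n. LBINT v:{x n i..x n (Suc i)}. q' v * D (p v) (q v) \<omega>)"
        using LBINT_partition[where n=n and x="x n" and g="\<lambda>v. q' v * D (p v) (q v) \<omega>"] qf \<delta>0 by (simp add: x0 xn xS)
      moreover have "W (p (x n (Suc i)), q (x n (Suc i))) \<omega> - W (p (x n (Suc i)), q (x n i)) \<omega> =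
          (LBINT v:{x n i..x n (Suc i)}. q' v * D (p v) (q v) \<omega>) + (r i \<omega> + s i \<omega>)" if i: "i < n" for i
      proof -
        have ss: "{x n i..x n (Suc i)} \<subseteq> {c..d}" using sub[OF _ i] by blast
        have le: "x n i \<le> x n (Suc i)" using \<delta>0 by (simp add: xS)
        have "(LBINT v:{x n i..x n (Suc i)}. q' v) = integral {x n i..x n (Suc i)} q'"
          by (intro set_borel_integral_eq_integral set_integrable_subset[OF q'i]) (use ss in auto)
        also have "\<dots> = q (x n (Suc i)) - q (x n i)"
          by (intro integral_unique fundamental_theorem_of_calculus le has_vector_derivative_within_subset[OF q_deriv ss])
            (use ss in auto)
        finally have q_incr: "(LBINT v:{x n i..x n (Suc i)}. q' v) = q (x n (Suc i)) - q (x n i)" .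
        define k where "k = D (p (x n (Suc i))) (q (x n i)) \<omega>"
        have 1: "set_integrable lborel {x n i..x n (Suc i)} (\<lambda>v. k * q' v)"
          by (intro set_integrable_mult_right set_integrable_subset[OF q'i]) (use ss in auto)
        have 2: "set_integrable lborel {x n i..x n (Suc i)} (\<lambda>v. q' v * D (p v) (q v) \<omega>)"
          by (intro set_integrable_subset[OF qf]) (use ss in auto)
        have "s i \<omega> = (LBINT v:{x n i..x n (Suc i)}. k * q' v - q' v * D (p v) (q v) \<omega>)"
          unfolding s_def k_def by (simp add: algebra_simps)
        also have "\<dots> = k * (q (x n (Suc i)) - q (x n i)) - (LBINT v:{x n i..x n (Suc i)}. q' v * D (p v) (q v) \<omega>)"
          by (subst set_integral_diff(2)[OF 1 2]) (simp add: q_incr)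
        finally show ?thesis unfolding r_def k_def[symmetric] by (simp add: algebra_simps)
      qed
      ultimately show ?case by (simp add: sum.distrib)
    qed
    then have "msq Q (?Y n) = msq Q (\<lambda>\<omega>. \<Sum>i<n. r i \<omega> + s i \<omega>)"
      unfolding msq_def by (intro nn_integral_cong_AE) auto
    also have "\<dots> \<le> of_nat n * (\<Sum>i<n. msq Q (\<lambda>\<omega>. r i \<omega> + s i \<omega>))"
      by (rule msq_sum) measurable
    also have "\<dots> \<le> of_nat n * (\<Sum>i<n. ennreal (6 * C * L ^ 3 * \<delta> ^ 3))"
    proof (intro mult_left_mono sum_mono)
      fix i assume "i \<in> {..<n}"
      then have i: "i < n" by simp
      have xi: "x n i \<in> {c..d}" "x n (Suc i) \<in> {c..d}" using i x_in by simp_all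
      have "msq Q (r i) \<le> ennreal (C * \<bar>q (x n (Suc i)) - q (x n i)\<bar> ^ 3)"
        unfolding r_def using xi by (intro C2 p_in q_in)
      also have "\<dots> \<le> ennreal (C * (L * \<delta>) ^ 3)"
        using q_lip[OF xi(2,1)] \<delta>0 C0 by (intro ennreal_leI mult_left_mono power_mono) (auto simp: xS)
      finally have r: "msq Q (r i) \<le> ennreal (C * L ^ 3 * \<delta> ^ 3)" by (simp add: power_mult_distrib mult.assoc)
      have "msq Q (s i) \<le> ennreal \<delta> * (\<integral>\<^sup>+ v. msq Q (\<lambda>\<omega>. q' v * (D (p (x n (Suc i))) (q (x n i)) \<omega> - D (p v) (q v) \<omega>)) * indicator {x n i..x n (Suc i)} v \<partial>lborel)"
        unfolding s_def using msq_integral_le[OF sigma_finite_measure_axioms sj, of "x n i" "x n (Suc i)"] \<delta>0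
        by (simp add: xS)
      also have "\<dots> \<le> ennreal \<delta> * (\<integral>\<^sup>+ v. ennreal (2 * C * L ^ 3 * \<delta>) * indicator {x n i..x n (Suc i)} v \<partial>lborel)"
      proof (intro mult_left_mono nn_integral_mono)
        fix v
        show "msq Q (\<lambda>\<omega>. q' v * (D (p (x n (Suc i))) (q (x n i)) \<omega> - D (p v) (q v) \<omega>)) * indicator {x n i..x n (Suc i)} v
          \<le> ennreal (2 * C * L ^ 3 * \<delta>) * indicator {x n i..x n (Suc i)} v"
        proof (cases "v \<in> {x n i..x n (Suc i)}")
          case True
          have v: "v \<in> {c..d}" using sub[OF True i] .
          have "msq Q (\<lambda>\<omega>. q' v * (D (p (x n (Suc i))) (q (x n i)) \<omega> - D (p v) (q v) \<omega>)) = 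
            ennreal ((q' v)\<^sup>2) * msq Q (\<lambda>\<omega>. D (p (x n (Suc i))) (q (x n i)) \<omega> - D (p v) (q v) \<omega>)"
            by (intro msq_cmult borel_measurable_diff Dm)
          also have "\<dots> \<le> ennreal (L\<^sup>2) * ennreal (C * (\<bar>p (x n (Suc i)) - p v\<bar> + \<bar>q (x n i) - q v\<bar>))"
            using q'_bd[OF v] L by (intro mult_mono C1 p_in q_in xi v ennreal_leI) (auto simp: abs_le_square_iff[symmetric])
          also have "\<dots> \<le> ennreal (L\<^sup>2) * ennreal (C * (L * \<delta> + L * \<delta>))"
          proof (intro mult_left_mono ennreal_leI add_mono C0)
            show "\<bar>p (x n (Suc i)) - p v\<bar> \<le> L * \<delta>"
              using True by (intro order_trans[OF p_lip[OF xi(2) v]] mult_left_mono L) (auto simp: xS)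
            show "\<bar>q (x n i) - q v\<bar> \<le> L * \<delta>"
              using True by (intro order_trans[OF q_lip[OF xi(1) v]] mult_left_mono L) (auto simp: xS)
          qed simp
          also have "\<dots> = ennreal (2 * C * L ^ 3 * \<delta>)"
            using C0 L \<delta>0 by (subst ennreal_mult[symmetric]) (auto simp: power2_eq_square power3_eq_cube algebra_simps)
          finally show ?thesis using True by simp
        qed simp
      qed simp_all
      also have "\<dots> = ennreal \<delta> * (ennreal (2 * C * L ^ 3 * \<delta>) * ennreal \<delta>)"
        using \<delta>0 by (simp add: nn_integral_cmult xS)
      also have "\<dots> = ennreal (2 * C * L ^ 3 * \<delta> ^ 3)"
        using C0 L \<delta>0 by (simp add: ennreal_mult[symmetric] power3_eq_cube mult_ac)
      finally have s: "msq Q (s i) \<le> ennreal (2 * C * L ^ 3 * \<delta> ^ 3)" .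
      have "msq Q (\<lambda>\<omega>. r i \<omega> + s i \<omega>) \<le> 2 * msq Q (r i) + 2 * msq Q (s i)"
        using i by (intro msq_add) measurable
      also have "\<dots> \<le> 2 * ennreal (C * L ^ 3 * \<delta> ^ 3) + 2 * ennreal (2 * C * L ^ 3 * \<delta> ^ 3)"
        by (intro add_mono mult_left_mono r s) auto
      also have "\<dots> = ennreal (2 * (C * L ^ 3 * \<delta> ^ 3) + 2 * (2 * C * L ^ 3 * \<delta> ^ 3))"
      proof -
        have tw: "2 * ennreal u + 2 * ennreal v = ennreal (2 * u + 2 * v)" if "0 \<le> u" "0 \<le> v" for u v
          using that by (simp add: ennreal_mult)
        show ?thesis by (rule tw) (use C0 L \<delta>0 in auto)
      qed
      also have "\<dots> = ennreal (6 * C * L ^ 3 * \<delta> ^ 3)" by (simp add: algebra_simps)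
      finally show "msq Q (\<lambda>\<omega>. r i \<omega> + s i \<omega>) \<le> ennreal (6 * C * L ^ 3 * \<delta> ^ 3)" .
    qed simp_all
    also have "\<dots> = ennreal (real n * (real n * (6 * C * L ^ 3 * \<delta> ^ 3)))"
      using C0 L \<delta>0 by (simp add: ennreal_of_nat_eq_real_of_nat ennreal_mult)
    also have "real n * (real n * (6 * C * L ^ 3 * \<delta> ^ 3)) = 6 * C * L ^ 3 * (d - c) ^ 3 / real n"
      using n by (simp add: \<delta>_def power3_eq_cube)
    finally show ?thesis .
  qed
  show ?thesis
  proof (rule tendsto_sandwich[of "\<lambda>_. 0" _ _ "\<lambda>n. ennreal (6 * C * L ^ 3 * (d - c) ^ 3 / real n)"])
    show "\<forall>\<^sub>F n in sequentially. msq Q (?Y n) \<le> ennreal (6 * C * L ^ 3 * (d - c) ^ 3 / real n)"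
      using bound by (auto intro!: eventually_sequentiallyI[of 1])
    have "(\<lambda>n. ennreal (6 * C * L ^ 3 * (d - c) ^ 3 / real n)) \<longlonglongrightarrow> ennreal 0"
      by (intro tendsto_ennrealI lim_const_over_n)
    then show "(\<lambda>n. ennreal (6 * C * L ^ 3 * (d - c) ^ 3 / real n)) \<longlonglongrightarrow> 0" by simp
  qed simp_all
qed

end

subsection \<open>The modification\<close>

lemma msq_eq_0_iff:
  assumes [measurable]: "f \<in> borel_measurable M"
  shows "msq M f = 0 \<longleftrightarrow> (AE x in M. f x = 0)"
  unfolding msq_def by (subst nn_integral_0_iff_AE) auto

lemma nn_integral_abs_powr_finite:
  assumes "x0 \<in> {a..b}" "b - a \<le> 1"
  shows "(\<integral>\<^sup>+ x. ennreal (\<bar>x - x0\<bar> powr (-1/2)) * indicator {a..b} x \<partial>lborel) < \<infinity>"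
proof -
  let ?g = "\<lambda>x. ennreal (x powr (-1/2)) * indicator {0..1} x"
  have g: "(\<integral>\<^sup>+ x. ?g x \<partial>lborel) = ennreal 2"
    using nn_integral_powr_Icc[of "-1/2" 1] by simp
  have "(\<integral>\<^sup>+ x. ennreal (\<bar>x - x0\<bar> powr (-1/2)) * indicator {a..b} x \<partial>lborel) \<le> (\<integral>\<^sup>+ x. ?g (- x0 + 1 * x) + ?g (x0 + (-1) * x) \<partial>lborel)"
    using assms by (intro nn_integral_mono) (auto simp: indicator_def abs_if)
  also have "\<dots> = (\<integral>\<^sup>+ x. ?g (- x0 + 1 * x) \<partial>lborel) + (\<integral>\<^sup>+ x. ?g (x0 + (-1) * x) \<partial>lborel)"
    by (rule nn_integral_add) auto
  also have "(\<integral>\<^sup>+ x. ?g (- x0 + 1 * x) \<partial>lborel) = ennreal 2"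
    using nn_integral_real_affine[of ?g 1 "-x0"] g by simp
  also have "(\<integral>\<^sup>+ x. ?g (x0 + (-1) * x) \<partial>lborel) = ennreal 2"
    using nn_integral_real_affine[of ?g "-1" x0] g by simp
  finally show ?thesis by (rule le_less_trans) (simp flip: ennreal_plus)
qed

context smooth_hurst_field
begin

lemma L2_derivative_measurable_section:
  assumes D: "L2_derivative D"
  shows "(\<lambda>(x, \<omega>). D t x \<omega>) \<in> borel_measurable (borel \<Otimes>\<^sub>M Q)"
  by (rule L2_derivative_measurable_comp[where p="\<lambda>_. t" and q="\<lambda>x. x", OF D]) auto

lemma AE_W_eq_integral:
  assumes D: "L2_derivative D" and t: "0 \<le> t" and x: "x \<in> {a..b}"
  shows "AE \<omega> in Q. W (t, x) \<omega> = W (t, a) \<omega> + (LBINT u:{a..x}. D t u \<omega>)"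
proof -
  let ?f = "\<lambda>\<omega>. W (t, x) \<omega> - W (t, a) \<omega> - (LBINT u:{a..x}. D t u \<omega>)"
  have "(\<lambda>n. msq Q (\<lambda>\<omega>. (\<Sum>i<n. W (t, a + real (Suc i) * (x - a) / real n) \<omega> - W (t, a + real i * (x - a) / real n) \<omega>) -
      (LBINT v:{a..x}. 1 * D t v \<omega>))) \<longlonglongrightarrow> 0"
    using x t by (intro telescoping_sum_tendsto[where p="\<lambda>_. t" and q="\<lambda>x. x" and q'="\<lambda>_. 1" and T=t and L=1, OF D])
      (auto intro!: derivative_eq_intros)
  moreover have "(\<Sum>i<n. W (t, a + real (Suc i) * (x - a) / real n) \<omega> - W (t, a + real i * (x - a) / real n) \<omega>) = W (t, x) \<omega> - W (t, a) \<omega>"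
    if "n > 0" for n \<omega>
    using sum_lessThan_telescope[of "\<lambda>i. W (t, a + real i * (x - a) / real n) \<omega>" n] that by simp
  then have "\<forall>\<^sub>F n in sequentially. msq Q (\<lambda>\<omega>. (\<Sum>i<n. W (t, a + real (Suc i) * (x - a) / real n) \<omega> - W (t, a + real i * (x - a) / real n) \<omega>) -
      (LBINT v:{a..x}. 1 * D t v \<omega>)) = msq Q ?f"
    by (intro eventually_sequentiallyI[of 1]) simp
  ultimately have "(\<lambda>n. msq Q ?f) \<longlonglongrightarrow> 0"
    by (rule Lim_transform_eventually)
  then have "msq Q ?f = 0" by (simp add: LIMSEQ_const_iff)
  moreover have "?f \<in> borel_measurable Q"
    by (intro borel_measurable_diff W_measurable LBINT_measurable L2_derivative_measurable_section D t x) (use ab in simp)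
  ultimately have "AE \<omega> in Q. ?f \<omega> = 0" using msq_eq_0_iff by blast
  then show ?thesis by eventually_elim simp
qed

lemma AE_has_vector_derivative:
  assumes D: "L2_derivative D" and t: "0 \<le> t" and x0: "x0 \<in> {a..b}"
  shows "AE \<omega> in Q. ((\<lambda>x. LBINT u:{a..x}. D t u \<omega>) has_vector_derivative D t x0 \<omega>) (at x0 within {a..b})"
proof -
  interpret P: pair_sigma_finite lborel Q ..
  obtain C where C0: "C \<ge> 0" and
    C: "\<And>x y. x \<in> {a..b} \<Longrightarrow> y \<in> {a..b} \<Longrightarrow> msq Q (\<lambda>\<omega>. D t x \<omega> - D t y \<omega>) \<le> ennreal (C * \<bar>x - y\<bar>)"
  proof (rule L2_derivative_bounds[OF D t])
    fix C assume C: "C \<ge> 0" "\<And>t' s x y. t' \<in> {0..t} \<Longrightarrow> s \<in> {0..t} \<Longrightarrow> x \<in> {a..b} \<Longrightarrow> y \<in> {a..b} \<Longrightarrow>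
       msq Q (\<lambda>\<omega>. D t' x \<omega> - D s y \<omega>) \<le> ennreal (C * (\<bar>t' - s\<bar> + \<bar>x - y\<bar>))"
    have "msq Q (\<lambda>\<omega>. D t x \<omega> - D t y \<omega>) \<le> ennreal (C * \<bar>x - y\<bar>)" if "x \<in> {a..b}" "y \<in> {a..b}" for x y
      using C(2)[of t t x y] t that by simp
    then show thesis by (rule that[OF C(1)])
  qed
  have Dj[measurable]: "(\<lambda>(x, \<omega>). D t x \<omega>) \<in> borel_measurable (borel \<Otimes>\<^sub>M Q)"
    by (rule L2_derivative_measurable_section[OF D])
  have Dm[measurable]: "D t x \<in> borel_measurable Q" for x by (rule L2_derivative_measurable[OF D])
  have 1: "AE \<omega> in Q. (\<integral>\<^sup>+ v. ennreal ((D t v \<omega>)\<^sup>2) * indicator {a..b} v \<partial>lborel) < \<infinity>"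
    using t by (intro AE_square_integrable[where p="\<lambda>_. t" and q="\<lambda>x. x" and T=t, OF D]) auto
  have "(\<integral>\<^sup>+ \<omega>. \<integral>\<^sup>+ x. ennreal ((D t x \<omega> - D t x0 \<omega>)\<^sup>2 * \<bar>x - x0\<bar> powr (-3/2)) * indicator {a..b} x \<partial>lborel \<partial>Q) =
    (\<integral>\<^sup>+ x. \<integral>\<^sup>+ \<omega>. ennreal ((D t x \<omega> - D t x0 \<omega>)\<^sup>2 * \<bar>x - x0\<bar> powr (-3/2)) * indicator {a..b} x \<partial>Q \<partial>lborel)"
    by (rule P.Fubini') measurable
  also have "\<dots> = (\<integral>\<^sup>+ x. \<integral>\<^sup>+ \<omega>. ennreal ((D t x \<omega> - D t x0 \<omega>)\<^sup>2) * (ennreal (\<bar>x - x0\<bar> powr (-3/2)) * indicator {a..b} x) \<partial>Q \<partial>lborel)"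
    by (simp add: ennreal_mult mult.assoc)
  also have "\<dots> = (\<integral>\<^sup>+ x. msq Q (\<lambda>\<omega>. D t x \<omega> - D t x0 \<omega>) * (ennreal (\<bar>x - x0\<bar> powr (-3/2)) * indicator {a..b} x) \<partial>lborel)"
    unfolding msq_def by (intro nn_integral_cong nn_integral_multc) measurable
  also have "\<dots> \<le> (\<integral>\<^sup>+ x. ennreal C * (ennreal (\<bar>x - x0\<bar> powr (-1/2)) * indicator {a..b} x) \<partial>lborel)"
  proof (rule nn_integral_mono)
    fix x
    show "msq Q (\<lambda>\<omega>. D t x \<omega> - D t x0 \<omega>) * (ennreal (\<bar>x - x0\<bar> powr (-3/2)) * indicator {a..b} x) \<le> 
      ennreal C * (ennreal (\<bar>x - x0\<bar> powr (-1/2)) * indicator {a..b} x)"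
    proof (cases "x \<in> {a..b}")
      case True
      have p: "y * y powr (-3/2) = y powr (-1/2)" if "0 \<le> y" for y :: real
        using that powr_add[of y 1 "-3/2"] by (cases "y = 0") auto
      have "msq Q (\<lambda>\<omega>. D t x \<omega> - D t x0 \<omega>) * ennreal (\<bar>x - x0\<bar> powr (-3/2)) \<le> ennreal (C * \<bar>x - x0\<bar>) * ennreal (\<bar>x - x0\<bar> powr (-3/2))"
        by (intro mult_right_mono C True x0) simp
      also have "\<dots> = ennreal C * ennreal (\<bar>x - x0\<bar> powr (-1/2))"
        using C0 p[of "\<bar>x - x0\<bar>"] by (simp add: ennreal_mult[symmetric] mult.assoc)
      finally show ?thesis using True by simp
    qed simp
  qed
  also have "\<dots> = ennreal C * (\<integral>\<^sup>+ x. ennreal (\<bar>x - x0\<bar> powr (-1/2)) * indicator {a..b} x \<partial>lborel)"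
    by (rule nn_integral_cmult) measurable
  also have "\<dots> < \<infinity>"
    using nn_integral_abs_powr_finite[OF x0] a b by (simp add: ennreal_mult_less_top)
  finally have "AE \<omega> in Q. (\<integral>\<^sup>+ x. ennreal ((D t x \<omega> - D t x0 \<omega>)\<^sup>2 * \<bar>x - x0\<bar> powr (-3/2)) * indicator {a..b} x \<partial>lborel) \<noteq> \<infinity>"
    by (intro nn_integral_noteq_infinite) auto
  with 1 AE_space show ?thesis
  proof eventually_elim
    case (elim \<omega>)
    have "(\<lambda>x. D t x \<omega>) \<in> borel_measurable borel" using elim(2) by measurable
    then show ?case
      using elim x0 by (intro has_vector_derivative_integral_of_weight) (auto simp: less_top)
  qed
qed

lemma modification_exists:
  assumes D: "L2_derivative D" and h: "\<And>t. 0 \<le> t \<Longrightarrow> h t \<in> {a..b}"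
    and Ds: "\<And>t. 0 \<le> t \<Longrightarrow> Ds t \<in> borel_measurable Q" "\<And>t. 0 \<le> t \<Longrightarrow> AE \<omega> in Q. Ds t \<omega> = D t (h t) \<omega>"
  obtains W' where "is_modification ({0..} \<times> {a..b}) Q W' W"
    and "\<And>\<omega> t. \<omega> \<in> space Q \<Longrightarrow> 0 \<le> t \<Longrightarrow> ((\<lambda>x. W' (t, x) \<omega>) has_vector_derivative Ds t \<omega>) (at (h t) within {a..b})"
proof -
  define F where "F t x \<omega> = (LBINT u:{a..x}. D t u \<omega>)" for t x \<omega>
  have "\<exists>N. 0 \<le> t \<longrightarrow> N \<in> null_sets Q \<and> (\<forall>\<omega>\<in>space Q - N.
      ((\<lambda>x. F t x \<omega>) has_vector_derivative Ds t \<omega>) (at (h t) within {a..b}))" for t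
  proof (cases "0 \<le> t")
    case True
    have "AE \<omega> in Q. ((\<lambda>x. F t x \<omega>) has_vector_derivative Ds t \<omega>) (at (h t) within {a..b})"
      using Ds(2)[OF True] AE_has_vector_derivative[OF D True h[OF True]] unfolding F_def by eventually_elim simp
    then show ?thesis by (rule AE_E3) blast
  qed simp
  then obtain N where N: "\<And>t. 0 \<le> t \<Longrightarrow> N t \<in> null_sets Q"
    "\<And>t \<omega>. 0 \<le> t \<Longrightarrow> \<omega> \<in> space Q \<Longrightarrow> \<omega> \<notin> N t \<Longrightarrow> ((\<lambda>x. F t x \<omega>) has_vector_derivative Ds t \<omega>) (at (h t) within {a..b})"
    by (metis (no_types) DiffI)
  define W' where "W' = (\<lambda>(t, x) \<omega>. if \<omega> \<in> N t then Ds t \<omega> * (x - h t) else W (t, a) \<omega> + F t x \<omega>)"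
  show thesis
  proof (rule that[of W'])
    have "W' (t, x) \<in> borel_measurable Q \<and> (AE \<omega> in Q. W' (t, x) \<omega> = W (t, x) \<omega>)" if t: "0 \<le> t" and x: "x \<in> {a..b}" for t x
    proof
      have [measurable]: "N t \<in> sets Q" "Ds t \<in> borel_measurable Q" "W (t, a) \<in> borel_measurable Q"
        using N(1)[OF t] Ds(1)[OF t] W_measurable[OF t, of a] ab by auto
      have [measurable]: "F t x \<in> borel_measurable Q"
        unfolding F_def by (intro LBINT_measurable L2_derivative_measurable_section D)
      show "W' (t, x) \<in> borel_measurable Q" unfolding W'_def by simp
      show "AE \<omega> in Q. W' (t, x) \<omega> = W (t, x) \<omega>"
        using AE_not_in[OF N(1)[OF t]] AE_W_eq_integral[OF D t x]
        by eventually_elim (simp add: W'_def F_def)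
    qed
    then show "is_modification ({0..} \<times> {a..b}) Q W' W"
      by (auto simp: is_modification_def)
    fix \<omega> t assume \<omega>: "\<omega> \<in> space Q" and t: "0 \<le> (t::real)"
    show "((\<lambda>x. W' (t, x) \<omega>) has_vector_derivative Ds t \<omega>) (at (h t) within {a..b})"
    proof (cases "\<omega> \<in> N t")
      case True
      have "((\<lambda>x. Ds t \<omega> * (x - h t)) has_real_derivative Ds t \<omega>) (at (h t) within {a..b})"
        by (auto intro!: derivative_eq_intros)
      then show ?thesis using True by (simp add: W'_def has_real_derivative_iff_has_vector_derivative)
    next
      case False
      have "((\<lambda>x. W (t, a) \<omega> + F t x \<omega>) has_vector_derivative (0 + Ds t \<omega>)) (at (h t) within {a..b})"
        by (intro has_vector_derivative_add has_vector_derivative_const N t \<omega> False)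
      then show ?thesis using False by (simp add: W'_def)
    qed
  qed
qed

lemma pathwise_derivative_exists:
  assumes D: "L2_derivative D" and h: "\<And>t. 0 \<le> t \<Longrightarrow> h t \<in> {a..b}" and hc: "continuous_on {0..} h"
  obtains Ds where "(\<lambda>(t, \<omega>). Ds t \<omega>) \<in> borel_measurable (borel \<Otimes>\<^sub>M Q)"
    and "AE \<omega> in Q. \<forall>t\<ge>0. Ds t \<omega> = D t (h t) \<omega>"
    and "\<And>\<omega> t. \<omega> \<in> space Q \<Longrightarrow> 0 \<le> t \<Longrightarrow> set_integrable lborel {0..t} (\<lambda>v. Ds v \<omega>)"
proof -
  define p q where "p t = max 0 t" and "q t = h (max 0 t)" for t :: real
  have pq[measurable]: "p \<in> borel_measurable borel" "q \<in> borel_measurable borel"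
    unfolding p_def q_def
    by (auto intro!: borel_measurable_continuous_onI continuous_on_compose2[OF hc] continuous_intros)
  note [measurable] = L2_derivative_measurable_comp[OF D, of p borel q]
  define G where "G \<omega> \<longleftrightarrow> (\<forall>m::nat. (\<integral>\<^sup>+ v. ennreal ((D (p v) (q v) \<omega>)\<^sup>2) * indicator {0..real m} v \<partial>lborel) < \<infinity>)" for \<omega>
  have [measurable]: "Measurable.pred Q G" unfolding G_def by measurable
  define Ds where "Ds t \<omega> = (if G \<omega> then D (p t) (q t) \<omega> else 0)" for t \<omega>
  have Dsm[measurable]: "(\<lambda>(t, \<omega>). Ds t \<omega>) \<in> borel_measurable (borel \<Otimes>\<^sub>M Q)"
    unfolding Ds_def by measurable
  have "AE \<omega> in Q. G \<omega>"
    unfolding G_def AE_all_countable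
  proof
    fix m :: nat
    show "AE \<omega> in Q. (\<integral>\<^sup>+ v. ennreal ((D (p v) (q v) \<omega>)\<^sup>2) * indicator {0..real m} v \<partial>lborel) < \<infinity>"
    proof (rule AE_square_integrable[OF D pq])
      show "p v \<in> {0..real m}" if "v \<in> {0..real m}" for v using that by (simp add: p_def)
      show "q v \<in> {a..b}" for v unfolding q_def by (rule h) simp
    qed simp
  qed
  then have "AE \<omega> in Q. \<forall>t\<ge>0. Ds t \<omega> = D t (h t) \<omega>"
    by eventually_elim (simp add: Ds_def p_def q_def)
  moreover have "set_integrable lborel {0..t} (\<lambda>v. Ds v \<omega>)" if \<omega>: "\<omega> \<in> space Q" and t: "0 \<le> t" for \<omega> t
  proof -
    have Dm: "(\<lambda>v. Ds v \<omega>) \<in> borel_measurable borel" using \<omega> by measurable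
    obtain m :: nat where m: "t \<le> real m" using real_arch_simple by blast
    have "(\<integral>\<^sup>+ v. ennreal ((Ds v \<omega>)\<^sup>2) * indicator {0..t} v \<partial>lborel) \<le> (\<integral>\<^sup>+ v. ennreal ((Ds v \<omega>)\<^sup>2) * indicator {0..real m} v \<partial>lborel)"
      using m by (intro nn_integral_mono) (auto simp: indicator_def)
    also have "\<dots> < \<infinity>"
    proof (cases "G \<omega>")
      case True
      then have "(\<integral>\<^sup>+ v. ennreal ((D (p v) (q v) \<omega>)\<^sup>2) * indicator {0..real m} v \<partial>lborel) < \<infinity>"
        unfolding G_def by blast
      then show ?thesis using True by (simp add: Ds_def)
    qed (simp add: Ds_def)
    finally show ?thesis by (rule square_integrable_Icc(1)[OF Dm t])
  qed
  ultimately show thesis using that Dsm by blast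
qed

end

subsection \<open>Identification of the finite-dimensional distributions\<close>

definition lincomb :: "'i set \<Rightarrow> ('i \<Rightarrow> 'a \<Rightarrow> real) \<Rightarrow> ('a \<Rightarrow> real) \<Rightarrow> bool" where
  "lincomb I X Z \<longleftrightarrow> (\<exists>J c. finite J \<and> J \<subseteq> I \<and> Z = (\<lambda>\<omega>. \<Sum>i\<in>J. c i * X i \<omega>))"

lemma lincomb_member: "i \<in> I \<Longrightarrow> lincomb I X (X i)"
  unfolding lincomb_def by (intro exI[of _ "{i}"] exI[of _ "\<lambda>_. 1"]) simp

lemma lincomb_zero: "lincomb I X (\<lambda>_. 0)"
  unfolding lincomb_def by (intro exI[of _ "{}"]) simp

lemma lincomb_cmult: "lincomb I X Z \<Longrightarrow> lincomb I X (\<lambda>\<omega>. k * Z \<omega>)"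
  unfolding lincomb_def
proof (elim exE conjE)
  fix J c assume "finite J" "J \<subseteq> I" "Z = (\<lambda>\<omega>. \<Sum>i\<in>J. c i * X i \<omega>)"
  then show "\<exists>J c. finite J \<and> J \<subseteq> I \<and> (\<lambda>\<omega>. k * Z \<omega>) = (\<lambda>\<omega>. \<Sum>i\<in>J. c i * X i \<omega>)"
    by (intro exI[of _ J] exI[of _ "\<lambda>i. k * c i"]) (simp add: sum_distrib_left mult.assoc)
qed

lemma lincomb_add:
  assumes "lincomb I X Z" "lincomb I X Z'"
  shows "lincomb I X (\<lambda>\<omega>. Z \<omega> + Z' \<omega>)"
proof -
  obtain J c where J: "finite J" "J \<subseteq> I" "Z = (\<lambda>\<omega>. \<Sum>i\<in>J. c i * X i \<omega>)"
    using assms(1) by (auto simp: lincomb_def)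
  obtain J' c' where J': "finite J'" "J' \<subseteq> I" "Z' = (\<lambda>\<omega>. \<Sum>i\<in>J'. c' i * X i \<omega>)"
    using assms(2) by (auto simp: lincomb_def)
  have "(\<Sum>i\<in>J. c i * X i \<omega>) = (\<Sum>i\<in>J \<union> J'. (if i \<in> J then c i else 0) * X i \<omega>)" for \<omega>
    using J J' by (intro sum.mono_neutral_cong_left) auto
  moreover have "(\<Sum>i\<in>J'. c' i * X i \<omega>) = (\<Sum>i\<in>J \<union> J'. (if i \<in> J' then c' i else 0) * X i \<omega>)" for \<omega>
    using J J' by (intro sum.mono_neutral_cong_left) auto
  ultimately have "(\<lambda>\<omega>. Z \<omega> + Z' \<omega>) = (\<lambda>\<omega>. \<Sum>i\<in>J \<union> J'. ((if i \<in> J then c i else 0) + (if i \<in> J' then c' i else 0)) * X i \<omega>)"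
    unfolding J(3) J'(3) by (simp only: distrib_right sum.distrib)
  then show ?thesis unfolding lincomb_def using J J' by (intro exI[of _ "J \<union> J'"]) auto
qed

lemma lincomb_sum: "finite A \<Longrightarrow> (\<And>k. k \<in> A \<Longrightarrow> lincomb I X (Z k)) \<Longrightarrow> lincomb I X (\<lambda>\<omega>. \<Sum>k\<in>A. Z k \<omega>)"
  by (induction A rule: finite_induct) (auto intro: lincomb_add lincomb_zero)

lemma lincomb_diff: "lincomb I X Z \<Longrightarrow> lincomb I X Z' \<Longrightarrow> lincomb I X (\<lambda>\<omega>. Z \<omega> - Z' \<omega>)"
  using lincomb_add[of I X Z "\<lambda>\<omega>. (-1) * Z' \<omega>"] lincomb_cmult[of I X Z' "-1"] by simp

lemma centered_normal_lincomb:
  "centered_gaussian_field M I X \<Longrightarrow> lincomb I X Z \<Longrightarrow> centered_normal M Z"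
  unfolding centered_gaussian_field_def lincomb_def by blast

lemma msq_sum_tendsto_0:
  assumes "finite J" and "\<And>j n. j \<in> J \<Longrightarrow> f n j \<in> borel_measurable M"
    and "\<And>j. j \<in> J \<Longrightarrow> (\<lambda>n. msq M (f n j)) \<longlonglongrightarrow> 0"
  shows "(\<lambda>n. msq M (\<lambda>x. \<Sum>j\<in>J. f n j x)) \<longlonglongrightarrow> 0"
  using assms
proof (induction J rule: finite_induct)
  case empty
  then show ?case by (simp add: msq_def)
next
  case (insert j J)
  have "(\<lambda>n. 2 * msq M (f n j) + 2 * msq M (\<lambda>x. \<Sum>j\<in>J. f n j x)) \<longlonglongrightarrow> 2 * 0 + 2 * 0"
    using insert by (intro tendsto_add ennreal_tendsto_cmult) auto
  then have lim: "(\<lambda>n. 2 * msq M (f n j) + 2 * msq M (\<lambda>x. \<Sum>j\<in>J. f n j x)) \<longlonglongrightarrow> 0" by simp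
  have le: "msq M (\<lambda>x. \<Sum>j\<in>insert j J. f n j x) \<le> 2 * msq M (f n j) + 2 * msq M (\<lambda>x. \<Sum>j\<in>J. f n j x)" for n
    using insert.hyps insert.prems(1) msq_add[of "f n j" M "\<lambda>x. \<Sum>j\<in>J. f n j x"] by simp
  show ?case
    by (rule tendsto_sandwich[OF _ _ tendsto_const lim]) (use le in auto)
qed

lemma square_weighted_sum:
  fixes c f :: "'i \<Rightarrow> real"
  shows "(\<Sum>j\<in>J. c j * f j)\<^sup>2 = (\<Sum>j\<in>J. \<Sum>k\<in>J. (c j * c k) * (f j * f k))"
  by (simp add: power2_eq_square sum_product mult_ac)

text \<open>
  Values of characteristic functions pass to \<open>L\<^sup>2\<close> limits, so the limiting field is identified
  without showing that it is Gaussian.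
\<close>

lemma fdd_equal_of_L2_limit:
  assumes P: "centered_gaussian_field P I S" and Q: "prob_space Q" and G: "centered_gaussian_field Q I' X"
    and Y: "\<And>t. t \<in> I \<Longrightarrow> Y t \<in> borel_measurable Q"
    and Yn: "\<And>t n. t \<in> I \<Longrightarrow> lincomb I' X (Yn n t)"
    and lim: "\<And>t. t \<in> I \<Longrightarrow> (\<lambda>n. msq Q (\<lambda>\<omega>. Yn n t \<omega> - Y t \<omega>)) \<longlonglongrightarrow> 0"
    and int: "\<And>t s n. t \<in> I \<Longrightarrow> s \<in> I \<Longrightarrow> integrable Q (\<lambda>\<omega>. Yn n t \<omega> * Yn n s \<omega>)"
    and cov: "\<And>t s. t \<in> I \<Longrightarrow> s \<in> I \<Longrightarrow> (\<lambda>n. LINT \<omega>|Q. Yn n t \<omega> * Yn n s \<omega>) \<longlonglongrightarrow> (LINT \<omega>|P. S t \<omega> * S s \<omega>)"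
  shows "fdd_equal I P S Q Y"
proof -
  have P': "prob_space P" using P by (simp add: centered_gaussian_field_def)
  have Sn: "centered_normal P Z" if "lincomb I S Z" for Z using P that by (rule centered_normal_lincomb)
  have S: "S t \<in> borel_measurable P" if "t \<in> I" for t
    using Sn[OF lincomb_member[OF that]] by (simp add: centered_normal_def)
  have Ynm: "Yn n t \<in> borel_measurable Q" if "t \<in> I" for n t
    using centered_normal_lincomb[OF G Yn[OF that]] by (simp add: centered_normal_def)
  have SS: "integrable P (\<lambda>\<omega>. S t \<omega> * S s \<omega>)" if "t \<in> I" "s \<in> I" for t s
  proof -
    have "integrable P (\<lambda>\<omega>. (S t \<omega> + S s \<omega>)\<^sup>2)" "integrable P (\<lambda>\<omega>. (S t \<omega> - S s \<omega>)\<^sup>2)"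
      using that by (auto intro!: centered_normal_square_integrable[OF P'] Sn lincomb_add lincomb_diff lincomb_member)
    then have "integrable P (\<lambda>\<omega>. ((S t \<omega> + S s \<omega>)\<^sup>2 - (S t \<omega> - S s \<omega>)\<^sup>2) / 4)" by simp
    moreover have "((x + y)\<^sup>2 - (x - y)\<^sup>2) / 4 = x * y" for x y :: real by (simp add: power2_eq_square algebra_simps)
    ultimately show ?thesis by simp
  qed
  show ?thesis
    unfolding fdd_equal_def
  proof (intro conjI ballI allI impI)
    fix J assume J: "finite J \<and> J \<subseteq> I"
    then have fin: "finite J" and sub: "\<And>j. j \<in> J \<Longrightarrow> j \<in> I" by auto
    show "distr P (\<Pi>\<^sub>M i\<in>J. borel) (\<lambda>\<omega>. \<lambda>i\<in>J. S i \<omega>) = distr Q (\<Pi>\<^sub>M i\<in>J. borel) (\<lambda>\<omega>. \<lambda>i\<in>J. Y i \<omega>)"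
    proof (rule distr_PiM_eqI_cos[OF P' Q fin])
      fix c and \<phi> :: real
      define V where "V n = (LINT \<omega>|Q. (\<Sum>j\<in>J. c j * Yn n j \<omega>)\<^sup>2)" for n
      have V_eq: "V = (\<lambda>n. \<Sum>j\<in>J. \<Sum>k\<in>J. (c j * c k) * (LINT \<omega>|Q. Yn n j \<omega> * Yn n k \<omega>))"
        unfolding V_def[abs_def] square_weighted_sum using sub by (simp add: int Bochner_Integration.integral_sum)
      have "V \<longlonglongrightarrow> (\<Sum>j\<in>J. \<Sum>k\<in>J. (c j * c k) * (LINT \<omega>|P. S j \<omega> * S k \<omega>))"
        unfolding V_eq using sub by (intro tendsto_sum tendsto_mult_left cov)
      also have "(\<Sum>j\<in>J. \<Sum>k\<in>J. (c j * c k) * (LINT \<omega>|P. S j \<omega> * S k \<omega>)) = (LINT \<omega>|P. (\<Sum>j\<in>J. c j * S j \<omega>)\<^sup>2)"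
        unfolding square_weighted_sum using sub by (simp add: SS Bochner_Integration.integral_sum)
      finally have V: "V \<longlonglongrightarrow> (LINT \<omega>|P. (\<Sum>j\<in>J. c j * S j \<omega>)\<^sup>2)" .
      have "lincomb I S (\<lambda>\<omega>. \<Sum>j\<in>J. c j * S j \<omega>)"
        using fin sub by (intro lincomb_sum lincomb_cmult lincomb_member)
      then have SE: "(LINT \<omega>|P. cos ((\<Sum>j\<in>J. c j * S j \<omega>) + \<phi>)) = cos \<phi> * exp (- (LINT \<omega>|P. (\<Sum>j\<in>J. c j * S j \<omega>)\<^sup>2) / 2)"
        by (intro centered_normal_cos[OF P'] Sn)
      have "lincomb I' X (\<lambda>\<omega>. \<Sum>j\<in>J. c j * Yn n j \<omega>)" for n
        using fin sub by (intro lincomb_sum lincomb_cmult Yn)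
      then have YE: "(LINT \<omega>|Q. cos ((\<Sum>j\<in>J. c j * Yn n j \<omega>) + \<phi>)) = cos \<phi> * exp (- V n / 2)" for n
        unfolding V_def by (intro centered_normal_cos[OF Q] centered_normal_lincomb[OF G])
      have "(\<lambda>n. msq Q (\<lambda>\<omega>. \<Sum>j\<in>J. c j * (Yn n j \<omega> - Y j \<omega>))) \<longlonglongrightarrow> 0"
      proof (rule msq_sum_tendsto_0[OF fin])
        fix j assume j: "j \<in> J"
        show m: "(\<lambda>\<omega>. c j * (Yn n j \<omega> - Y j \<omega>)) \<in> borel_measurable Q" for n
          using Ynm[OF sub[OF j]] Y[OF sub[OF j]] by simp
        have "(\<lambda>n. ennreal ((c j)\<^sup>2) * msq Q (\<lambda>\<omega>. Yn n j \<omega> - Y j \<omega>)) \<longlonglongrightarrow> ennreal ((c j)\<^sup>2) * 0"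
          by (intro ennreal_tendsto_cmult lim sub j) simp
        then show "(\<lambda>n. msq Q (\<lambda>\<omega>. c j * (Yn n j \<omega> - Y j \<omega>))) \<longlonglongrightarrow> 0"
          using Ynm[OF sub[OF j]] Y[OF sub[OF j]] by (simp add: msq_cmult)
      qed
      then have "(\<lambda>n. msq Q (\<lambda>\<omega>. (\<Sum>j\<in>J. c j * Yn n j \<omega>) - (\<Sum>j\<in>J. c j * Y j \<omega>))) \<longlonglongrightarrow> 0"
        by (simp add: right_diff_distrib sum_subtractf)
      then have "(\<lambda>n. LINT \<omega>|Q. cos ((\<Sum>j\<in>J. c j * Yn n j \<omega>) + \<phi>)) \<longlonglongrightarrow> (LINT \<omega>|Q. cos ((\<Sum>j\<in>J. c j * Y j \<omega>) + \<phi>))"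
        using sub Ynm Y by (intro prob_space.integral_cos_tendsto[OF Q]) auto
      moreover have "(\<lambda>n. LINT \<omega>|Q. cos ((\<Sum>j\<in>J. c j * Yn n j \<omega>) + \<phi>)) \<longlonglongrightarrow> (LINT \<omega>|P. cos ((\<Sum>j\<in>J. c j * S j \<omega>) + \<phi>))"
        unfolding YE SE by (intro tendsto_intros V) simp
      ultimately show "(LINT \<omega>|P. cos ((\<Sum>j\<in>J. c j * S j \<omega>) + \<phi>)) = (LINT \<omega>|Q. cos ((\<Sum>j\<in>J. c j * Y j \<omega>) + \<phi>))"
        by (rule LIMSEQ_unique[symmetric])
    qed (use sub S Y in auto)
  qed (use S Y in auto)
qed

context smooth_hurst_field
begin

definition euler_sum :: "(real \<Rightarrow> real) \<Rightarrow> nat \<Rightarrow> real \<Rightarrow> 'c \<Rightarrow> real" where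
  "euler_sum h n t \<omega> = (\<Sum>i<n. W (real (Suc i) * t / real n, h (real i * t / real n)) \<omega> - W (real i * t / real n, h (real i * t / real n)) \<omega>)"

lemma euler_sum_covariance:
  assumes h: "\<And>t. 0 \<le> t \<Longrightarrow> h t \<in> {a..b}" and t: "0 \<le> t" and s: "0 \<le> s"
  shows "integrable Q (\<lambda>\<omega>. euler_sum h n t \<omega> * euler_sum h n s \<omega>)"
    and "expectation (\<lambda>\<omega>. euler_sum h n t \<omega> * euler_sum h n s \<omega>) = (\<Sum>i<n. \<Sum>j<n.
      W_cov_rect R (real i * t / n) (real (Suc i) * t / n) (real j * s / n) (real (Suc j) * s / n) (h (real i * t / n)) (h (real j * s / n)))"
proof -
  have h': "h (real i * t / n) \<in> {a..b}" "h (real i * s / n) \<in> {a..b}" for i using h t s by simp_all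
  have nn: "0 \<le> real i * t / n" "0 \<le> real i * s / n" for i using t s by simp_all
  have eq: "euler_sum h n t \<omega> * euler_sum h n s \<omega> = (\<Sum>i<n. \<Sum>j<n.
      W (real (Suc i) * t / n, h (real i * t / n)) \<omega> * W (real (Suc j) * s / n, h (real j * s / n)) \<omega> -
      W (real i * t / n, h (real i * t / n)) \<omega> * W (real (Suc j) * s / n, h (real j * s / n)) \<omega> -
      W (real (Suc i) * t / n, h (real i * t / n)) \<omega> * W (real j * s / n, h (real j * s / n)) \<omega> +
      W (real i * t / n, h (real i * t / n)) \<omega> * W (real j * s / n, h (real j * s / n)) \<omega>)" for \<omega>
    unfolding euler_sum_def sum_product by (intro sum.cong refl) (simp only: right_diff_distrib left_diff_distrib)
  have I: "integrable Q (\<lambda>\<omega>. W (real k * t / n, h (real i * t / n)) \<omega> * W (real l * s / n, h (real j * s / n)) \<omega>)"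
    and E: "expectation (\<lambda>\<omega>. W (real k * t / n, h (real i * t / n)) \<omega> * W (real l * s / n, h (real j * s / n)) \<omega>) =
       W_cov R (real k * t / n) (real l * s / n) (h (real i * t / n)) (h (real j * s / n))" for k l i j
    by (rule W_mult_integrable W_covariance; rule nn h')+
  show "integrable Q (\<lambda>\<omega>. euler_sum h n t \<omega> * euler_sum h n s \<omega>)"
    unfolding eq by (intro Bochner_Integration.integrable_sum Bochner_Integration.integrable_add Bochner_Integration.integrable_diff I)
  show "expectation (\<lambda>\<omega>. euler_sum h n t \<omega> * euler_sum h n s \<omega>) = (\<Sum>i<n. \<Sum>j<n.
      W_cov_rect R (real i * t / n) (real (Suc i) * t / n) (real j * s / n) (real (Suc j) * s / n) (h (real i * t / n)) (h (real j * s / n)))"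
    unfolding eq W_cov_rect_def E[symmetric]
    by (simp only: Bochner_Integration.integral_sum Bochner_Integration.integral_add Bochner_Integration.integral_diff
        Bochner_Integration.integrable_sum Bochner_Integration.integrable_add Bochner_Integration.integrable_diff I)
qed

lemma AE_W_0: "x \<in> {a..b} \<Longrightarrow> AE \<omega> in Q. W (0, x) \<omega> = 0"
proof -
  assume x: "x \<in> {a..b}"
  have "expectation (\<lambda>\<omega>. W (0, x) \<omega> * W (0, x) \<omega>) = 0"
    using W_covariance[of 0 0 x x] x by (simp add: W_cov_def upper_integral_def)
  then have "AE \<omega> in Q. W (0, x) \<omega> * W (0, x) \<omega> = 0"
    using W_mult_integrable[of 0 0 x x] x by (subst (asm) integral_nonneg_eq_0_iff_AE) auto
  then show ?thesis by simp
qed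

lemma euler_sum_tendsto:
  assumes D: "L2_derivative D" and h: "\<And>t. 0 \<le> t \<Longrightarrow> h t \<in> {a..b}"
    and h_deriv: "\<And>t. 0 \<le> t \<Longrightarrow> (h has_vector_derivative h' t) (at t within {0..})"
    and h'c: "continuous_on {0..} h'" and t: "0 \<le> t"
    and Y: "AE \<omega> in Q. Y \<omega> = W (t, h t) \<omega> - (LBINT v:{0..t}. h' v * D v (h v) \<omega>)"
  shows "(\<lambda>n. msq Q (\<lambda>\<omega>. euler_sum h n t \<omega> - Y \<omega>)) \<longlonglongrightarrow> 0"
proof -
  have hc: "continuous_on {0..} h"
    unfolding continuous_on_eq_continuous_within using h_deriv by (auto intro: has_vector_derivative_continuous)
  define q q' where "q v = h (max 0 v)" and "q' v = h' (max 0 v)" for v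
  have [measurable]: "q \<in> borel_measurable borel" "q' \<in> borel_measurable borel"
    unfolding q_def q'_def
    by (auto intro!: borel_measurable_continuous_onI continuous_on_compose2[OF hc] continuous_on_compose2[OF h'c] continuous_intros)
  have "bounded (h' ` {0..t})"
    by (intro compact_imp_bounded compact_continuous_image continuous_on_subset[OF h'c]) auto
  then obtain K where K: "\<And>v. v \<in> {0..t} \<Longrightarrow> \<bar>h' v\<bar> \<le> K" by (auto simp: bounded_iff simp del: atLeastAtMost_iff)
  define L where "L = max 1 K"
  have hq: "q v = h v" "q' v = h' v" if "v \<in> {0..t}" for v using that by (simp_all add: q_def q'_def)
  have deriv: "(h has_vector_derivative h' v) (at v within {0..t})" if "v \<in> {0..t}" for v
    using h_deriv[of v] that by (auto intro: has_vector_derivative_within_subset)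
  have lip: "\<bar>h v - h w\<bar> \<le> L * \<bar>v - w\<bar>" if "v \<in> {0..t}" "w \<in> {0..t}" for v w
  proof -
    have "norm (h v - h w) \<le> L * norm (v - w)"
      by (rule field_differentiable_bound[where S="{0..t}" and f'=h'])
        (use that K deriv in \<open>force simp: has_real_derivative_iff_has_vector_derivative L_def le_max_iff_disj\<close>)+
    then show ?thesis by simp
  qed
  let ?Z = "\<lambda>n \<omega>. (\<Sum>i<n. W (0 + real (Suc i) * (t - 0) / real n, q (0 + real (Suc i) * (t - 0) / real n)) \<omega> 
      - W (0 + real (Suc i) * (t - 0) / real n, q (0 + real i * (t - 0) / real n)) \<omega>) -
      (LBINT v:{0..t}. q' v * D v (q v) \<omega>)"
  have lim: "(\<lambda>n. msq Q (?Z n)) \<longlonglongrightarrow> 0"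
  proof (rule telescoping_sum_tendsto[where p="\<lambda>v. v" and T=t and L=L, OF D t t])
    show "(q has_vector_derivative q' v) (at v within {0..t})" if "v \<in> {0..t}" for v
      using deriv[OF that] hq(2)[OF that] hq(1) that
      by (auto intro: has_vector_derivative_transform[where f=h])
    show "q v \<in> {a..b}" if "v \<in> {0..t}" for v using h[of v] that by (simp add: hq)
  qed (use lip hq K in \<open>auto simp: L_def le_max_iff_disj abs_minus_commute simp del: atLeastAtMost_iff intro: mult_right_mono[of 1 "max 1 K", simplified]\<close>)
  have eq: "AE \<omega> in Q. euler_sum h n t \<omega> - Y \<omega> = (-1) * ?Z n \<omega>" if n: "n > 0" for n
    using Y AE_W_0[OF h[OF order_refl]]
  proof eventually_elim
    case (elim \<omega>)
    have q: "q (real i * t / real n) = h (real i * t / real n)" for i using t by (simp add: q_def)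
    have int: "(LBINT v:{0..t}. q' v * D v (q v) \<omega>) = (LBINT v:{0..t}. h' v * D v (h v) \<omega>)"
      by (rule set_lebesgue_integral_cong) (use hq in auto)
    have "W (t, h t) \<omega> = (\<Sum>i<n. W (real (Suc i) * t / real n, h (real (Suc i) * t / real n)) \<omega> - W (real i * t / real n, h (real i * t / real n)) \<omega>)"
      using sum_lessThan_telescope[of "\<lambda>i. W (real i * t / real n, h (real i * t / real n)) \<omega>" n] n elim(2) by simp
    also have "\<dots> = (\<Sum>i<n. W (real (Suc i) * t / real n, h (real (Suc i) * t / real n)) \<omega> - W (real (Suc i) * t / real n, h (real i * t / real n)) \<omega>) + euler_sum h n t \<omega>"
      unfolding euler_sum_def by (simp add: sum.distrib[symmetric])
    finally show ?case unfolding elim(1) int q by (simp add: q del: of_nat_Suc)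
  qed
  have "\<forall>\<^sub>F n in sequentially. msq Q (?Z n) = msq Q (\<lambda>\<omega>. euler_sum h n t \<omega> - Y \<omega>)"
  proof (rule eventually_sequentiallyI[of 1])
    fix n :: nat assume "1 \<le> n"
    then have n: "n > 0" by simp
    show "msq Q (?Z n) = msq Q (\<lambda>\<omega>. euler_sum h n t \<omega> - Y \<omega>)"
      unfolding msq_def by (rule nn_integral_cong_AE) (use eq[OF n] in \<open>eventually_elim, simp only: power_mult_distrib, simp\<close>)
  qed
  from Lim_transform_eventually[OF lim this] show ?thesis .
qed

end

lemma times_cont_diff_on_2_derivative:
  fixes h :: "real \<Rightarrow> real"
  assumes "times_cont_diff_on 2 h S"
  obtains h' where "\<And>t. t \<in> S \<Longrightarrow> (h has_vector_derivative h' t) (at t within S)" "continuous_on S h'"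
proof -
  from assms obtain D where D: "\<And>x. x \<in> S \<Longrightarrow> (h has_derivative D x) (at x within S)"
    and D1: "\<And>v. v \<in> Basis \<Longrightarrow> times_cont_diff_on (Suc 0) (\<lambda>x. D x v) S"
    unfolding numeral_2_eq_2 times_cont_diff_on.simps(2)[of "Suc 0"] by blast
  show thesis
  proof (rule that[of "\<lambda>t. D t 1"])
    show "continuous_on S (\<lambda>t. D t 1)" by (rule times_cont_diff_on_imp_continuous_on[OF D1]) simp
    fix t assume t: "t \<in> S"
    have "D t r = r *\<^sub>R D t 1" for r
      using linear_scale[OF has_derivative_linear[OF D[OF t]], of r 1] by simp
    then have "D t = (\<lambda>r. r *\<^sub>R D t 1)" by (rule ext)
    then show "(h has_vector_derivative D t 1) (at t within S)"
      using D[OF t] unfolding has_vector_derivative_def by metis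
  qed
qed

lemma at_within_Ici_neq_bot: "0 \<le> t \<Longrightarrow> at t within {0..} \<noteq> (bot :: real filter)"
proof -
  assume "0 \<le> t"
  then have "at_right t \<le> at t within {0..}" by (intro at_le) auto
  then show ?thesis using trivial_limit_at_right_real[of t] by (auto simp: bot_unique)
qed

theorem theorem5:
  fixes a b :: real
    and R :: "real \<times> real \<Rightarrow> real"
    and h :: "real \<Rightarrow> real"
    and M :: "'a measure" and X :: "nat \<Rightarrow> real \<Rightarrow> 'a \<Rightarrow> real"
    and P :: "'b measure" and S :: "real \<Rightarrow> 'b \<Rightarrow> real"
    and Q :: "'c measure" and W :: "real \<times> real \<Rightarrow> 'c \<Rightarrow> real"
  assumes "1/2 < a" and "a \<le> b" and "b < 1"
    and "asymptotic_covariance a b R"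
    and "h \<in> {0..} \<rightarrow> {a..b}"
    and "times_cont_diff_on 3 R ({a..b} \<times> {a..b})"
    and "times_cont_diff_on 2 h {0..}"
    and "in_G a b R M X"
    and "is_S_tilde R h M X P S"
    and "is_W_tilde a b R M X Q W"
  shows "\<exists>W'. is_modification ({0..} \<times> {a..b}) Q W' W \<and>
           (\<forall>\<omega> \<in> space Q.
              (\<forall>\<theta>\<ge>0. (\<lambda>H. W' (\<theta>, H) \<omega>) differentiable (at (h \<theta>) within {a..b})) \<and>
              (\<forall>t\<ge>0. set_integrable lborel {0..t} (W_integrand a b h W' \<omega>))) \<and>
           fdd_equal {0..} P S Q
             (\<lambda>t \<omega>. W' (t, h t) \<omega> - (LBINT \<theta>:{0..t}. W_integrand a b h W' \<omega> \<theta>))"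
proof -
  have h: "h t \<in> {a..b}" if "0 \<le> t" for t using assms(5) that by auto
  have S: "centered_gaussian_field P {0..} S"
    "\<And>t s. 0 \<le> t \<Longrightarrow> 0 \<le> s \<Longrightarrow> (LINT \<omega>|P. S t \<omega> * S s \<omega>) =
        (LBINT \<theta>:{0..t}. (LBINT \<sigma>:{0..s}. cov_kernel R (h \<theta>) (h \<sigma>) \<theta> \<sigma>))"
    using assms(9) by (auto simp: is_S_tilde_def cov_kernel_def)
  have W: "centered_gaussian_field Q ({0..} \<times> {a..b}) W"
    "\<And>t s x y. 0 \<le> t \<Longrightarrow> 0 \<le> s \<Longrightarrow> x \<in> {a..b} \<Longrightarrow> y \<in> {a..b} \<Longrightarrow> (LINT \<omega>|Q. W (t, x) \<omega> * W (s, y) \<omega>) = W_cov R t s x y"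
    using assms(10) by (auto simp: is_W_tilde_def W_cov_eq)
  have Q: "prob_space Q" using W(1) by (simp add: centered_gaussian_field_def)
  have Wn: "centered_normal Q (W (t, x))" if "0 \<le> t" "x \<in> {a..b}" for t x
    using that by (intro centered_normal_lincomb[OF W(1)] lincomb_member) auto
  interpret smooth_hurst_field Q a b R W
  proof (intro smooth_hurst_field.intro smooth_hurst_field_axioms.intro Q assms(1-3,6) W(2))
    fix t x :: real assume "0 \<le> t" "x \<in> {a..b}"
    from Wn[OF this] show "W (t, x) \<in> borel_measurable Q" "integrable Q (\<lambda>\<omega>. (W (t, x) \<omega>)\<^sup>2)"
      using centered_normal_square_integrable[OF Q] by (auto simp: centered_normal_def)
  qed
  obtain D where D: "L2_derivative D" using L2_derivative_exists by blast
  obtain h' where h': "\<And>t. 0 \<le> t \<Longrightarrow> (h has_vector_derivative h' t) (at t within {0..})" and h'c: "continuous_on {0..} h'"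
    using times_cont_diff_on_2_derivative[OF assms(7)] by (metis atLeast_iff)
  have hc: "continuous_on {0..} h"
    unfolding continuous_on_eq_continuous_within using h' by (auto intro: has_vector_derivative_continuous)
  have vd_h: "vector_derivative h (at t within {0..}) = h' t" if "0 \<le> t" for t
    using at_within_Ici_neq_bot[OF that] h'[OF that] by (rule vector_derivative_within)
  obtain Ds where Dsm[measurable]: "(\<lambda>(t, \<omega>). Ds t \<omega>) \<in> borel_measurable (borel \<Otimes>\<^sub>M Q)"
    and Ds_eq: "AE \<omega> in Q. \<forall>t\<ge>0. Ds t \<omega> = D t (h t) \<omega>"
    and Ds_int: "\<And>\<omega> t. \<omega> \<in> space Q \<Longrightarrow> 0 \<le> t \<Longrightarrow> set_integrable lborel {0..t} (\<lambda>v. Ds v \<omega>)"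
    by (rule pathwise_derivative_exists[OF D h hc]) (assumption, rule that)
  obtain W' where mod: "is_modification ({0..} \<times> {a..b}) Q W' W"
    and W'_deriv: "\<And>\<omega> t. \<omega> \<in> space Q \<Longrightarrow> 0 \<le> t \<Longrightarrow> ((\<lambda>x. W' (t, x) \<omega>) has_vector_derivative Ds t \<omega>) (at (h t) within {a..b})"
  proof (rule modification_exists[OF D h])
    show "Ds t \<in> borel_measurable Q" for t using measurable_compose[of "\<lambda>\<omega>. (t, \<omega>)", OF _ Dsm] by auto
    show "AE \<omega> in Q. Ds t \<omega> = D t (h t) \<omega>" if "0 \<le> t" for t using Ds_eq by eventually_elim (use that in blast)
  qed (assumption | rule that)+
  have integrand: "W_integrand a b h W' \<omega> t = h' t * Ds t \<omega>" if \<omega>: "\<omega> \<in> space Q" and t: "0 \<le> t" for \<omega> t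
  proof (cases "a < b")
    case True
    have "vector_derivative (\<lambda>x. W' (t, x) \<omega>) (at (h t) within {a..b}) = Ds t \<omega>"
      using vector_derivative_within_closed_interval[OF True h[OF t] W'_deriv[OF \<omega> t]] .
    then show ?thesis by (simp add: W_integrand_def partial_H_def vd_h[OF t])
  next
    case False
    then have "h s = a" if "0 \<le> s" for s using h[OF that] assms(2) by auto
    then have "(h has_vector_derivative 0) (at t within {0..})"
      using t by (auto intro: has_vector_derivative_transform[OF _ _ has_vector_derivative_const])
    then have "h' t = 0"
      using vector_derivative_within[OF at_within_Ici_neq_bot[OF t]] vd_h[OF t] by metis
    then show ?thesis by (simp add: W_integrand_def vd_h[OF t])
  qed
  define q' where "q' v = h' (max 0 v)" for v
  have q'm[measurable]: "q' \<in> borel_measurable borel"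
    unfolding q'_def by (auto intro!: borel_measurable_continuous_onI continuous_on_compose2[OF h'c] continuous_intros)
  have integrand_int: "set_integrable lborel {0..t} (\<lambda>v. q' v * Ds v \<omega>)" if \<omega>: "\<omega> \<in> space Q" and t: "0 \<le> t" for \<omega> t
  proof -
    have "bounded (h' ` {0..t})"
      by (intro compact_imp_bounded compact_continuous_image continuous_on_subset[OF h'c]) auto
    then obtain K where K: "\<And>v. v \<in> {0..t} \<Longrightarrow> \<bar>h' v\<bar> \<le> K" by (auto simp: bounded_iff simp del: atLeastAtMost_iff)
    have "(\<lambda>v. Ds v \<omega>) \<in> borel_measurable borel" using \<omega> by measurable
    then show ?thesis
      using K by (intro set_integrable_bounded_mult[OF q'm _ Ds_int[OF \<omega> t]]) (auto simp: q'_def)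
  qed
  have integral_eq: "(LBINT v:{0..t}. W_integrand a b h W' \<omega> v) = (LBINT v:{0..t}. q' v * Ds v \<omega>)" if "\<omega> \<in> space Q" for \<omega> t
    using that by (intro set_lebesgue_integral_cong) (auto simp: integrand q'_def)
  let ?Y = "\<lambda>t \<omega>. W' (t, h t) \<omega> - (LBINT \<theta>:{0..t}. W_integrand a b h W' \<omega> \<theta>)"
  have Rc: "continuous_on ({a..b} \<times> {a..b}) R" by (rule times_cont_diff_on_imp_continuous_on[OF assms(6)])
  have "fdd_equal {0..} P S Q ?Y"
  proof (rule fdd_equal_of_L2_limit[OF S(1) Q W(1), where Yn="euler_sum h"])
    fix t :: real assume "t \<in> {0..}"
    then have t: "0 \<le> t" by simp
    have mt: "W' (t, h t) \<in> borel_measurable Q" "AE \<omega> in Q. W' (t, h t) \<omega> = W (t, h t) \<omega>"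
      using mod t h[OF t] by (auto simp: is_modification_def)
    have "(\<lambda>p. q' (fst p) * (\<lambda>(t, \<omega>). Ds t \<omega>) p) \<in> borel_measurable (borel \<Otimes>\<^sub>M Q)" by measurable
    then have "(\<lambda>\<omega>. W' (t, h t) \<omega> - (LBINT v:{0..t}. q' v * Ds v \<omega>)) \<in> borel_measurable Q"
      by (intro borel_measurable_diff LBINT_measurable mt(1)) (simp add: split_beta)
    then show "?Y t \<in> borel_measurable Q" by (subst measurable_cong) (auto simp: integral_eq)
    show "lincomb ({0..} \<times> {a..b}) W (euler_sum h n t)" for n
      unfolding euler_sum_def[abs_def] using t h
      by (intro lincomb_sum lincomb_diff lincomb_member) auto
    have "AE \<omega> in Q. ?Y t \<omega> = W (t, h t) \<omega> - (LBINT v:{0..t}. h' v * D v (h v) \<omega>)"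
      using mt(2) Ds_eq AE_space
    proof eventually_elim
      case (elim \<omega>)
      have "(LBINT v:{0..t}. q' v * Ds v \<omega>) = (LBINT v:{0..t}. h' v * D v (h v) \<omega>)"
        using elim(2) by (intro set_lebesgue_integral_cong) (auto simp: q'_def)
      then show ?case using elim by (simp add: integral_eq)
    qed
    then show "(\<lambda>n. msq Q (\<lambda>\<omega>. euler_sum h n t \<omega> - ?Y t \<omega>)) \<longlonglongrightarrow> 0"
      by (intro euler_sum_tendsto[OF D h h' h'c t])
    fix s :: real assume "s \<in> {0..}"
    then have s: "0 \<le> s" by simp
    show "integrable Q (\<lambda>\<omega>. euler_sum h n t \<omega> * euler_sum h n s \<omega>)" for n
      by (rule euler_sum_covariance(1)[OF h t s])
    show "(\<lambda>n. LINT \<omega>|Q. euler_sum h n t \<omega> * euler_sum h n s \<omega>) \<longlonglongrightarrow> (LINT \<omega>|P. S t \<omega> * S s \<omega>)"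
      unfolding S(2)[OF t s]
      by (subst euler_sum_covariance(2)[OF h t s], assumption)
        (rule covariance_sum_tendsto[OF assms(1-3) h hc Rc t s])
  qed
  moreover have "(\<lambda>x. W' (t, x) \<omega>) differentiable (at (h t) within {a..b})" if "\<omega> \<in> space Q" "0 \<le> t" for \<omega> t
    using W'_deriv[OF that] by (auto intro: differentiableI_vector)
  moreover have "set_integrable lborel {0..t} (W_integrand a b h W' \<omega>)" if "\<omega> \<in> space Q" "0 \<le> t" for \<omega> t
    using integrand_int[OF that] that(1)
    by (subst set_integrable_cong[where f'="\<lambda>v. q' v * Ds v \<omega>" and M'=lborel and A'="{0..t}"]) (auto simp: integrand q'_def)
  ultimately show ?thesis using mod by blast
qed

end
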